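(* Let $(\pi^{(\mu)},\mathscr{B}^{(\mu)})$ be a non-trivial finite-dimensional irreducible representation of $\mathrm{SU}(d)$ with highest weight $\mu$, and let $\mathcal{G}<\mathrm{SU}(d)$ be a finite subgroup. Then $\mathcal{G}$ is an inaccessible symmetry for $\mathscr{B}^{(\mu)}$ if and only if the trivial irreducible representation of $\mathcal{G}$ does not appear in the decomposition of the restriction $\pi^{(\mu)}|_{\mathcal{G}}$ into irreducible representations of $\mathcal{G}$, that is, if and only if its multiplicity $$a_1=\frac{1}{|\mathcal{G}|}\sum_{g\in\mathcal{G}}\chi_{(\mu)}(g)$$ is equal to zero, where $\chi_{(\mu)}$ is the character of $\pi^{(\mu)}$, given by the Weyl character formula.
   Context: Inaccessible symmetry: for a non-trivial representation $(\pi,V)$ of $\mathrm{SU}(d)$, a finite subgroup $\mathcal{G}<\mathrm{SU}(d)$ is an inaccessible symmetry for $V$ if the $\mathcal{G}$-invariant subspace $\{v\in V:\pi(g)v=v\ \forall g\in\mathcal{G}\}$ is either the zero subspace or (when $V$ is a space of operators on which $\mathrm{SU}(d)$ acts by conjugation) the span of the identity operator. In the application, $\mathscr{B}^{(\mu)}$ is an irreducible component of the operator space $\mathcal{B}(\mathcal{H}_S)$ under conjugation. Weyl character formula: for $H$ in the Cartan subalgebra (diagonal matrices), $$\chi_{(\mu)}(e^{H})=\frac{\sum_{w\in W}\det(w)\,e^{\langle w\cdot(\mu+\delta),H\rangle}}{\sum_{w\in W}\det(w)\,e^{\langle w\cdot\delta,H\rangle}},$$ (extended by continuity where the denominator vanishes),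 where $W$ is the Weyl group, $\delta$ is half the sum of the positive roots and $\langle X,Y\rangle=\mathrm{Tr}[X^*Y]$; the values at other elements follow from invariance of the character under conjugation in $\mathrm{SU}(d)$. *)

theory Defs
  imports "HOL-Analysis.Analysis" "HOL-Algebra.Coset" "HOL-Combinatorics.Permutations"
begin

section \<open>The groups\<close>

definition ctranspose :: "complex^'n^'n \<Rightarrow> complex^'n^'n" where
  "ctranspose A = map_matrix cnj (transpose A)"

definition SU :: "(complex^'n^'n) monoid" where
  "SU = \<lparr>carrier = {A. A ** ctranspose A = mat 1 \<and> det A = 1}, mult = (**), one = mat 1\<rparr>"

definition GL :: "(complex^'m^'m) monoid" where
  "GL = \<lparr>carrier = {A. invertible A}, mult = (**), one = mat 1\<rparr>"

section \<open>Finite-dimensional representations\<close>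

text \<open>A representation is a continuous homomorphism, written in a basis of its space.  Functions
  on the group are total functions on matrices; only their values on the group matter.\<close>

definition is_representation :: "(complex^'n^'n \<Rightarrow> complex^'m^'m) \<Rightarrow> bool" where
  "is_representation \<pi> \<longleftrightarrow> \<pi> \<in> hom SU GL \<and> continuous_on (carrier SU) \<pi>"

definition nontrivial :: "(complex^'n^'n \<Rightarrow> complex^'m^'m) \<Rightarrow> bool" where
  "nontrivial \<pi> \<longleftrightarrow> (\<exists>g\<in>carrier SU. \<pi> g \<noteq> mat 1)"

definition character :: "(complex^'n^'n \<Rightarrow> complex^'m^'m) \<Rightarrow> complex^'n^'n \<Rightarrow> complex" where
  "character \<pi> g = trace (\<pi> g)"

text \<open>The set \<open>K\<close> below is the group to which \<open>\<pi>\<close> is restricted.\<close>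

definition subrepresentation ::
    "(complex^'n^'n \<Rightarrow> complex^'m^'m) \<Rightarrow> (complex^'n^'n) set \<Rightarrow> (complex^'m) set \<Rightarrow> bool" where
  "subrepresentation \<pi> K W \<longleftrightarrow> vec.subspace W \<and> (\<forall>g\<in>K. \<forall>w\<in>W. \<pi> g *v w \<in> W)"

definition irreducible_on ::
    "(complex^'n^'n \<Rightarrow> complex^'m^'m) \<Rightarrow> (complex^'n^'n) set \<Rightarrow> (complex^'m) set \<Rightarrow> bool" where
  "irreducible_on \<pi> K W \<longleftrightarrow>
     subrepresentation \<pi> K W \<and> W \<noteq> {0} \<and>
     (\<forall>U. subrepresentation \<pi> K U \<and> U \<subseteq> W \<longrightarrow> U = {0} \<or> U = W)"

text \<open>\<open>W\<close> is isomorphic to the trivial irreducible representation.\<close>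

definition trivial_irrep_on ::
    "(complex^'n^'n \<Rightarrow> complex^'m^'m) \<Rightarrow> (complex^'n^'n) set \<Rightarrow> (complex^'m) set \<Rightarrow> bool" where
  "trivial_irrep_on \<pi> K W \<longleftrightarrow>
     subrepresentation \<pi> K W \<and> vec.dim W = 1 \<and> (\<forall>g\<in>K. \<forall>w\<in>W. \<pi> g *v w = w)"

text \<open>The whole space is the internal direct sum of the members of \<open>D\<close>.  Isomorphic but
  different summands are different members of \<open>D\<close>, so multiplicities are cardinalities.\<close>

definition irreducible_decomposition ::
    "(complex^'n^'n \<Rightarrow> complex^'m^'m) \<Rightarrow> (complex^'n^'n) set \<Rightarrow> (complex^'m) set set \<Rightarrow> bool" where
  "irreducible_decomposition \<pi> K D \<longleftrightarrow>
     finite D \<and> (\<forall>W\<in>D. irreducible_on \<pi> K W) \<and>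
     (\<forall>v. \<exists>!f. f \<in> (\<Pi>\<^sub>E W\<in>D. W) \<and> v = (\<Sum>W\<in>D. f W))"

section \<open>Inaccessible symmetries\<close>

definition invariants ::
    "(complex^'n^'n \<Rightarrow> complex^'m^'m) \<Rightarrow> (complex^'n^'n) set \<Rightarrow> (complex^'m) set" where
  "invariants \<pi> K = {v. \<forall>g\<in>K. \<pi> g *v v = v}"

text \<open>The space of \<open>\<pi>\<close> is identified by \<open>\<Phi>\<close> with a space of operators on \<open>complex^'h\<close>,
  on which the group acts by conjugation through a representation on \<open>complex^'h\<close>.
  The matrix \<open>mat c\<close> is \<open>c\<close> times the identity.\<close>

definition operator_space ::
    "(complex^'n^'n \<Rightarrow> complex^'m^'m) \<Rightarrow> (complex^'m \<Rightarrow> complex^'h^'h) \<Rightarrow> bool" where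
  "operator_space \<pi> \<Phi> \<longleftrightarrow>
     (\<forall>v w. \<Phi> (v + w) = \<Phi> v + \<Phi> w) \<and> (\<forall>c v. \<Phi> (c *s v) = mat c ** \<Phi> v) \<and> inj \<Phi> \<and>
     (\<exists>U. is_representation U \<and>
        (\<forall>g\<in>carrier SU. \<forall>v. \<Phi> (\<pi> g *v v) = U g ** \<Phi> v ** matrix_inv (U g)))"

text \<open>If \<open>\<Phi>\<close> does not make the space of \<open>\<pi>\<close> a space of operators, the second alternative is
  void.\<close>

definition inaccessible_symmetry ::
    "(complex^'n^'n \<Rightarrow> complex^'m^'m) \<Rightarrow> (complex^'m \<Rightarrow> complex^'h^'h) \<Rightarrow>
      (complex^'n^'n) set \<Rightarrow> bool" where
  "inaccessible_symmetry \<pi> \<Phi> K \<longleftrightarrow>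
     invariants \<pi> K = {0} \<or> (operator_space \<pi> \<Phi> \<and> \<Phi> ` invariants \<pi> K = range mat)"

section \<open>Weights and the Weyl character formula\<close>

text \<open>Diagonal matrices are represented by the vectors of their diagonal entries.  The elements
  \<open>H\<close> of the Cartan subalgebra of the Lie algebra of \<open>SU\<close> are the traceless skew-Hermitian
  diagonal matrices; weights and roots are traceless real diagonal matrices, paired with \<open>H\<close> by
  \<open>Tr (X\<^sup>* H)\<close>.\<close>

definition diagonal :: "complex^'n \<Rightarrow> complex^'n^'n" where
  "diagonal h = (\<chi> i j. if i = j then h $ i else 0)"

definition cartan :: "(complex^'n) set" where
  "cartan = {h. (\<forall>i. Re (h $ i) = 0) \<and> (\<Sum>i\<in>UNIV. h $ i) = 0}"

definition pairing :: "real^'n \<Rightarrow> complex^'n \<Rightarrow> complex" where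
  "pairing x h = trace (ctranspose (diagonal (\<chi> i. complex_of_real (x $ i))) ** diagonal h)"

definition exp_diagonal :: "complex^'n \<Rightarrow> complex^'n^'n" where
  "exp_diagonal h = diagonal (\<chi> i. exp (h $ i))"

definition is_weight :: "(complex^'n^'n \<Rightarrow> complex^'m^'m) \<Rightarrow> real^'n \<Rightarrow> bool" where
  "is_weight \<pi> \<nu> \<longleftrightarrow>
     (\<Sum>i\<in>UNIV. \<nu> $ i) = 0 \<and>
     (\<exists>v. v \<noteq> 0 \<and> (\<forall>h\<in>cartan. \<pi> (exp_diagonal h) *v v = exp (pairing \<nu> h) *s v))"

definition positive_roots :: "(real^'n::{finite,linorder}) set" where
  "positive_roots = {axis i 1 - axis j 1 | i j. i < j}"

definition highest_weight ::
    "(complex^'n::{finite,linorder}^'n::{finite,linorder} \<Rightarrow> complex^'m^'m) \<Rightarrow>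
      real^'n::{finite,linorder} \<Rightarrow> bool" where
  "highest_weight \<pi> \<mu> \<longleftrightarrow>
     is_weight \<pi> \<mu> \<and>
     (\<forall>\<nu>. is_weight \<pi> \<nu> \<longrightarrow>
        (\<exists>a. (\<forall>\<alpha>\<in>positive_roots. a \<alpha> \<ge> 0) \<and> \<mu> - \<nu> = (\<Sum>\<alpha>\<in>positive_roots. a \<alpha> *\<^sub>R \<alpha>)))"

definition weyl_vector :: "real^'n::{finite,linorder}" where
  "weyl_vector = (1 / 2) *\<^sub>R (\<Sum>\<alpha>\<in>positive_roots. \<alpha>)"

text \<open>The Weyl group is the symmetric group permuting the diagonal entries; the determinant of a
  Weyl group element is the sign of the permutation.\<close>

definition weyl_act :: "('n \<Rightarrow> 'n) \<Rightarrow> real^'n \<Rightarrow> real^'n" where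
  "weyl_act w x = (\<chi> i. x $ inv_into UNIV w i)"

definition alternating_sum :: "real^'n \<Rightarrow> complex^'n \<Rightarrow> complex" where
  "alternating_sum x h =
     (\<Sum>w | w permutes (UNIV :: 'n set). of_int (sign w) * exp (pairing (weyl_act w x) h))"

definition weyl_regular :: "(complex^'n::{finite,linorder}) set" where
  "weyl_regular = {h\<in>cartan. alternating_sum weyl_vector h \<noteq> 0}"

definition weyl_quotient :: "real^'n::{finite,linorder} \<Rightarrow> complex^'n::{finite,linorder} \<Rightarrow> complex" where
  "weyl_quotient \<mu> h = alternating_sum (\<mu> + weyl_vector) h / alternating_sum weyl_vector h"

text \<open>\<open>X\<close> is the function on \<open>SU\<close> given by the Weyl character formula for \<open>\<mu>\<close>: by the quotient
  where its denominator does not vanish, by continuous extension of the quotient on the rest of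
  the torus, and by conjugation invariance elsewhere.\<close>

definition given_by_weyl_formula ::
    "real^'n::{finite,linorder} \<Rightarrow>
      (complex^'n::{finite,linorder}^'n::{finite,linorder} \<Rightarrow> complex) \<Rightarrow> bool" where
  "given_by_weyl_formula \<mu> X \<longleftrightarrow>
     (\<forall>h\<in>weyl_regular. X (exp_diagonal h) = weyl_quotient \<mu> h) \<and>
     (\<forall>h\<in>cartan. (weyl_quotient \<mu> \<longlongrightarrow> X (exp_diagonal h)) (at h within weyl_regular)) \<and>
     (\<forall>g\<in>carrier SU. \<forall>u\<in>carrier SU. X (u ** g ** matrix_inv u) = X g)"

end

theory Submission
  imports Defs "HOL-Computational_Algebra.Polynomial"
begin

text \<open>
  By Maschke's theorem the restriction to \<open>G\<close> decomposes, and averaging over \<open>G\<close> projects onto the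
  invariants, so its trace, the mean of the character, is their dimension.  An invariant
  operator equal to the identity would span an \<open>SU\<close>-invariant line, which irreducibility excludes.

  Weyl's formula is obtained without Haar measure, from the Casimir operator.  A continuous
  representation is differentiable along one-parameter subgroups; its complexified derivative gives operators
  \<open>E i j\<close> satisfying the commutation relations of matrix units, and lowering a highest weight vector
  generates the whole space, because torus elements and plane rotations generate \<open>SU\<close>.  Hence there
  is a basis of weight vectors in which the highest weight \<open>\<mu>\<close> occurs once, and \<open>\<Sum>i j. E i j E j i\<close> is
  the scalar \<open>\<langle>\<mu>, \<mu> + 2\<delta>\<rangle>\<close>.  For a regular torus element \<open>t\<close> cyclicity of the trace gives
  \<open>(1 - t\<^sub>i/t\<^sub>j) Tr (E i j E j i t) = - (t\<^sub>i/t\<^sub>j) Tr ((E i i - E j j) t)\<close>, so the trace of the Casimir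
  operator times \<open>t\<close> becomes a differential equation for the character: its product with the Weyl
  denominator is an eigenfunction of the flat Laplacian with eigenvalue \<open>\<parallel>\<mu> + \<delta>\<parallel>\<^sup>2\<close>.  An
  antisymmetric exponential sum with that eigenvalue and leading exponent \<open>\<mu> + \<delta>\<close> can only be the
  alternating sum over the Weyl orbit of \<open>\<mu> + \<delta>\<close>.
\<close>

section \<open>Special unitary matrices and their representations\<close>

text \<open>Two obstacles shape the analytic half. A representation is only assumed continuous, so
  curves in SU with the same velocity might a priori have images with different derivatives, or
  none. Derivatives therefore start as a relation between velocities, fed by explicit one-parameter
  subgroups and closed under products of curves; that it is single-valued is a separate estimate. No
  matrix exponential is used: a subspace stable under the derivative of a one-parameter group is
  shown stable under the group by an ODE argument. The Casimir operator is that of gl_n, with the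
  identity matrix acting as 0. As weights have trace zero, \<open>E i i\<close> then acts on a
  vector of weight \<nu> by \<open>\<nu>$i\<close>. The shift by 2\<delta> in the eigenvalue comes
  from moving raising operators to the right, each pair \<open>i < j\<close> contributing
  \<open>\<mu>$i - \<mu>$j\<close>. In the equation for the character the off-diagonal terms give
  first derivatives weighted by twice the logarithmic derivative of the Weyl denominator, which is
  why multiplying by the denominator leaves the flat Laplacian.\<close>

lemma carrier_SU: "A \<in> carrier SU \<longleftrightarrow> A ** ctranspose A = mat 1 \<and> det A = 1"
  by (simp add: SU_def)

lemma mult_SU [simp]: "A \<otimes>\<^bsub>SU\<^esub> B = A ** B"
  by (simp add: SU_def)

lemma one_SU [simp]: "\<one>\<^bsub>SU\<^esub> = mat 1"
  by (simp add: SU_def)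

lemma ctranspose_nth: "ctranspose A$i$j = cnj (A$j$i)"
  by (simp add: ctranspose_def transpose_def)

lemma ctranspose_mult: "ctranspose (A ** B) = ctranspose B ** ctranspose A"
  by (simp add: vec_eq_iff ctranspose_nth matrix_matrix_mult_def mult.commute)

lemma ctranspose_ctranspose [simp]: "ctranspose (ctranspose A) = A"
  by (simp add: vec_eq_iff ctranspose_nth)

lemma ctranspose_mat_1 [simp]: "ctranspose (mat 1) = mat 1"
  by (auto simp: vec_eq_iff ctranspose_nth mat_def)

lemma det_ctranspose: "det (ctranspose A) = cnj (det A)"
proof -
  have "det (map_matrix cnj B) = cnj (det B)" for B :: "complex^'n^'n"
    by (simp add: det_def)
  from this[of "transpose A"] show ?thesis by (simp only: ctranspose_def det_transpose)
qed

lemma SU_ctranspose_mult: "A \<in> carrier SU \<Longrightarrow> ctranspose A ** A = mat 1"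
  by (simp add: carrier_SU matrix_left_right_inverse)

lemma SU_mult_ctranspose: "A \<in> carrier SU \<Longrightarrow> A ** ctranspose A = mat 1"
  by (simp add: carrier_SU)

lemma SU_closed: "A \<in> carrier SU \<Longrightarrow> B \<in> carrier SU \<Longrightarrow> A ** B \<in> carrier SU"
proof -
  assume A: "A \<in> carrier SU" and B: "B \<in> carrier SU"
  have "(A ** B) ** ctranspose (A ** B) = A ** (B ** ctranspose B) ** ctranspose A"
    by (simp add: ctranspose_mult matrix_mul_assoc)
  then show ?thesis using A B by (simp add: carrier_SU det_mul)
qed

lemma SU_ctranspose: "A \<in> carrier SU \<Longrightarrow> ctranspose A \<in> carrier SU"
  using SU_ctranspose_mult[of A] by (simp add: carrier_SU det_ctranspose)

lemma SU_one: "mat 1 \<in> carrier SU"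
  by (simp add: carrier_SU)

lemma group_SU: "group SU"
  by (rule groupI) (auto simp: SU_closed SU_one matrix_mul_assoc
      intro: SU_ctranspose SU_ctranspose_mult bexI[OF _ SU_ctranspose])

lemma inv_SU: "A \<in> carrier SU \<Longrightarrow> inv\<^bsub>SU\<^esub> A = ctranspose A"
  by (rule group.inv_equality[OF group_SU]) (auto simp: SU_ctranspose_mult SU_ctranspose)

lemma matrix_inv_right: "invertible A \<Longrightarrow> A ** matrix_inv A = mat 1"
  unfolding invertible_def matrix_inv_def by (rule someI2_ex) auto

lemma matrix_inv_SU: "A \<in> carrier SU \<Longrightarrow> matrix_inv A = ctranspose A"
proof -
  assume A: "A \<in> carrier SU"
  then have "invertible A" using SU_mult_ctranspose SU_ctranspose_mult by (auto simp: invertible_def)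
  then have "A ** matrix_inv A = mat 1" by (simp add: matrix_inv_right)
  then have "ctranspose A ** (A ** matrix_inv A) = ctranspose A" by simp
  then show ?thesis by (simp add: matrix_mul_assoc SU_ctranspose_mult[OF A])
qed

lemma rep_mult:
  assumes "is_representation \<pi>" "g \<in> carrier SU" "h \<in> carrier SU"
  shows "\<pi> (g ** h) = \<pi> g ** \<pi> h"
  using assms hom_mult[of \<pi> SU GL g h] by (simp add: is_representation_def GL_def)

lemma rep_invertible: "is_representation \<pi> \<Longrightarrow> g \<in> carrier SU \<Longrightarrow> invertible (\<pi> g)"
  using hom_in_carrier[of \<pi> SU GL g] by (simp add: is_representation_def GL_def)

lemma rep_one: "is_representation \<pi> \<Longrightarrow> \<pi> (mat 1) = mat 1"
proof -
  assume r: "is_representation \<pi>"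
  have "\<pi> (mat 1) ** \<pi> (mat 1) = \<pi> (mat 1)"
    using rep_mult[OF r SU_one SU_one] by simp
  moreover obtain B where "B ** \<pi> (mat 1) = mat 1"
    using rep_invertible[OF r SU_one] by (auto simp: invertible_def)
  ultimately show ?thesis by (metis matrix_mul_assoc matrix_mul_lid)
qed

lemma rep_ctranspose:
  assumes "is_representation \<pi>" "g \<in> carrier SU"
  shows "\<pi> g ** \<pi> (ctranspose g) = mat 1" "\<pi> (ctranspose g) ** \<pi> g = mat 1"
  using assms rep_one[OF assms(1)]
  by (simp_all add: SU_ctranspose SU_mult_ctranspose SU_ctranspose_mult flip: rep_mult)

section \<open>Restriction to a finite subgroup\<close>

text \<open>The matrix \<open>P\<close> with the eigenbasis as columns conjugates \<open>A\<close>
  to a diagonal matrix. This turns traces into sums over weights and the trace of the group average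
  into a dimension.\<close>

lemma trace_eigenbasis:
  fixes A :: "'a::field^'m^'m"
  assumes ind: "vec.independent B" and span: "vec.span B = UNIV"
    and eig: "\<And>b. b \<in> B \<Longrightarrow> A *v b = c b *s b"
  shows "trace A = (\<Sum>b\<in>B. c b)"
proof -
  have "card B = CARD('m)"
    using vec.dim_eq_card[OF _ ind, of UNIV] span by (simp add: card_cart_basis)
  moreover have finB: "finite B" using ind by (rule vec.finiteI_independent)
  ultimately obtain f :: "'m \<Rightarrow> 'a^'m" where f: "bij_betw f UNIV B"
    using finite_same_card_bij[of "UNIV::'m set" B] by auto
  define P :: "'a^'m^'m" where "P = (\<chi> i j. f j$i)"
  define D :: "'a^'m^'m" where "D = (\<chi> i j. if i = j then c (f j) else 0)"
  have "columns P = B"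
    using f by (auto simp: columns_def column_def P_def bij_betw_def image_def)
  then obtain Q where "P ** Q = mat 1"
    using span by (metis matrix_right_invertible_span_columns)
  then have Q: "Q ** P = mat 1" by (simp add: matrix_left_right_inverse)
  have "A ** P = P ** D"
  proof -
    have "(A ** P)$i$j = (P ** D)$i$j" for i j
    proof -
      have "(A ** P)$i$j = (A *v f j)$i"
        by (simp add: matrix_matrix_mult_def matrix_vector_mult_def P_def)
      also have "\<dots> = c (f j) * f j$i"
        using eig f by (auto simp: bij_betw_def)
      also have "\<dots> = (P ** D)$i$j"
        by (simp add: matrix_matrix_mult_def P_def D_def if_distrib cong: if_cong)
      finally show ?thesis .
    qed
    then show ?thesis by (simp add: vec_eq_iff)
  qed
  then have "A ** (P ** Q) = P ** D ** Q" by (simp only: matrix_mul_assoc)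
  then have "A = P ** D ** Q" using \<open>P ** Q = mat 1\<close> by simp
  then have "trace A = trace (P ** D ** Q)" by (rule arg_cong)
  also have "\<dots> = trace (Q ** (P ** D))" by (rule trace_mul_sym)
  also have "\<dots> = trace D" by (simp add: matrix_mul_assoc Q)
  also have "\<dots> = (\<Sum>j\<in>UNIV. c (f j))" by (simp add: trace_def D_def)
  also have "\<dots> = (\<Sum>b\<in>B. c b)" by (rule sum.reindex_bij_betw[OF f])
  finally show ?thesis .
qed

text \<open>A projection in matrix form, to be averaged over the group in Maschke's argument and to
  split off the component outside \<open>W\<close> in the ODE argument.\<close>

lemma vec_projection:
  fixes W :: "('a::field^'m) set"
  assumes "vec.subspace W"
  obtains Q :: "'a^'m^'m" where "\<And>v. Q *v v \<in> W" "\<And>w. w \<in> W \<Longrightarrow> Q *v w = w"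
proof -
  have "Vector_Spaces.linear (*s) (*s) (id :: 'a^'m \<Rightarrow> 'a^'m)" by (rule vec.linear_id)
  then obtain g where g: "range g \<subseteq> W" "Vector_Spaces.linear (*s) (*s) g" "\<forall>v\<in>W. g (id v) = v"
    using vec.linear_exists_left_inverse_on[of id W] assms by auto
  show ?thesis
    by (rule that[of "matrix g"]) (use g in \<open>auto simp: matrix_works\<close>)
qed

lemma matrix_vector_mult_sum_left: "(\<Sum>i\<in>S. A i) *v v = (\<Sum>i\<in>S. A i *v v)"
  by (induction S rule: infinite_finite_induct) (auto simp: matrix_vector_mult_add_rdistrib)

lemma matrix_vector_mult_sum_right: "A *v (\<Sum>i\<in>S. v i) = (\<Sum>i\<in>S. A *v v i)"
  by (induction S rule: infinite_finite_induct) (auto simp: matrix_vector_right_distrib)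

lemma scaleR_matrix_vector: "(r *\<^sub>R A) *v v = r *\<^sub>R (A *v (v::complex^'m))"
  by (simp add: vec_eq_iff matrix_vector_mult_def scaleR_right.sum)

lemma scaleR_eq_vec_scale: "r *\<^sub>R (v::complex^'m) = of_real r *s v"
  by (simp add: vec_eq_iff scaleR_conv_of_real[where 'a=complex])

lemma subspace_invariants: "vec.subspace (invariants \<pi> K)"
  by (auto simp: invariants_def vec.subspace_def matrix_vector_right_distrib vec.scale)

locale finite_rep =
  fixes \<pi> :: "complex^'n^'n \<Rightarrow> complex^'m^'m" and G :: "(complex^'n^'n) set"
  assumes rep: "is_representation \<pi>" and sub: "subgroup G SU" and fin: "finite G"
begin

lemma G_SU: "g \<in> G \<Longrightarrow> g \<in> carrier SU"
  using sub by (auto dest: subgroup.subset)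

lemma G_mult: "g \<in> G \<Longrightarrow> h \<in> G \<Longrightarrow> g ** h \<in> G"
  using subgroup.m_closed[OF sub] by simp

lemma G_ctranspose: "g \<in> G \<Longrightarrow> ctranspose g \<in> G"
  using subgroup.m_inv_closed[OF sub, of g] by (simp add: inv_SU G_SU)

lemma card_G: "card G > 0"
  using subgroup.one_closed[OF sub] fin by (auto simp: card_gt_0_iff)

lemma sum_translate:
  assumes "h \<in> G" shows "(\<Sum>g\<in>G. f (h ** g)) = (\<Sum>g\<in>G. f g)"
proof (rule sum.reindex_bij_witness[where i="\<lambda>g. ctranspose h ** g" and j="\<lambda>g. h ** g"])
qed (auto simp: matrix_mul_assoc SU_mult_ctranspose SU_ctranspose_mult G_SU assms G_mult G_ctranspose)

definition avg :: "complex^'m^'m" where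
  "avg = (1 / real (card G)) *\<^sub>R (\<Sum>g\<in>G. \<pi> g)"

lemma avg_vec: "avg *v v = (1 / real (card G)) *\<^sub>R (\<Sum>g\<in>G. \<pi> g *v v)"
  by (simp add: avg_def scaleR_matrix_vector matrix_vector_mult_sum_left)

lemma avg_invariant: "avg *v v \<in> invariants \<pi> G"
proof -
  have "\<pi> h *v (avg *v v) = avg *v v" if h: "h \<in> G" for h
  proof -
    have "\<pi> h *v (\<Sum>g\<in>G. \<pi> g *v v) = (\<Sum>g\<in>G. \<pi> (h ** g) *v v)"
      unfolding matrix_vector_mult_sum_right
      using h by (intro sum.cong) (auto simp: rep_mult[OF rep] G_SU matrix_vector_mul_assoc)
    also have "\<dots> = (\<Sum>g\<in>G. \<pi> g *v v)" by (rule sum_translate[OF h])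
    finally show ?thesis by (simp add: avg_vec scaleR_eq_vec_scale vec.scale)
  qed
  then show ?thesis by (simp add: invariants_def)
qed

lemma avg_fixes: "v \<in> invariants \<pi> G \<Longrightarrow> avg *v v = v"
proof -
  assume "v \<in> invariants \<pi> G"
  then have "(\<Sum>g\<in>G. \<pi> g *v v) = (\<Sum>g\<in>G. v)"
    by (intro sum.cong) (auto simp: invariants_def)
  then show ?thesis using card_G unfolding avg_vec sum_constant_scaleR by simp
qed

text \<open>\<open>avg\<close> is idempotent with image the invariants, so a basis can be drawn from
  the invariants and the kernel of \<open>avg\<close>, with eigenvalues 1 and 0; its trace counts
  the first kind.\<close>

lemma dim_invariants:
  "of_nat (vec.dim (invariants \<pi> G)) = 1 / of_nat (card G) * (\<Sum>g\<in>G. character \<pi> g)"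
proof -
  let ?I = "invariants \<pi> G"
  obtain B1 where B1: "B1 \<subseteq> ?I" "vec.independent B1" "?I \<subseteq> vec.span B1" "card B1 = vec.dim ?I"
    using vec.basis_exists[of ?I] by blast
  obtain B where B: "B1 \<subseteq> B" "B \<subseteq> ?I \<union> {v. avg *v v = 0}" "vec.independent B"
      "?I \<union> {v. avg *v v = 0} \<subseteq> vec.span B"
    using vec.maximal_independent_subset_extend[of B1 "?I \<union> {v. avg *v v = 0}"] B1(1,2) by blast
  have "v \<in> vec.span B" for v
  proof -
    \<comment> \<open>The splitting \<open>v = avg *v v + (v - avg *v v)\<close> into an invariant
      and a vector of the kernel.\<close>
    have "avg *v v \<in> vec.span B" "v - avg *v v \<in> vec.span B"
      using B(4) avg_invariant avg_fixes[OF avg_invariant]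
      by (auto simp: matrix_vector_mult_diff_distrib)
    then show ?thesis using vec.span_add by fastforce
  qed
  then have span: "vec.span B = UNIV" by auto
  have "avg *v b = (if b \<in> B1 then 1 else 0) *s b" if b: "b \<in> B" for b
  proof (cases "b \<in> B1")
    case True
    then show ?thesis using avg_fixes B1(1) by auto
  next
    case False
    \<comment> \<open>\<open>B1\<close> already spans the invariants, so a further invariant vector
      would break independence.\<close>
    have "b \<notin> ?I"
    proof
      assume "b \<in> ?I"
      then have "b \<in> vec.span (B - {b})"
        using B1(3) vec.span_mono[of B1 "B - {b}"] B(1) False by blast
      then show False using B(3) b by (auto simp: vec.dependent_def)
    qed
    then show ?thesis using B(2) b False by auto
  qed
  from trace_eigenbasis[OF B(3) span this] have "trace avg = of_nat (card B1)"
    using B(1) vec.finiteI_independent[OF B(3)]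
    by (simp add: sum.If_cases Int_absorb1)
  moreover have "trace avg = 1 / of_nat (card G) * (\<Sum>g\<in>G. character \<pi> g)"
  proof -
    have "trace avg = (\<Sum>i\<in>UNIV. 1 / of_nat (card G) * (\<Sum>g\<in>G. \<pi> g$i$i))"
      by (simp add: avg_def trace_def scaleR_conv_of_real[where 'a=complex])
    also have "\<dots> = 1 / of_nat (card G) * (\<Sum>i\<in>UNIV. \<Sum>g\<in>G. \<pi> g$i$i)"
      by (rule sum_distrib_left[symmetric])
    also have "(\<Sum>i\<in>UNIV. \<Sum>g\<in>G. \<pi> g$i$i) = (\<Sum>g\<in>G. character \<pi> g)"
      unfolding character_def trace_def by (rule sum.swap)
    finally show ?thesis .
  qed
  ultimately show ?thesis by (simp add: B1(4))
qed

section \<open>Maschke's theorem and decompositions into irreducibles\<close>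

lemma subrep_complement:
  assumes W: "subrepresentation \<pi> G W"
  obtains C where "subrepresentation \<pi> G C" "W \<inter> C = {0}" "\<And>v. \<exists>w\<in>W. \<exists>c\<in>C. v = w + c"
proof -
  have sW: "vec.subspace W" and WG: "\<And>g w. g \<in> G \<Longrightarrow> w \<in> W \<Longrightarrow> \<pi> g *v w \<in> W"
    using W by (auto simp: subrepresentation_def)
  obtain Q where Q: "\<And>v. Q *v v \<in> W" "\<And>w. w \<in> W \<Longrightarrow> Q *v w = w"
    using vec_projection[OF sW] by blast
  \<comment> \<open>Averaging the conjugates of a projection onto \<open>W\<close> keeps it a
    projection onto \<open>W\<close> and makes it commute with \<open>G\<close>; its kernel is the
    invariant complement.\<close>
  define R where "R v = (1 / real (card G)) *\<^sub>R (\<Sum>g\<in>G. \<pi> g *v (Q *v (\<pi> (ctranspose g) *v v)))" for v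
  have Radd: "R (v + w) = R v + R w" and Rscale: "R (c *s v) = c *s R v" for v w c
    by (simp_all add: R_def matrix_vector_right_distrib sum.distrib scaleR_add_right vec.scale
        scaleR_eq_vec_scale vec.scale_sum_right mult.commute)
  have RW: "R v \<in> W" for v
    unfolding R_def scaleR_eq_vec_scale
    by (intro vec.subspace_scale[OF sW] vec.subspace_sum[OF sW] WG Q)
  have Rid: "R w = w" if "w \<in> W" for w
  proof -
    have "\<pi> g *v (Q *v (\<pi> (ctranspose g) *v w)) = w" if g: "g \<in> G" for g
      using Q(2)[OF WG[OF G_ctranspose[OF g] \<open>w \<in> W\<close>]]
      by (simp add: matrix_vector_mul_assoc rep_ctranspose[OF rep G_SU[OF g]])
    then have "(\<Sum>g\<in>G. \<pi> g *v (Q *v (\<pi> (ctranspose g) *v w))) = (\<Sum>g\<in>G. w)" by simp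
    then show ?thesis using card_G unfolding R_def sum_constant_scaleR by simp
  qed
  have Rcomm: "R (\<pi> h *v v) = \<pi> h *v R v" if h: "h \<in> G" for h v
  proof -
    have "(\<Sum>g\<in>G. \<pi> g *v (Q *v (\<pi> (ctranspose g) *v (\<pi> h *v v))))
        = (\<Sum>g\<in>G. \<pi> (h ** g) *v (Q *v (\<pi> (ctranspose (h ** g)) *v (\<pi> h *v v))))"
      by (rule sum_translate[OF h, symmetric])
    also have "\<dots> = (\<Sum>g\<in>G. \<pi> h *v (\<pi> g *v (Q *v (\<pi> (ctranspose g) *v v))))"
    proof (rule sum.cong[OF refl])
      fix g assume g: "g \<in> G"
      have "\<pi> (ctranspose (h ** g)) ** \<pi> h = \<pi> (ctranspose g)"
        using g h by (simp add: ctranspose_mult SU_ctranspose G_SU SU_closed SU_ctranspose_mult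
            flip: rep_mult[OF rep] matrix_mul_assoc)
      moreover have "\<pi> (h ** g) = \<pi> h ** \<pi> g" using g h by (simp add: rep_mult[OF rep] G_SU)
      ultimately show "\<pi> (h ** g) *v (Q *v (\<pi> (ctranspose (h ** g)) *v (\<pi> h *v v))) =
          \<pi> h *v (\<pi> g *v (Q *v (\<pi> (ctranspose g) *v v)))"
        by (simp add: matrix_vector_mul_assoc matrix_mul_assoc)
    qed
    finally show ?thesis
      by (simp add: R_def matrix_vector_mult_sum_right scaleR_eq_vec_scale vec.scale)
  qed
  define C where "C = {v. R v = 0}"
  show ?thesis
  proof
    show "subrepresentation \<pi> G C"
      using Rscale[of 0 0]
      by (auto simp: subrepresentation_def C_def vec.subspace_def Radd Rscale Rcomm)
    show "W \<inter> C = {0}"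
      using Rid vec.subspace_0[OF sW] by (auto simp: C_def)
    fix v
    have "v = R v + (v - R v)" by simp
    moreover have "v - R v \<in> C"
      using Radd[of v "- R v"] Rscale[of "-1" "R v"] Rid[OF RW] by (simp add: C_def)
    ultimately show "\<exists>w\<in>W. \<exists>c\<in>C. v = w + c" using RW by blast
  qed
qed

text \<open>A nonzero subrepresentation of least dimension has no proper nonzero
  subrepresentation.\<close>

lemma ex_irreducible:
  assumes "subrepresentation \<pi> G C" "C \<noteq> {0}"
  obtains U where "irreducible_on \<pi> G U" "U \<subseteq> C"
proof -
  define P where "P U \<longleftrightarrow> subrepresentation \<pi> G U \<and> U \<noteq> {0} \<and> U \<subseteq> C" for U
  have "P C" using assms by (simp add: P_def)
  then obtain U where U: "P U" and least: "\<And>V. P V \<Longrightarrow> vec.dim U \<le> vec.dim V"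
    using ex_has_least_nat[of P C vec.dim] by metis
  have "V = {0} \<or> V = U" if "subrepresentation \<pi> G V" "V \<subseteq> U" for V
  proof (rule disjCI)
    assume "V \<noteq> U"
    show "V = {0}"
    proof (rule ccontr)
      assume "V \<noteq> {0}"
      then have "vec.dim U \<le> vec.dim V" using that U by (intro least) (auto simp: P_def)
      moreover have "vec.span V \<subset> vec.span U"
        using that U \<open>V \<noteq> U\<close> by (auto simp: P_def subrepresentation_def vec.span_eq_iff[THEN iffD2])
      ultimately show False using vec.dim_psubset[of V U] by simp
    qed
  qed
  then have "irreducible_on \<pi> G U" using U unfolding irreducible_on_def P_def by blast
  then show ?thesis using U that by (simp add: P_def)
qed

text \<open>Independence of the summands, phrased without the extensional functions of
  \<open>irreducible_decomposition\<close>, which would be awkward while families are being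
  enlarged.\<close>

definition direct :: "(complex^'m) set set \<Rightarrow> bool" where
  "direct D \<longleftrightarrow> (\<forall>f. (\<forall>W\<in>D. f W \<in> W) \<and> (\<Sum>W\<in>D. f W) = 0 \<longrightarrow> (\<forall>W\<in>D. f W = 0))"

lemma directD:
  assumes "direct D" "\<And>W. W \<in> D \<Longrightarrow> f W \<in> W" "(\<Sum>W\<in>D. f W) = 0" "W \<in> D"
  shows "f W = 0"
  using assms(1)[unfolded direct_def, THEN spec[of _ f]] assms(2-) by blast

definition sum_space :: "(complex^'m) set set \<Rightarrow> (complex^'m) set" where
  "sum_space D = {\<Sum>W\<in>D. f W | f. \<forall>W\<in>D. f W \<in> W}"

lemma subrep_sum_space:
  assumes "\<And>W. W \<in> D \<Longrightarrow> subrepresentation \<pi> G W"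
  shows "subrepresentation \<pi> G (sum_space D)"
  unfolding subrepresentation_def vec.subspace_def
proof (intro conjI ballI allI impI)
  have sub: "vec.subspace W" if "W \<in> D" for W using assms that by (auto simp: subrepresentation_def)
  show "0 \<in> sum_space D"
    unfolding sum_space_def using vec.subspace_0[OF sub]
    by (auto intro!: exI[of _ "\<lambda>_. 0"])
  fix x assume "x \<in> sum_space D"
  then obtain f where f: "x = (\<Sum>W\<in>D. f W)" "\<forall>W\<in>D. f W \<in> W" by (auto simp: sum_space_def)
  show "c *s x \<in> sum_space D" for c
    unfolding sum_space_def using vec.subspace_scale[OF sub] f
    by (auto simp: vec.scale_sum_right intro!: exI[of _ "\<lambda>W. c *s f W"])
  show "\<pi> g *v x \<in> sum_space D" if "g \<in> G" for g
    unfolding sum_space_def using assms f that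
    by (auto simp: matrix_vector_mult_sum_right subrepresentation_def intro!: exI[of _ "\<lambda>W. \<pi> g *v f W"])
  fix y assume "y \<in> sum_space D"
  then obtain h where h: "y = (\<Sum>W\<in>D. h W)" "\<forall>W\<in>D. h W \<in> W" by (auto simp: sum_space_def)
  show "x + y \<in> sum_space D"
    unfolding sum_space_def using vec.subspace_add[OF sub] f h
    by (auto simp: sum.distrib intro!: exI[of _ "\<lambda>W. f W + h W"])
qed

text \<open>Spanning is the existence half and directness the uniqueness half of the unique family.
  \<open>restrict\<close> normalises families outside \<open>D\<close>, where \<open>PiE\<close>
  prescribes their values.\<close>

lemma irreducible_decomposition_iff:
  assumes "finite D" "\<And>W. W \<in> D \<Longrightarrow> irreducible_on \<pi> G W"
  shows "irreducible_decomposition \<pi> G D \<longleftrightarrow> direct D \<and> sum_space D = UNIV"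
proof
  have sub: "vec.subspace W" if "W \<in> D" for W
    using assms(2)[OF that] by (auto simp: irreducible_on_def subrepresentation_def)
  have restr: "(\<Sum>W\<in>D. restrict f D W) = (\<Sum>W\<in>D. f W)" for f :: "_ \<Rightarrow> complex^'m"
    by (rule sum.cong) auto
  show "direct D \<and> sum_space D = UNIV" if dec: "irreducible_decomposition \<pi> G D"
  proof
    show "sum_space D = UNIV"
    proof (intro equalityI subsetI)
      fix v
      obtain f where "f \<in> (\<Pi>\<^sub>E W\<in>D. W)" "v = (\<Sum>W\<in>D. f W)"
        using dec unfolding irreducible_decomposition_def by metis
      then show "v \<in> sum_space D" by (auto simp: sum_space_def)
    qed auto
    show "direct D" unfolding direct_def
    proof (intro allI impI)
      fix f assume f: "(\<forall>W\<in>D. f W \<in> W) \<and> (\<Sum>W\<in>D. f W) = 0"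
      have "restrict f D \<in> (\<Pi>\<^sub>E W\<in>D. W)" "(\<lambda>W\<in>D. 0) \<in> (\<Pi>\<^sub>E W\<in>D. W)"
        using f vec.subspace_0[OF sub] by auto
      moreover have "0 = (\<Sum>W\<in>D. restrict f D W)" "0 = (\<Sum>W\<in>D. (\<lambda>W\<in>D. 0::complex^'m) W)"
        using f by (simp_all only: restr) auto
      ultimately have "restrict f D = (\<lambda>W\<in>D. 0)"
        using dec unfolding irreducible_decomposition_def by metis
      then show "\<forall>W\<in>D. f W = 0" by (metis restrict_apply')
    qed
  qed
  show "irreducible_decomposition \<pi> G D" if *: "direct D \<and> sum_space D = UNIV"
    unfolding irreducible_decomposition_def
  proof (intro conjI allI)
    fix v :: "complex^'m"
    have "v \<in> sum_space D" using * by simp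
    then obtain f where f: "v = (\<Sum>W\<in>D. f W)" "\<forall>W\<in>D. f W \<in> W" by (auto simp: sum_space_def)
    show "\<exists>!f. f \<in> (\<Pi>\<^sub>E W\<in>D. W) \<and> v = (\<Sum>W\<in>D. f W)"
    proof (rule ex1I[of _ "restrict f D"])
      show "restrict f D \<in> (\<Pi>\<^sub>E W\<in>D. W) \<and> v = (\<Sum>W\<in>D. restrict f D W)"
        using f by (simp add: restr)
      fix h assume h: "h \<in> (\<Pi>\<^sub>E W\<in>D. W) \<and> v = (\<Sum>W\<in>D. h W)"
      have 1: "h V - f V \<in> V" if "V \<in> D" for V
        using h f that by (intro vec.subspace_diff[OF sub]) (auto simp: PiE_iff)
      have 2: "(\<Sum>W\<in>D. h W - f W) = 0" using h f by (simp add: sum_subtractf)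
      have "h V - f V = 0" if "V \<in> D" for V
        using directD[of D "\<lambda>W. h W - f W", OF _ 1 2 that] * by simp
      then show "h = restrict f D" using h by (auto simp: fun_eq_iff PiE_iff extensional_def)
    qed
  qed (use assms in auto)
qed

text \<open>A direct family of irreducibles whose sum has the greatest dimension exhausts the space:
  otherwise an irreducible inside a complement could be adjoined.\<close>

lemma ex_irreducible_decomposition: "\<exists>D. irreducible_decomposition \<pi> G D"
proof -
  define P where "P D \<longleftrightarrow> finite D \<and> (\<forall>W\<in>D. irreducible_on \<pi> G W) \<and> direct D" for D
  have "P {}" by (simp add: P_def direct_def)
  moreover have "vec.dim (sum_space D) \<le> CARD('m)" for D
    using vec.dim_subset_UNIV[of "sum_space D"] by (simp add: vec.dimension_def card_cart_basis)
  ultimately obtain D where D: "P D" and max: "\<And>E. P E \<Longrightarrow> vec.dim (sum_space E) \<le> vec.dim (sum_space D)"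
    using ex_has_greatest_nat[of P "{}" "\<lambda>D. vec.dim (sum_space D)" "Suc CARD('m)"]
    by (metis less_Suc_eq_le)
  have irr: "\<And>W. W \<in> D \<Longrightarrow> irreducible_on \<pi> G W" and finD: "finite D" and dir: "direct D"
    using D by (auto simp: P_def)
  have subT: "subrepresentation \<pi> G (sum_space D)"
    using irr by (intro subrep_sum_space) (auto simp: irreducible_on_def)
  have "sum_space D = UNIV"
  proof (rule ccontr)
    assume ne: "sum_space D \<noteq> UNIV"
    obtain C where C: "subrepresentation \<pi> G C" "sum_space D \<inter> C = {0}" "\<And>v. \<exists>w\<in>sum_space D. \<exists>c\<in>C. v = w + c"
      using subrep_complement[OF subT] by metis
    have "C \<noteq> {0}" using C(3) ne by fastforce
    then obtain U where U: "irreducible_on \<pi> G U" "U \<subseteq> C" using ex_irreducible[OF C(1)] by blast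
    have U0: "0 \<in> U" "U \<noteq> {0}" "vec.subspace U"
      using U(1) by (auto simp: irreducible_on_def subrepresentation_def vec.subspace_def)
    have W0: "0 \<in> W" if "W \<in> D" for W
      using irr[OF that] by (auto simp: irreducible_on_def subrepresentation_def vec.subspace_def)
    have "x \<in> sum_space D" if "W \<in> D" "x \<in> W" for x W
    proof -
      have "x = (\<Sum>V\<in>D. if V = W then x else 0)" using that finD by simp
      then show ?thesis unfolding sum_space_def using that W0
        by (intro CollectI exI[of _ "\<lambda>V. if V = W then x else 0"]) auto
    qed
    \<comment> \<open>\<open>D\<close> is a set, so \<open>U\<close> has to be new for adjoining it
      to add a summand.\<close>
    then have UD: "U \<notin> D" using U C(2) U0 by blast
    have "direct (insert U D)" unfolding direct_def
    proof (intro allI impI)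
      fix f assume f: "(\<forall>W\<in>insert U D. f W \<in> W) \<and> (\<Sum>W\<in>insert U D. f W) = 0"
      then have eq: "f U + (\<Sum>W\<in>D. f W) = 0" using finD UD by simp
      have "(\<Sum>W\<in>D. f W) \<in> sum_space D"
        unfolding sum_space_def by (rule CollectI, rule exI[of _ f]) (use f in simp)
      then have "- (\<Sum>W\<in>D. f W) \<in> sum_space D"
        using subT vec.subspace_neg by (auto simp: subrepresentation_def)
      moreover have fU: "f U = - (\<Sum>W\<in>D. f W)" using eq by (simp only: eq_neg_iff_add_eq_0)
      moreover have "f U \<in> C" using f U(2) by blast
      ultimately have "f U \<in> sum_space D \<inter> C" by simp
      then have f0: "f U = 0" using C(2) by simp
      then have z: "(\<Sum>W\<in>D. f W) = 0" using eq by simp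
      have "f W = 0" if "W \<in> D" for W
        by (rule directD[OF dir _ z that]) (use f in simp)
      with f0 show "\<forall>W\<in>insert U D. f W = 0" by simp
    qed
    then have "P (insert U D)" using D U(1) by (auto simp: P_def)
    then have le: "vec.dim (sum_space (insert U D)) \<le> vec.dim (sum_space D)" by (rule max)
    obtain u where u: "u \<in> U" "u \<noteq> 0" using U0 by blast
    have "sum_space D \<subseteq> sum_space (insert U D)"
    proof
      fix x assume "x \<in> sum_space D"
      then obtain f where f: "x = (\<Sum>W\<in>D. f W)" "\<forall>W\<in>D. f W \<in> W" by (auto simp: sum_space_def)
      have "x = (\<Sum>W\<in>insert U D. (f(U := 0)) W)"
        using finD UD by (simp add: f(1)) (rule sum.cong, auto)
      then show "x \<in> sum_space (insert U D)"
        unfolding sum_space_def using f U0 by (intro CollectI exI[of _ "f(U := 0)"]) auto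
    qed
    moreover have "u \<in> sum_space (insert U D)"
    proof -
      have "u = (\<Sum>W\<in>insert U D. if W = U then u else 0)" using finD by simp
      then show ?thesis
        unfolding sum_space_def using u W0 by (intro CollectI exI[of _ "\<lambda>W. if W = U then u else 0"]) auto
    qed
    moreover have "u \<notin> sum_space D" using u U(2) C(2) by blast
    ultimately have "sum_space D \<subset> sum_space (insert U D)" by blast
    moreover have "subrepresentation \<pi> G (sum_space (insert U D))"
      by (rule subrep_sum_space) (use irr U(1) in \<open>auto simp only: irreducible_on_def insert_iff\<close>)
    then have "vec.span (sum_space D) = sum_space D" "vec.span (sum_space (insert U D)) = sum_space (insert U D)"
      using subT by (simp_all add: subrepresentation_def vec.span_eq_iff)
    ultimately show False using le vec.dim_psubset by (metis not_le)
  qed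
  then show ?thesis using irreducible_decomposition_iff[OF finD irr] dir by blast
qed

text \<open>A nonzero invariant vector spans a subrepresentation, which irreducibility makes all of
  \<open>W\<close>.\<close>

lemma trivial_irrep_iff:
  assumes "irreducible_on \<pi> G W"
  shows "trivial_irrep_on \<pi> G W \<longleftrightarrow> (\<exists>w\<in>W. w \<noteq> 0 \<and> w \<in> invariants \<pi> G)"
proof
  have sW: "vec.subspace W" using assms by (auto simp: irreducible_on_def subrepresentation_def)
  show "\<exists>w\<in>W. w \<noteq> 0 \<and> w \<in> invariants \<pi> G" if t: "trivial_irrep_on \<pi> G W"
  proof -
    have "W \<noteq> {0}" "0 \<in> W" using assms vec.subspace_0[OF sW] by (auto simp: irreducible_on_def)
    then obtain w where "w \<in> W" "w \<noteq> 0" by blast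
    then show ?thesis using t by (auto simp: trivial_irrep_on_def invariants_def)
  qed
  assume "\<exists>w\<in>W. w \<noteq> 0 \<and> w \<in> invariants \<pi> G"
  then obtain w where w: "w \<in> W" "w \<noteq> 0" "w \<in> invariants \<pi> G" by blast
  have span: "vec.span {w} \<subseteq> W" "vec.span {w} \<subseteq> invariants \<pi> G"
    using w by (intro vec.span_minimal sW subspace_invariants; simp)+
  then have "subrepresentation \<pi> G (vec.span {w})"
    by (auto simp: subrepresentation_def invariants_def subset_iff)
  moreover have "vec.span {w} \<noteq> {0}" using w(2) vec.span_base[of w "{w}"] by auto
  ultimately have W: "vec.span {w} = W" using assms span by (auto simp: irreducible_on_def)
  have "vec.dim (vec.span {w}) = 1"
    using w(2) vec.dim_eq_card_independent[of "{w}"] by (simp add: vec.dim_span)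
  then show "trivial_irrep_on \<pi> G W"
    using assms span by (auto simp: trivial_irrep_on_def W irreducible_on_def invariants_def subset_iff)
qed

text \<open>One nonzero invariant vector from each trivial summand gives a basis of the invariants:
  independent because the sum is direct, spanning because the components of an invariant vector are
  invariant.\<close>

lemma card_trivial_irreps:
  assumes dec: "irreducible_decomposition \<pi> G D"
  shows "card {W\<in>D. trivial_irrep_on \<pi> G W} = vec.dim (invariants \<pi> G)"
proof -
  define T where "T = {W\<in>D. trivial_irrep_on \<pi> G W}"
  have finD: "finite D" and irr: "\<And>W. W \<in> D \<Longrightarrow> irreducible_on \<pi> G W"
    using dec by (auto simp: irreducible_decomposition_def)
  have dir: "direct D" and tot: "sum_space D = UNIV"
    using irreducible_decomposition_iff[OF finD irr] dec by auto
  have sub: "subrepresentation \<pi> G W" "vec.subspace W" if "W \<in> D" for W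
    using irr[OF that] by (auto simp: irreducible_on_def subrepresentation_def)
  have "\<exists>w\<in>W. w \<noteq> 0 \<and> w \<in> invariants \<pi> G" if "W \<in> T" for W
    using that trivial_irrep_iff[OF irr] by (auto simp: T_def)
  then obtain b where b: "\<And>W. W \<in> T \<Longrightarrow> b W \<in> W" "\<And>W. W \<in> T \<Longrightarrow> b W \<noteq> 0"
      "\<And>W. W \<in> T \<Longrightarrow> b W \<in> invariants \<pi> G"
    by metis
  have TD: "T \<subseteq> D" "finite T" using finD by (auto simp: T_def)
  have coeff: "\<forall>W\<in>T. u W = 0" if eq: "(\<Sum>W\<in>T. u W *s b W) = 0" for u
  proof -
    define f where "f W = (if W \<in> T then u W *s b W else 0)" for W
    have "(\<Sum>W\<in>D. f W) = 0" using eq TD finD by (simp add: f_def sum.If_cases Int_absorb1)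
    moreover have "\<forall>W\<in>D. f W \<in> W"
      using sub b(1) by (auto simp: f_def vec.subspace_0 vec.subspace_scale)
    ultimately have "\<forall>W\<in>D. f W = 0" using dir by (auto simp: direct_def)
    then have "u W *s b W = 0" if "W \<in> T" for W using TD(1) that unfolding f_def by force
    then show ?thesis using b(2) by (metis vec.scale_eq_0_iff)
  qed
  have inj: "inj_on b T"
  proof (rule inj_onI, rule ccontr)
    fix V W assume VW: "V \<in> T" "W \<in> T" "b V = b W" "V \<noteq> W"
    define u :: "_ \<Rightarrow> complex" where "u X = (if X = V then 1 else if X = W then -1 else 0)" for X
    have "(\<Sum>X\<in>T. u X *s b X) = (\<Sum>X\<in>{V,W}. u X *s b X)"
      using VW TD by (intro sum.mono_neutral_right) (auto simp: u_def)
    also have "\<dots> = 0" using VW by (simp add: u_def)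
    finally have "\<forall>X\<in>T. u X = 0" by (rule coeff)
    with VW(1) show False by (auto simp: u_def)
  qed
  have ind: "vec.independent (b ` T)"
  proof
    assume "vec.dependent (b ` T)"
    then obtain u v where uv: "v \<in> b ` T" "u v \<noteq> 0" "(\<Sum>v\<in>b ` T. u v *s v) = 0"
      using vec.dependent_finite[of "b ` T"] TD by auto
    then have "(\<Sum>W\<in>T. u (b W) *s b W) = 0" by (simp add: sum.reindex[OF inj])
    from coeff[OF this] uv show False by auto
  qed
  have "v \<in> vec.span (b ` T)" if v: "v \<in> invariants \<pi> G" for v
  proof -
    have "v \<in> sum_space D" using tot by simp
    then obtain f where f: "v = (\<Sum>W\<in>D. f W)" "\<forall>W\<in>D. f W \<in> W" by (auto simp: sum_space_def)
    \<comment> \<open>By directness: \<open>\<pi> g *v v - v = 0\<close> has the components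
      \<open>\<pi> g *v f W - f W\<close>, each in its own summand.\<close>
    have inv: "f W \<in> invariants \<pi> G" if "W \<in> D" for W
    proof -
      have "\<pi> g *v f W = f W" if g: "g \<in> G" for g
      proof -
        have 1: "(\<Sum>W\<in>D. \<pi> g *v f W - f W) = 0"
          using v g f(1) by (simp add: sum_subtractf invariants_def flip: matrix_vector_mult_sum_right)
        have 2: "\<pi> g *v f V - f V \<in> V" if "V \<in> D" for V
          using f(2) sub[OF that] g that by (intro vec.subspace_diff) (auto simp: subrepresentation_def)
        show ?thesis
          using directD[OF dir, of "\<lambda>W. \<pi> g *v f W - f W", OF 2 1 \<open>W \<in> D\<close>] by simp
      qed
      then show ?thesis by (simp add: invariants_def)
    qed
    have "f W \<in> vec.span (b ` T)" if W: "W \<in> D" for W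
    proof (cases "f W = 0")
      case False
      then have "trivial_irrep_on \<pi> G W" using trivial_irrep_iff[OF irr[OF W]] inv[OF W] f(2) W by auto
      then have WT: "W \<in> T" and dim: "vec.dim W = 1" using W by (auto simp: T_def trivial_irrep_on_def)
      \<comment> \<open>A trivial summand is one-dimensional, hence the line through
        \<open>b W\<close>.\<close>
      have "W \<subseteq> vec.span {b W}"
        using dim b[OF WT] by (intro vec.card_ge_dim_independent) auto
      then have "f W \<in> vec.span {b W}" using f(2) W by auto
      then show ?thesis using vec.span_mono[of "{b W}" "b ` T"] WT by auto
    qed (simp add: vec.span_zero)
    then show ?thesis unfolding f(1) by (rule vec.span_sum)
  qed
  then have "vec.dim (invariants \<pi> G) = card (b ` T)"
    using ind b(3) by (intro vec.dim_unique[of "b ` T"]) auto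
  then show ?thesis by (simp add: T_def[symmetric] card_image[OF inj])
qed

end

section \<open>The operator-space alternative\<close>

lemma inaccessible_symmetry_iff:
  fixes \<Phi> :: "complex^'m \<Rightarrow> complex^'h^'h"
  assumes rep: "is_representation \<pi>" and irr: "irreducible_on \<pi> (carrier SU) UNIV"
    and nontriv: "nontrivial \<pi>"
  shows "inaccessible_symmetry \<pi> \<Phi> K \<longleftrightarrow> invariants \<pi> K = {0}"
proof -
  have False if op: "operator_space \<pi> \<Phi>" and range: "\<Phi> ` invariants \<pi> K = range mat"
  proof -
    obtain U where U: "is_representation U"
      and conj: "\<And>g v. g \<in> carrier SU \<Longrightarrow> \<Phi> (\<pi> g *v v) = U g ** \<Phi> v ** matrix_inv (U g)"
      using op by (auto simp: operator_space_def)
    have inj: "inj \<Phi>" and scale: "\<And>c v. \<Phi> (c *s v) = mat c ** \<Phi> v"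
      using op by (auto simp: operator_space_def)
    obtain v where v: "\<Phi> v = mat 1" using range by (metis imageE rangeI)
    \<comment> \<open>Conjugation by any invertible \<open>U g\<close> fixes the identity, so
      \<open>v\<close> is fixed by all of SU and not only by \<open>K\<close>.\<close>
    have fixed: "\<pi> g *v v = v" if g: "g \<in> carrier SU" for g
    proof -
      have "\<Phi> (\<pi> g *v v) = \<Phi> v"
        using conj[OF g] rep_invertible[OF U g] by (simp add: v matrix_inv_right)
      then show ?thesis using inj by (simp add: inj_eq)
    qed
    have "v \<noteq> 0"
    proof
      assume "v = 0"
      then have "\<Phi> v = mat 0 ** \<Phi> v" using scale[of 0 v] by simp
      also have "\<dots> = 0" by (simp add: mat_def matrix_matrix_mult_def vec_eq_iff)
      finally have "mat 1 = (0 :: complex^'h^'h)" using v by simp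
      then have "(mat 1 :: complex^'h^'h)$i$i = 0$i$i" for i by (rule arg_cong)
      then show False by (simp add: mat_def)
    qed
    then have "v \<in> invariants \<pi> (carrier SU)" "invariants \<pi> (carrier SU) \<noteq> {0}"
      using fixed by (auto simp: invariants_def)
    moreover have "subrepresentation \<pi> (carrier SU) (invariants \<pi> (carrier SU))"
      using subspace_invariants by (auto simp: subrepresentation_def invariants_def)
    \<comment> \<open>The invariants of SU are a nonzero subrepresentation, hence everything; then
      SU acts trivially, against \<open>nontriv\<close>.\<close>
    ultimately have "invariants \<pi> (carrier SU) = UNIV"
      using irr by (auto simp: irreducible_on_def)
    then have "\<pi> g = mat 1" if "g \<in> carrier SU" for g
      using that by (simp add: matrix_eq invariants_def set_eq_iff)
    then show False using nontriv by (auto simp: nontrivial_def)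
  qed
  then show ?thesis by (auto simp: inaccessible_symmetry_def)
qed

section \<open>Alternating sums\<close>

lemma permutes_increasing_id:
  fixes p :: "'n::{finite,linorder} \<Rightarrow> 'n"
  assumes "p permutes UNIV" and le: "\<And>i. i \<le> p i"
  shows "p = id"
proof (rule ccontr)
  assume "p \<noteq> id"
  then have ne: "{i. p i \<noteq> i} \<noteq> {}" by (auto simp: fun_eq_iff)
  \<comment> \<open>At the largest moved point \<open>i\<close> the image \<open>p i\<close> is
    moved as well, so it cannot exceed \<open>i\<close>.\<close>
  define i where "i = Max {i. p i \<noteq> i}"
  have pi: "p i \<noteq> i" using Max_in[OF _ ne] by (simp add: i_def)
  have "p (p i) \<noteq> p i" using assms(1) pi by (metis permutes_def)
  then have "p i \<le> i" unfolding i_def by (intro Max_ge) auto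
  with le[of i] pi show False by simp
qed

text \<open>A permutation other than the identity lowers some index and there meets a zero entry
  below the diagonal.\<close>

lemma det_upper_triangular:
  fixes A :: "'a::comm_ring_1^'n::{finite,linorder}^'n::{finite,linorder}"
  assumes "\<And>i j. j < i \<Longrightarrow> A$i$j = 0"
  shows "det A = (\<Prod>i\<in>UNIV. A$i$i)"
proof -
  have "det A = (\<Sum>p | p permutes (UNIV::'n set). if p = id then (\<Prod>i\<in>UNIV. A$i$i) else 0)"
    unfolding det_def
  proof (rule sum.cong[OF refl])
    fix p :: "'n \<Rightarrow> 'n" assume "p \<in> {p. p permutes UNIV}"
    then have p: "p permutes UNIV" by simp
    show "of_int (sign p) * (\<Prod>i\<in>UNIV. A$i$p i) = (if p = id then (\<Prod>i\<in>UNIV. A$i$i) else 0)"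
    proof (cases "p = id")
      case False
      then obtain i where "p i < i" using permutes_increasing_id[OF p] by (meson not_le)
      then have "(\<Prod>i\<in>UNIV. A$i$p i) = 0" by (auto intro!: prod_zero assms)
      with False show ?thesis by simp
    qed simp
  qed
  also have "\<dots> = (\<Prod>i\<in>UNIV. A$i$i)" by (simp add: finite_permutations permutes_id)
  finally show ?thesis .
qed

text \<open>Counting the larger indices makes the exponent decrease along the order, as the entries
  of \<open>weyl_vector\<close> do; the two differ by a constant.\<close>

definition rk :: "'n::{finite,linorder} \<Rightarrow> nat" where
  "rk i = card {j. i < j}"

lemma rk_mono: "i < j \<Longrightarrow> rk j < rk i"
  unfolding rk_def by (rule psubset_card_mono) auto

lemma rk_bij: "bij_betw rk (UNIV::'n::{finite,linorder} set) {..<CARD('n)}"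
proof -
  have inj: "inj (rk :: 'n \<Rightarrow> nat)"
    by (rule injI) (metis linorder_neqE less_irrefl rk_mono)
  have "rk i < CARD('n)" for i :: 'n
    unfolding rk_def by (rule psubset_card_mono) auto
  then have "range (rk :: 'n \<Rightarrow> nat) \<subseteq> {..<CARD('n)}" by auto
  moreover have "card (range (rk :: 'n \<Rightarrow> nat)) = card {..<CARD('n)}"
    using card_image[OF inj] by simp
  ultimately show ?thesis using inj by (simp add: bij_betw_def card_subset_eq)
qed

text \<open>The monomials of the Vandermonde matrix are replaced, by a unitriangular change of basis,
  by monic polynomials of the same degrees that make the matrix triangular.\<close>

lemma vandermonde_det:
  fixes x :: "'n::{finite,linorder} \<Rightarrow> complex"
  shows "det ((\<chi> i j. x i ^ rk j) :: complex^'n::{finite,linorder}^'n::{finite,linorder}) = (\<Prod>(i,k)\<in>{(i,k). i < k}. x i - x k)"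
proof -
  \<comment> \<open>\<open>p j\<close> is monic of degree \<open>rk j\<close> and vanishes at
    \<open>x i\<close> for all \<open>i > j\<close>.\<close>
  define p where "p j = (\<Prod>k\<in>{k. j < k}. [:- x k, 1:])" for j
  have degp: "degree (p j) = rk j" for j
    unfolding p_def rk_def by (subst degree_prod_eq_sum_degree) auto
  have lead: "coeff (p j) (rk j) = 1" for j
  proof -
    have "lead_coeff (p j) = 1" unfolding p_def by (simp add: lead_coeff_prod)
    then show ?thesis by (simp add: degp)
  qed
  have evalp: "poly (p j) y = (\<Prod>k\<in>{k. j < k}. y - x k)" for j y
    unfolding p_def by (simp add: poly_prod)
  define N :: "complex^'n::_^'n::_" where "N = (\<chi> i j. x i ^ rk j)"
  define U :: "complex^'n::_^'n::_" where "U = (\<chi> k j. coeff (p j) (rk k))"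
  have "N ** U = (\<chi> i j. poly (p j) (x i))"
  proof -
    have "(\<Sum>k\<in>(UNIV::'n set). x i ^ rk k * coeff (p j) (rk k)) = poly (p j) (x i)" for i j
    proof -
      have "(\<Sum>k\<in>(UNIV::'n set). x i ^ rk k * coeff (p j) (rk k)) = (\<Sum>d<CARD('n). x i ^ d * coeff (p j) d)"
        using sum.reindex_bij_betw[OF rk_bij[where 'n='n], of "\<lambda>d. x i ^ d * coeff (p j) d"] .
      also have "\<dots> = (\<Sum>d\<le>degree (p j). x i ^ d * coeff (p j) d)"
      proof (rule sum.mono_neutral_right)
        have "rk j < CARD('n)" using bij_betwE[OF rk_bij] by auto
        then show "{..degree (p j)} \<subseteq> {..<CARD('n)}" by (auto simp: degp)
      qed (auto simp: coeff_eq_0)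
      also have "\<dots> = poly (p j) (x i)" by (simp add: poly_altdef mult.commute)
      finally show ?thesis .
    qed
    then show ?thesis by (simp add: N_def U_def matrix_matrix_mult_def vec_eq_iff)
  qed
  then have "det ((\<chi> i j. poly (p j) (x i)) :: complex^'n::_^'n::_) = det N * det U" by (metis det_mul)
  moreover have "det U = 1"
  proof -
    have "det (transpose U) = (\<Prod>i\<in>UNIV. transpose U$i$i)"
    proof (rule det_upper_triangular)
      fix i j :: 'n assume "j < i"
      then show "transpose U$i$j = 0"
        by (simp add: U_def transpose_def coeff_eq_0 degp rk_mono)
    qed
    then have "det (transpose U) = 1" by (simp add: U_def transpose_def lead)
    then show ?thesis by (simp only: det_transpose)
  qed
  moreover have "det ((\<chi> i j. poly (p j) (x i)) :: complex^'n::_^'n::_) = (\<Prod>i\<in>UNIV. poly (p i) (x i))"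
  proof (subst det_upper_triangular)
    fix i j :: 'n assume "j < i"
    then show "(\<chi> i j. poly (p j) (x i))$i$j = 0"
      by (auto simp: evalp intro!: prod_zero)
  qed simp
  moreover have "(\<Prod>i\<in>UNIV. poly (p i) (x i)) = (\<Prod>(i,k)\<in>{(i,k). i < k}. x i - x k)"
  proof -
    have "{(i,k). i < k} = Sigma UNIV (\<lambda>i::'n. {k. i < k})" by auto
    then show ?thesis by (simp add: evalp prod.Sigma)
  qed
  ultimately show ?thesis by (simp add: N_def)
qed

section \<open>Pairings, positive roots and the Weyl denominator\<close>

lemma pairing_eq: "pairing x h = (\<Sum>i\<in>UNIV. of_real (x$i) * h$i)"
proof -
  have *: "cnj (if k = i then (\<chi> i. of_real (x$i))$k else 0) * (if k = i then h$k else 0)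
      = (if k = i then of_real (x$k) * h$k else 0)" for i k
    by simp
  show ?thesis
    by (simp add: pairing_def trace_def ctranspose_def diagonal_def transpose_def map_matrix_def
        matrix_matrix_mult_def * del: vec_lambda_beta) (simp add: *)
qed

lemma pairing_add_left: "pairing (x + y) h = pairing x h + pairing y h"
  by (simp add: pairing_eq sum.distrib algebra_simps)

lemma pairing_add_right: "pairing x (h + k) = pairing x h + pairing x k"
  by (simp add: pairing_eq sum.distrib algebra_simps)

lemma pairing_scale_right: "pairing x (c *s h) = c * pairing x h"
  by (simp add: pairing_eq sum_distrib_left mult.left_commute)

lemma pairing_of_real: "pairing x (\<chi> i. of_real (y$i)) = of_real (x \<bullet> y)"
  by (simp add: pairing_eq inner_vec_def)

lemma permutes_sum_inv:
  assumes "w permutes (UNIV::'n::finite set)"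
  shows "(\<Sum>i\<in>UNIV. f (inv_into UNIV w i) i) = (\<Sum>i\<in>UNIV. f i (w i))"
proof -
  have "(\<Sum>i\<in>UNIV. f (inv_into UNIV w i) i) = (\<Sum>i\<in>UNIV. f (inv_into UNIV w (w i)) (w i))"
    using sum.permute[OF assms, of "\<lambda>i. f (inv_into UNIV w i) i"] by (simp add: o_def)
  also have "\<dots> = (\<Sum>i\<in>UNIV. f i (w i))"
    using assms by (simp add: permutes_inverses(2))
  finally show ?thesis .
qed

lemma pairing_weyl_act:
  "w permutes UNIV \<Longrightarrow> pairing (weyl_act w x) h = (\<Sum>i\<in>UNIV. of_real (x$i) * h$(w i))"
  by (simp add: pairing_eq weyl_act_def permutes_sum_inv[of w "\<lambda>a b. of_real (x$a) * h$b"])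

text \<open>A positive root determines its pair, by the positions of its entries 1 and -1, so the
  set of vectors can be indexed by pairs.\<close>

lemma sum_positive_roots:
  fixes f :: "real^'n::{finite,linorder} \<Rightarrow> 'b::comm_monoid_add"
  shows "(\<Sum>\<alpha>\<in>positive_roots. f \<alpha>) = (\<Sum>(i,j)\<in>{(i,j). i < j}. f (axis i 1 - axis j 1))"
proof -
  define g :: "'n \<times> 'n \<Rightarrow> real^'n::_" where "g = (\<lambda>(i,j). axis i 1 - axis j 1)"
  have inj: "inj_on g {(i,j). i < j}"
  proof (rule inj_onI, clarify)
    fix i j k l :: 'n
    assume ij: "i < j" and kl: "k < l" and eq: "g (i,j) = g (k,l)"
    have val: "g (a,b)$c = (if c = a then 1 else 0) - (if c = b then 1 else 0)" for a b c
      by (simp add: g_def axis_def)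
    from eq have e: "g (i,j)$c = g (k,l)$c" for c by simp
    have "i = k" using e[of i] ij kl by (auto simp: val split: if_splits)
    moreover have "j = l" using e[of j] ij kl by (auto simp: val split: if_splits)
    ultimately show "i = k \<and> j = l" by simp
  qed
  have im: "positive_roots = g ` {(i,j). i < j}"
    by (auto simp: positive_roots_def g_def)
  show ?thesis unfolding im by (subst sum.reindex[OF inj]) (auto simp: g_def intro!: sum.cong)
qed

lemma weyl_vector_nth:
  "weyl_vector$i = (\<Sum>j\<in>UNIV. (if i < j then 1 else 0) - (if j < i then 1 else 0)) / 2"
  for i :: "'n::{finite,linorder}"
proof -
  have "(\<Sum>\<alpha>\<in>positive_roots. \<alpha>)$i
      = (\<Sum>(a,b)\<in>{(a,b). a < b}. (if a = i then 1 else 0) - (if b = i then 1 else (0::real)))"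
    by (subst sum_positive_roots) (auto simp: sum_component axis_def intro!: sum.cong)
  also have "\<dots> = (\<Sum>(a,b)\<in>{(a,b). a < b}. (if a = i then 1 else 0)) -
      (\<Sum>(a,b)\<in>{(a,b). a < b}. (if b = i then 1 else 0))"
    by (simp add: case_prod_unfold sum_subtractf)
  also have "(\<Sum>(a,b)\<in>{(a,b). a < b}. (if a = i then 1 else (0::real)))
      = (\<Sum>b\<in>UNIV. (if i < b then 1 else 0))"
    by (simp add: case_prod_unfold sum.If_cases)
      (rule bij_betw_same_card[OF bij_betw_byWitness[where f=snd and f'="Pair i"]], auto)
  also have "(\<Sum>(a,b)\<in>{(a,b). a < b}. (if b = i then 1 else (0::real)))
      = (\<Sum>b\<in>UNIV. (if b < i then 1 else 0))"
    by (simp add: case_prod_unfold sum.If_cases)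
      (rule bij_betw_same_card[OF bij_betw_byWitness[where f=fst and f'="\<lambda>b. (b,i)"]], auto)
  finally show ?thesis by (simp add: weyl_vector_def sum_subtractf)
qed

text \<open>Of the other \<open>CARD('n) - 1\<close> indices \<open>rk i\<close> are larger than
  \<open>i\<close> and the rest smaller. The constant shift disappears when paired with a traceless
  \<open>h\<close>.\<close>

lemma weyl_vector_rk:
  "weyl_vector$i = real (rk i) - (real CARD('n) - 1) / 2" for i :: "'n::{finite,linorder}"
proof -
  have "UNIV = insert i ({j. i < j} \<union> {j. j < i})" by auto
  then have "CARD('n) = Suc (card ({j. i < j} \<union> {j. j < i}))"
    by (metis (no_types, lifting) card_insert_disjoint finite Un_iff less_irrefl mem_Collect_eq)
  also have "card ({j. i < j} \<union> {j. j < i}) = rk i + card {j. j < i}"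
    unfolding rk_def by (rule card_Un_disjoint) auto
  finally have "real CARD('n) = 1 + real (rk i) + real (card {j. j < i})" by simp
  moreover have "weyl_vector$i = (real (rk i) - real (card {j. j < i})) / 2"
    by (simp add: weyl_vector_nth sum_subtractf sum.If_cases rk_def)
  ultimately show ?thesis by (simp add: field_simps)
qed

lemma weyl_vector_decreasing: "i < j \<Longrightarrow> weyl_vector$j < weyl_vector$i"
  by (simp add: weyl_vector_rk rk_mono)

lemma sum_weyl_vector: "(\<Sum>i\<in>UNIV. weyl_vector$i) = 0"
  unfolding weyl_vector_nth sum_subtractf sum_divide_distrib[symmetric]
  by (subst sum.swap) simp

lemma inner_weyl_vector: "x \<bullet> weyl_vector = (\<Sum>(i,j)\<in>{(i,j). i < j}. x$i - x$j) / 2"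
  by (simp add: weyl_vector_def inner_sum_right sum_positive_roots inner_diff_right inner_axis
      case_prod_unfold)

text \<open>On traceless \<open>h\<close> the constant part of \<open>weyl_vector\<close> drops out,
  and what remains is the Leibniz expansion of the Vandermonde determinant in the numbers
  \<open>exp (h$i)\<close>.\<close>

theorem weyl_denominator:
  fixes h :: "complex^'n::{finite,linorder}"
  assumes "(\<Sum>i\<in>UNIV. h$i) = 0"
  shows "alternating_sum weyl_vector h = (\<Prod>(i,k)\<in>{(i,k). i < k}. exp (h$i) - exp (h$k))"
proof -
  define x where "x i = exp (h$i)" for i
  define c where "c = complex_of_real ((real CARD('n) - 1) / 2)"
  have "exp (pairing (weyl_act w weyl_vector) h) = (\<Prod>i\<in>UNIV. x (w i) ^ rk i)"
    if w: "w permutes UNIV" for w :: "'n \<Rightarrow> 'n"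
  proof -
    have "(\<Sum>i\<in>UNIV. h$(w i)) = 0"
      using assms sum.permute[OF w, of "\<lambda>i. h$i"] by (simp add: o_def)
    then have "pairing (weyl_act w weyl_vector) h = (\<Sum>i\<in>UNIV. of_nat (rk i) * h$(w i))"
      unfolding pairing_weyl_act[OF w] weyl_vector_rk of_real_diff left_diff_distrib sum_subtractf
      sum_distrib_left[symmetric] by simp
    then show ?thesis by (simp add: exp_sum x_def exp_of_nat_mult)
  qed
  then have "alternating_sum weyl_vector h =
      (\<Sum>w | w permutes (UNIV :: 'n set). of_int (sign w) * (\<Prod>i\<in>UNIV. x (w i) ^ rk i))"
    unfolding alternating_sum_def by (intro sum.cong) auto
  also have "\<dots> = det (transpose ((\<chi> i j. x i ^ rk j) :: complex^'n::_^'n::_))"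
    by (simp add: det_def transpose_def)
  also have "\<dots> = (\<Prod>(i,k)\<in>{(i,k). i < k}. exp (h$i) - exp (h$k))"
    unfolding det_transpose vandermonde_det by (simp add: x_def)
  finally show ?thesis .
qed

lemma weyl_denominator_nonzero_iff:
  assumes "(\<Sum>i\<in>UNIV. h$i) = 0"
  shows "alternating_sum weyl_vector h \<noteq> 0 \<longleftrightarrow> (\<forall>i k. i \<noteq> k \<longrightarrow> exp (h$i) \<noteq> exp (h$k))"
  unfolding weyl_denominator[OF assms] by (auto simp: prod_zero_iff) (metis linorder_neqE)

text \<open>The identity is the logarithmic derivative of the product formula for the denominator
  in the direction \<open>\<nu>\<close>.\<close>

lemma weyl_denominator_derivative:
  fixes h :: "complex^'n::{finite,linorder}"
  assumes h: "(\<Sum>i\<in>UNIV. h$i) = 0" and \<nu>: "(\<Sum>i\<in>UNIV. \<nu>$i) = 0"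
    and reg: "alternating_sum weyl_vector h \<noteq> 0"
  shows "2 * (\<Sum>w | w permutes (UNIV :: 'n set).
           of_int (sign w) * of_real (weyl_act w weyl_vector \<bullet> \<nu>) * exp (pairing (weyl_act w weyl_vector) h))
    = alternating_sum weyl_vector h *
      (\<Sum>(i,k)\<in>{(i,k). i < k}. of_real (\<nu>$i - \<nu>$k) * (exp (h$i) + exp (h$k)) / (exp (h$i) - exp (h$k)))"
proof -
  let ?L = "\<Sum>w | w permutes (UNIV :: 'n set).
    of_int (sign w) * (of_real (weyl_act w weyl_vector \<bullet> \<nu>) * exp (pairing (weyl_act w weyl_vector) h))"
  define P where "P = {(i::'n,k). i < k}"
  define x where "x i = exp (h$i)" for i
  \<comment> \<open>A real direction leaves \<open>cartan\<close>, but
    \<open>weyl_denominator\<close> asks only for trace zero. The derivative of \<open>A\<close> at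
    0 is computed from the sum and from the product.\<close>
  define v :: "complex^'n::_" where "v = (\<chi> i. of_real (\<nu>$i))"
  define A where "A t = alternating_sum weyl_vector (h + t *s v)" for t
  have A1: "(A has_field_derivative ?L) (at 0)"
    unfolding A_def alternating_sum_def pairing_add_right pairing_scale_right v_def pairing_of_real
    by (auto intro!: derivative_eq_intros sum.cong)
  have vs: "(\<Sum>i\<in>UNIV. v$i) = 0"
    using arg_cong[OF \<nu>, of complex_of_real] by (simp add: v_def)
  have "A t = (\<Prod>(i,k)\<in>P. x i * exp (t * v$i) - x k * exp (t * v$k))" for t
  proof -
    have "(\<Sum>i\<in>UNIV. (h + t *s v)$i) = 0" by (simp add: sum.distrib h vs flip: sum_distrib_left)
    from weyl_denominator[OF this] show ?thesis by (simp add: A_def P_def x_def exp_add)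
  qed
  then have A2: "A = (\<lambda>t. \<Prod>z\<in>P. x (fst z) * exp (t * v$(fst z)) - x (snd z) * exp (t * v$(snd z)))"
    by (simp add: fun_eq_iff case_prod_unfold)
  have A0: "A 0 = alternating_sum weyl_vector h" by (simp add: A_def)
  have nz: "x i - x k \<noteq> 0" if "(i,k) \<in> P" for i k
    using reg that weyl_denominator_nonzero_iff[OF h] by (auto simp: P_def x_def)
  define d where "d z = x (fst z) * v$(fst z) - x (snd z) * v$(snd z)" for z
  define q where "q z = x (fst z) - x (snd z)" for z
  have "(A has_field_derivative (\<Sum>z\<in>P. d z * (\<Prod>y\<in>P - {z}. q y))) (at 0)"
  proof -
    have "((\<lambda>t. x (fst z) * exp (t * v$(fst z)) - x (snd z) * exp (t * v$(snd z)))
        has_field_derivative d z) (at 0)" for z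
      by (auto intro!: derivative_eq_intros simp: d_def)
    from has_field_derivative_prod[of P, OF this]
    show ?thesis unfolding A2 q_def by simp
  qed
  then have "?L
      = (\<Sum>z\<in>P. d z * (\<Prod>y\<in>P - {z}. q y))"
    using A1 DERIV_unique by blast
  also have "\<dots> = (\<Sum>z\<in>P. A 0 * (d z / q z))"
  proof (rule sum.cong[OF refl])
    fix z assume z: "z \<in> P"
    have "A 0 = q z * (\<Prod>y\<in>P - {z}. q y)"
      unfolding A2 q_def by (subst prod.remove[OF _ z]) auto
    moreover have "q z \<noteq> 0" using nz[of "fst z" "snd z"] z by (simp add: q_def)
    ultimately show "d z * (\<Prod>y\<in>P - {z}. q y) = A 0 * (d z / q z)" by simp
  qed
  also have "2 * \<dots> = A 0 * (\<Sum>z\<in>P. 2 * d z / q z)"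
    by (simp add: sum_distrib_left mult.left_commute)
  \<comment> \<open>For values \<open>x\<close>, \<open>v\<close> and \<open>x'\<close>,
    \<open>v'\<close> at the two indices,
    \<open>2 * (x v - x' v') = (v - v') (x + x') + (v + v') (x - x')\<close>.\<close>
  also have "(\<Sum>z\<in>P. 2 * d z / q z) = (\<Sum>z\<in>P. (v$(fst z) - v$(snd z)) * (x (fst z) + x (snd z)) / q z
      + (v$(fst z) + v$(snd z)))"
  proof (rule sum.cong[OF refl])
    fix z assume z: "z \<in> P"
    have "q z \<noteq> 0" using nz[of "fst z" "snd z"] z by (simp add: q_def)
    then show "2 * d z / q z = (v$(fst z) - v$(snd z)) * (x (fst z) + x (snd z)) / q z + (v$(fst z) + v$(snd z))"
      by (simp add: field_simps) (simp add: d_def q_def algebra_simps)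
  qed
  \<comment> \<open>Each index lies in equally many pairs, so the extra terms add up to a multiple
    of the trace of \<open>v\<close>, which is 0.\<close>
  also have "\<dots> = (\<Sum>z\<in>P. (v$(fst z) - v$(snd z)) * (x (fst z) + x (snd z)) / q z)"
  proof -
    have P: "P = {z. fst z < snd z}" by (auto simp: P_def)
    have "(\<Sum>z\<in>P. v$(snd z)) = (\<Sum>z\<in>{z. snd z < fst z}. v$(fst z))"
      unfolding P by (rule sum.reindex_bij_witness[of _ prod.swap prod.swap]) auto
    then have "(\<Sum>z\<in>P. v$(fst z) + v$(snd z)) = (\<Sum>z\<in>P \<union> {z. snd z < fst z}. v$(fst z))"
      by (subst sum.union_disjoint) (auto simp: P sum.distrib)
    also have "\<dots> = (\<Sum>z\<in>UNIV \<times> (UNIV :: 'n set). v$(fst z)) - (\<Sum>z\<in>(\<lambda>i. (i,i)) ` UNIV. v$(fst z))"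
    proof -
      have "UNIV \<times> (UNIV :: 'n set) = (P \<union> {z. snd z < fst z}) \<union> (\<lambda>i. (i,i)) ` UNIV"
        by (auto simp: P)
      then have "(\<Sum>z\<in>UNIV \<times> (UNIV :: 'n set). v$(fst z)) =
          (\<Sum>z\<in>P \<union> {z. snd z < fst z}. v$(fst z)) + (\<Sum>z\<in>(\<lambda>i. (i,i)) ` UNIV. v$(fst z))"
        by (simp only:) (subst sum.union_disjoint, auto simp: P)
      then show ?thesis by simp
    qed
    also have "(\<Sum>z\<in>(\<lambda>i. (i,i)) ` UNIV. v$(fst z)) = 0"
      by (subst sum.reindex) (auto simp: inj_on_def vs)
    also have "(\<Sum>z\<in>UNIV \<times> (UNIV :: 'n set). v$(fst z)) = 0"
    proof -
      have "(\<Sum>z\<in>UNIV \<times> (UNIV :: 'n set). v$(fst z)) = (\<Sum>i\<in>UNIV. \<Sum>k\<in>(UNIV :: 'n set). v$i)"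
        by (simp only: sum.cartesian_product case_prod_unfold)
      then show ?thesis by (simp add: vs flip: sum_distrib_left)
    qed
    finally show ?thesis by (simp add: sum.distrib)
  qed
  finally show ?thesis
    by (simp add: A0 P_def x_def q_def v_def case_prod_unfold mult.assoc)
qed

subsection \<open>Exponential sums on the Cartan subalgebra\<close>

lemma cartan_add: "h \<in> cartan \<Longrightarrow> k \<in> cartan \<Longrightarrow> h + k \<in> cartan"
  by (auto simp: cartan_def sum.distrib)

lemma cartan_imaginary:
  "(\<Sum>i\<in>UNIV. x$i) = 0 \<Longrightarrow> (\<chi> i. \<i> * of_real (t * x$i)) \<in> cartan"
  by (auto simp: cartan_def simp flip: sum_distrib_left of_real_sum)

lemma pairing_imaginary: "pairing x (\<chi> i. \<i> * of_real (t * y$i)) = \<i> * of_real (t * (x \<bullet> y))"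
  by (simp add: pairing_eq inner_vec_def sum_distrib_left mult.assoc mult.left_commute)

lemma cartan_permute:
  assumes "w permutes UNIV" "h \<in> cartan" shows "(\<chi> i. h$(w i)) \<in> cartan"
  using assms sum.permute[OF assms(1), of "\<lambda>i. h$i"] by (auto simp: cartan_def o_def)

lemma separate_exponentials:
  fixes x y :: "real^'n"
  assumes "x \<noteq> y" "(\<Sum>i\<in>UNIV. x$i) = 0" "(\<Sum>i\<in>UNIV. y$i) = 0"
  obtains h where "h \<in> cartan" "exp (pairing x h) \<noteq> exp (pairing y h)"
proof
  \<comment> \<open>\<open>t\<close> makes the two pairings differ by \<open>\<i> * pi\<close>, so
    the exponentials are opposite.\<close>
  define t where "t = pi / ((x - y) \<bullet> (x - y))"
  define h :: "complex^'n" where "h = (\<chi> i. \<i> * of_real (t * (x - y)$i))"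
  have "(\<Sum>i\<in>UNIV. (x - y)$i) = 0" using assms by (simp add: sum_subtractf)
  then show "h \<in> cartan" unfolding h_def by (rule cartan_imaginary)
  have "pairing x h = pairing y h + \<i> * of_real (t * ((x - y) \<bullet> (x - y)))"
    unfolding h_def pairing_imaginary by (simp add: algebra_simps inner_diff_left)
  also have "t * ((x - y) \<bullet> (x - y)) = pi" using assms(1) by (simp add: t_def)
  finally have "exp (pairing x h) = - exp (pairing y h)"
    by (simp only: exp_add exp_pi_i mult_minus_right mult_1_right mult.commute[of \<i>])
  then show "exp (pairing x h) \<noteq> exp (pairing y h)"
    by (metis add.inverse_inverse add_eq_0_iff exp_not_eq_zero mult_2 mult_eq_0_iff zero_neq_numeral)
qed

text \<open>Artin's argument for the independence of characters: translating by a \<open>k\<close>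
  that separates two exponents and subtracting removes the term of \<open>y\<close>, leaving a
  shorter relation.\<close>

lemma exponentials_independent:
  fixes S :: "(real^'n) set"
  assumes "finite S" "\<And>x. x \<in> S \<Longrightarrow> (\<Sum>i\<in>UNIV. x$i) = 0"
    and "\<And>h. h \<in> cartan \<Longrightarrow> (\<Sum>x\<in>S. a x * exp (pairing x h)) = 0"
    and "x \<in> S"
  shows "a x = 0"
  using assms
proof (induction S arbitrary: a x rule: finite_induct)
  case (insert y S)
  have S: "a z = 0" if z: "z \<in> S" for z
  proof -
    have "z \<noteq> y" using insert.hyps(2) z by metis
    then obtain k where k: "k \<in> cartan" "exp (pairing z k) \<noteq> exp (pairing y k)"
      using separate_exponentials[of z y] insert.prems(1) z by blast
    have "(\<Sum>x\<in>S. (a x * (exp (pairing x k) - exp (pairing y k))) * exp (pairing x h)) = 0"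
      if h: "h \<in> cartan" for h
    proof -
      have "(\<Sum>x\<in>insert y S. a x * exp (pairing x (h + k)))
          - exp (pairing y k) * (\<Sum>x\<in>insert y S. a x * exp (pairing x h)) = 0"
        using insert.prems(2)[OF h] insert.prems(2)[OF cartan_add[OF h k(1)]] by simp
      then have "(\<Sum>x\<in>S. a x * exp (pairing x (h + k)) - exp (pairing y k) * (a x * exp (pairing x h))) = 0"
        using insert.hyps
        by (simp add: pairing_add_right exp_add sum_distrib_left sum_subtractf algebra_simps)
      then show ?thesis
        by (simp add: pairing_add_right exp_add algebra_simps)
    qed
    from insert.IH[OF _ this z] insert.prems(1) have "a z * (exp (pairing z k) - exp (pairing y k)) = 0"
      by blast
    then show ?thesis using k(2) by simp
  qed
  have "(0::complex^'n) \<in> cartan" by (simp add: cartan_def)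
  from insert.prems(2)[OF this] have "a y * exp (pairing y 0) = 0"
    using insert.hyps S by simp
  then have "a y = 0" by simp
  with S insert.prems(3) show ?case by blast
qed simp

lemma exponentials_coefficients_eq:
  fixes S T :: "(real^'n) set"
  assumes "finite S" "finite T" "\<And>x. x \<in> S \<union> T \<Longrightarrow> (\<Sum>i\<in>UNIV. x$i) = 0"
    and "\<And>h. h \<in> cartan \<Longrightarrow> (\<Sum>x\<in>S. a x * exp (pairing x h)) = (\<Sum>x\<in>T. b x * exp (pairing x h))"
    and "\<And>x. x \<notin> S \<Longrightarrow> a x = 0" "\<And>x. x \<notin> T \<Longrightarrow> b x = 0"
  shows "a x = b x"
proof (cases "x \<in> S \<union> T")
  case True
  have "(\<Sum>x\<in>S \<union> T. (a x - b x) * exp (pairing x h)) = 0" if "h \<in> cartan" for h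
  proof -
    have "(\<Sum>x\<in>S \<union> T. a x * exp (pairing x h)) = (\<Sum>x\<in>S. a x * exp (pairing x h))"
      using assms by (intro sum.mono_neutral_right) auto
    moreover have "(\<Sum>x\<in>S \<union> T. b x * exp (pairing x h)) = (\<Sum>x\<in>T. b x * exp (pairing x h))"
      using assms by (intro sum.mono_neutral_right) auto
    ultimately show ?thesis using assms(4)[OF that] by (simp add: sum_subtractf left_diff_distrib)
  qed
  from exponentials_independent[OF _ _ this True] assms show ?thesis by auto
qed (use assms in auto)

text \<open>The Weyl vector has distinct entries, so a short move from \<open>h\<close> along it
  makes all \<open>exp (h$i)\<close> distinct; continuity carries the vanishing back to
  \<open>h\<close>.\<close>

lemma regular_dense:
  fixes h :: "complex^'n::{finite,linorder}"
  assumes h: "h \<in> cartan" and cont: "continuous_on UNIV F"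
    and reg: "\<And>h. h \<in> cartan \<Longrightarrow> (\<And>i k. i \<noteq> k \<Longrightarrow> exp (h$i) \<noteq> exp (h$k)) \<Longrightarrow> F h = (0::complex)"
  shows "F h = 0"
proof -
  define k where "k t = h + (\<chi> i. \<i> * of_real (t * weyl_vector$i))" for t
  have k: "k t \<in> cartan" for t
    unfolding k_def by (intro cartan_add h cartan_imaginary sum_weyl_vector)
  have "\<forall>\<^sub>F t in at 0. exp (k t$i) \<noteq> exp (k t$j)" if "i \<noteq> j" for i j
  proof -
    define c where "c = weyl_vector$i - weyl_vector$j"
    have c: "c \<noteq> 0" using that weyl_vector_decreasing[of i j] weyl_vector_decreasing[of j i]
      by (cases i j rule: linorder_cases) (auto simp: c_def)
    define f where "f t = exp (k t$i) - exp (k t$j)" for t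
    define g where "g t = exp (h$i - h$j) * exp (\<i> * of_real (t * c)) - 1" for t
    have f: "f t = exp (k t$j) * g t" for t
      by (simp add: f_def g_def k_def c_def algebra_simps flip: exp_add exp_diff)
    show ?thesis
    proof (cases "exp (h$i - h$j) = 1")
      case False
      have "(g \<longlongrightarrow> g 0) (at 0)"
        unfolding g_def by (intro tendsto_intros)
      moreover have "g 0 \<noteq> 0" using False by (simp add: g_def)
      ultimately have "\<forall>\<^sub>F t in at 0. g t \<noteq> 0"
        by (rule tendsto_imp_eventually_ne)
      then show ?thesis
      proof (rule eventually_mono)
        fix t assume "g t \<noteq> 0"
        then have "f t \<noteq> 0" unfolding f by simp
        then show "exp (k t$i) \<noteq> exp (k t$j)" by (simp add: f_def)
      qed
    next
      \<comment> \<open>The exponentials agree at \<open>h\<close> itself: they separate once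
        \<open>t * c\<close> is nonzero and less than a full turn.\<close>
      case True
      have "\<forall>\<^sub>F t in at 0. t \<noteq> 0 \<and> \<bar>t * c\<bar> < 2 * pi"
      proof -
        have "((\<lambda>t. \<bar>t * c\<bar>) \<longlongrightarrow> \<bar>0 * c\<bar>) (at 0)" by (intro tendsto_intros)
        then have "\<forall>\<^sub>F t in at 0. \<bar>t * c\<bar> < 2 * pi" by (rule order_tendstoD) simp
        then show ?thesis by (simp add: eventually_conj eventually_neq_at_within)
      qed
      then show ?thesis
      proof (rule eventually_mono)
        fix t assume t: "t \<noteq> 0 \<and> \<bar>t * c\<bar> < 2 * pi"
        have "exp (\<i> * of_real (t * c)) \<noteq> 1"
        proof
          assume "exp (\<i> * of_real (t * c)) = 1"
          then obtain n :: int where n: "t * c = of_int (2 * n) * pi"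
            unfolding exp_eq_1 by auto
          with t have "\<bar>of_int (2 * n) :: real\<bar> < 2"
            by (simp add: abs_mult)
          then have "n = 0" by linarith
          with n t c show False by simp
        qed
        then have "f t \<noteq> 0" unfolding f g_def True by simp
        then show "exp (k t$i) \<noteq> exp (k t$j)" by (simp add: f_def)
      qed
    qed
  qed
  then have "\<forall>\<^sub>F t in at 0. \<forall>z\<in>{z. fst z \<noteq> snd z}. exp (k t$fst z) \<noteq> exp (k t$snd z)"
    by (intro eventually_ball_finite) auto
  then have "\<forall>\<^sub>F t in at 0. F (k t) = 0"
  proof (rule eventually_mono)
    fix t assume "\<forall>z\<in>{z. fst z \<noteq> snd z}. exp (k t$fst z) \<noteq> exp (k t$snd z)"
    then have "exp (k t$i) \<noteq> exp (k t$j)" if "i \<noteq> j" for i j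
      using that by (auto dest: bspec[of _ _ "(i,j)"])
    then show "F (k t) = 0" by (rule reg[OF k])
  qed
  moreover have "((\<lambda>t. F (k t)) \<longlongrightarrow> F (k 0)) (at (0::real))"
  proof -
    have "continuous_on UNIV k" unfolding k_def
      by (intro continuous_intros continuous_on_vec_lambda)
    then have "continuous_on UNIV (F \<circ> k)"
      by (intro continuous_on_compose continuous_on_subset[OF cont]) auto
    then show ?thesis by (simp add: continuous_on_def o_def)
  qed
  ultimately have "F (k 0) = 0"
    by (metis tendsto_eventually tendsto_unique trivial_limit_at)
  moreover have "k 0 = h" by (simp add: k_def vec_eq_iff)
  ultimately show ?thesis by simp
qed

subsection \<open>Weights determine an alternating sum\<close>

lemma weyl_act_nth: "weyl_act w x$i = x$(inv_into UNIV w i)"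
  by (simp add: weyl_act_def)

lemma weyl_act_comp:
  "\<lbrakk>w permutes UNIV; v permutes UNIV\<rbrakk> \<Longrightarrow> weyl_act w (weyl_act v x) = weyl_act (w \<circ> v) x"
  by (simp add: weyl_act_def vec_eq_iff permutes_inv_o permutes_bij o_inv_distrib)

lemma weyl_act_id [simp]: "weyl_act id x = x"
  by (simp add: weyl_act_def vec_eq_iff)

lemma sum_weyl_act: "w permutes UNIV \<Longrightarrow> (\<Sum>i\<in>UNIV. weyl_act w x$i) = (\<Sum>i\<in>UNIV. x$i)"
  using permutes_sum_inv[of w "\<lambda>a b. x$a"] by (simp add: weyl_act_nth)

lemma inner_weyl_act: "w permutes UNIV \<Longrightarrow> weyl_act w x \<bullet> y = (\<Sum>i\<in>UNIV. x$i * y$(w i))"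
  using permutes_sum_inv[of w "\<lambda>a b. x$a * y$b"] by (simp add: inner_vec_def weyl_act_nth)

lemma norm_weyl_act: "w permutes UNIV \<Longrightarrow> weyl_act w x \<bullet> weyl_act w x = x \<bullet> x"
  by (subst inner_weyl_act) (simp_all add: weyl_act_nth inner_vec_def permutes_inverses)

text \<open>The equality case of Cauchy-Schwarz for vectors of equal length.\<close>

lemma eq_if_inner_ge:
  assumes "x \<bullet> x = y \<bullet> y" "y \<bullet> y \<le> x \<bullet> y" shows "x = (y::real^'n)"
proof -
  have "(x - y) \<bullet> (x - y) = x \<bullet> x + y \<bullet> y - 2 * (x \<bullet> y)"
    by (simp add: inner_diff_left inner_diff_right inner_commute)
  also have "\<dots> \<le> 0" using assms by simp
  finally have "x - y = 0" by (metis inner_gt_zero_iff not_le)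
  then show ?thesis by simp
qed

definition dominant :: "real^'n::{finite,linorder} \<Rightarrow> bool" where
  "dominant x \<longleftrightarrow> (\<forall>i j. i < j \<longrightarrow> x$j \<le> x$i)"

lemma dominant_weyl_vector: "dominant weyl_vector"
  by (simp add: dominant_def weyl_vector_decreasing less_imp_le)

text \<open>Summing over all ordered pairs with a sign lets a permutation act on both indices; the 4
  combines the half in \<open>weyl_vector\<close> with the doubling of pairs.\<close>

lemma inner_weyl_vector_full:
  fixes x :: "real^'n::{finite,linorder}"
  shows "4 * (x \<bullet> weyl_vector) =
    (\<Sum>i\<in>UNIV. \<Sum>j\<in>UNIV. (x$i - x$j) * ((if i < j then 1 else 0) - (if j < i then 1 else 0)))"
proof -
  define s :: "'n \<Rightarrow> 'n \<Rightarrow> real" where "s i j = (if i < j then 1 else 0) - (if j < i then 1 else 0)" for i j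
  have anti: "s j i = - s i j" for i j by (simp add: s_def)
  have a: "2 * (x \<bullet> weyl_vector) = (\<Sum>i\<in>UNIV. \<Sum>j\<in>UNIV. x$i * s i j)"
    by (simp add: inner_vec_def weyl_vector_nth s_def flip: sum_distrib_left sum_divide_distrib)
  also have "\<dots> = (\<Sum>j\<in>UNIV. \<Sum>i\<in>UNIV. x$i * s i j)" by (rule sum.swap)
  also have "\<dots> = (\<Sum>i\<in>UNIV. \<Sum>j\<in>UNIV. - (x$j * s i j))"
    by (subst anti) simp
  finally have "4 * (x \<bullet> weyl_vector) = (\<Sum>i\<in>UNIV. \<Sum>j\<in>UNIV. x$i * s i j) + (\<Sum>i\<in>UNIV. \<Sum>j\<in>UNIV. - (x$j * s i j))"
    using a by simp
  then show ?thesis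
    by (simp add: s_def[symmetric] left_diff_distrib sum_subtractf sum_negf)
qed

text \<open>A rearrangement inequality: each signed difference is at most its absolute value, the
  sum of absolute values is invariant under permutations, and a dominant vector attains it.\<close>

lemma dominant_inner_weyl_act_le:
  fixes x :: "real^'n::{finite,linorder}"
  assumes "dominant x" and w: "w permutes (UNIV::'n set)"
  shows "x \<bullet> weyl_act w weyl_vector \<le> x \<bullet> weyl_vector"
proof -
  define y where "y = (\<chi> i. x$(w i))"
  have "x \<bullet> weyl_act w weyl_vector = y \<bullet> weyl_vector"
    using inner_weyl_act[OF w, of weyl_vector x] by (simp add: inner_commute y_def inner_vec_def mult.commute)
  moreover have "4 * (y \<bullet> weyl_vector) \<le> (\<Sum>i\<in>UNIV. \<Sum>j\<in>UNIV. \<bar>y$i - y$j\<bar>)"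
    unfolding inner_weyl_vector_full by (intro sum_mono) auto
  moreover have "(\<Sum>i\<in>UNIV. \<Sum>j\<in>UNIV. \<bar>y$i - y$j\<bar>) = (\<Sum>i\<in>UNIV. \<Sum>j\<in>UNIV. \<bar>x$i - x$j\<bar>)"
  proof -
    have "(\<Sum>j\<in>UNIV. \<bar>y$i - y$j\<bar>) = (\<Sum>j\<in>UNIV. \<bar>x$(w i) - x$j\<bar>)" for i
      using sum.permute[OF w, of "\<lambda>j. \<bar>x$(w i) - x$j\<bar>"] by (simp add: y_def o_def)
    then have "(\<Sum>i\<in>UNIV. \<Sum>j\<in>UNIV. \<bar>y$i - y$j\<bar>) = (\<Sum>i\<in>UNIV. \<Sum>j\<in>UNIV. \<bar>x$(w i) - x$j\<bar>)"
      by simp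
    also have "\<dots> = (\<Sum>i\<in>UNIV. \<Sum>j\<in>UNIV. \<bar>x$i - x$j\<bar>)"
      using sum.permute[OF w, of "\<lambda>i. \<Sum>j\<in>UNIV. \<bar>x$i - x$j\<bar>"] by (simp add: o_def)
    finally show ?thesis .
  qed
  moreover have "(\<Sum>i\<in>UNIV. \<Sum>j\<in>UNIV. \<bar>x$i - x$j\<bar>) = 4 * (x \<bullet> weyl_vector)"
    unfolding inner_weyl_vector_full
    using assms(1) by (intro sum.cong refl) (auto simp: dominant_def not_less)
  ultimately show ?thesis by simp
qed

text \<open>An orbit point with the greatest pairing with \<open>weyl_vector\<close> is dominant,
  since transposing an increasing pair of entries would raise the pairing.\<close>

lemma ex_dominant_weyl_act:
  fixes x :: "real^'n::{finite,linorder}"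
  obtains w where "w permutes (UNIV::'n set)" "dominant (weyl_act w x)"
proof -
  define P where "P = {w. w permutes (UNIV::'n set)}"
  have "finite P" "P \<noteq> {}"
    using permutes_id[of "UNIV::'n set"] by (auto simp: P_def finite_permutations simp del: permutes_id)
  then have "Max ((\<lambda>w. weyl_act w x \<bullet> weyl_vector) ` P) \<in> (\<lambda>w. weyl_act w x \<bullet> weyl_vector) ` P"
    by (intro Max_in) auto
  then obtain w where w: "w \<in> P"
    and "weyl_act w x \<bullet> weyl_vector = Max ((\<lambda>w. weyl_act w x \<bullet> weyl_vector) ` P)"
    by auto
  then have max: "weyl_act v x \<bullet> weyl_vector \<le> weyl_act w x \<bullet> weyl_vector" if "v \<in> P" for v
    using \<open>finite P\<close> that by (auto intro!: Max_ge)
  have wp: "w permutes UNIV" using w by (simp add: P_def)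
  have "weyl_act w x$j \<le> weyl_act w x$i" if ij: "i < j" for i j
  proof (rule ccontr)
    assume neg: "\<not> ?thesis"
    define y where "y = weyl_act w x"
    let ?t = "Transposition.transpose i j"
    have t: "?t permutes UNIV" by (simp add: permutes_swap_id)
    have "?t \<circ> w \<in> P" using wp t by (simp add: P_def permutes_compose)
    from max[OF this] have "weyl_act ?t y \<bullet> weyl_vector \<le> y \<bullet> weyl_vector"
      using weyl_act_comp[OF t wp] by (simp add: y_def)
    moreover have "weyl_act ?t y \<bullet> weyl_vector - y \<bullet> weyl_vector
        = (y$j - y$i) * (weyl_vector$i - weyl_vector$j)"
    proof -
      have "weyl_act ?t y \<bullet> weyl_vector - y \<bullet> weyl_vector
          = (\<Sum>k\<in>UNIV. y$k * (weyl_vector$(?t k) - weyl_vector$k))"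
        unfolding inner_weyl_act[OF t] by (simp add: inner_vec_def sum_subtractf right_diff_distrib)
      also have "\<dots> = (\<Sum>k\<in>{i,j}. y$k * (weyl_vector$(?t k) - weyl_vector$k))"
        by (rule sum.mono_neutral_right) (auto simp: Transposition.transpose_def)
      also have "\<dots> = (y$j - y$i) * (weyl_vector$i - weyl_vector$j)"
        using ij by (simp add: algebra_simps)
      finally show ?thesis .
    qed
    moreover have "\<dots> > 0"
      using neg weyl_vector_decreasing[OF ij] by (intro mult_pos_pos) (auto simp: y_def)
    ultimately show False by linarith
  qed
  then show ?thesis using that wp by (auto simp: dominant_def)
qed

lemma alternating_sum_permute:
  assumes v: "v permutes (UNIV::'n set)"
  shows "alternating_sum x (\<chi> i. h$(v i)) = of_int (sign v) * alternating_sum x (h::complex^'n)"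
proof -
  define P where "P = {w. w permutes (UNIV::'n set)}"
  define f where "f w = exp (pairing (weyl_act w x) h)" for w
  have vi: "inv_into UNIV v permutes UNIV" using v by (rule permutes_inv)
  have 1: "pairing (weyl_act w x) (\<chi> i. h$(v i)) = pairing (weyl_act (v \<circ> w) x) h" if "w \<in> P" for w
    using that v by (simp add: P_def pairing_weyl_act permutes_compose)
  have 2: "of_int (sign w) = (of_int (sign v) * of_int (sign (v \<circ> w)) :: complex)" if "w \<in> P" for w
    using that v
    by (simp add: P_def sign_compose permutes_imp_permutation[OF finite]) (simp add: sign_def)
  have "alternating_sum x (\<chi> i. h$(v i)) = (\<Sum>w\<in>P. of_int (sign v) * (of_int (sign (v \<circ> w)) * f (v \<circ> w)))"
    unfolding alternating_sum_def P_def[symmetric] by (intro sum.cong refl) (simp add: 1 2 f_def)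
  also have "\<dots> = (\<Sum>w\<in>P. of_int (sign v) * (of_int (sign w) * f w))"
    by (rule sum.reindex_bij_witness[of _ "\<lambda>w. inv_into UNIV v \<circ> w" "\<lambda>w. v \<circ> w"])
      (use v vi in \<open>auto simp: P_def permutes_compose o_assoc permutes_inv_o\<close>)
  also have "\<dots> = of_int (sign v) * alternating_sum x h"
    unfolding alternating_sum_def P_def[symmetric] f_def by (simp add: sum_distrib_left)
  finally show ?thesis .
qed

text \<open>The product of the exponential sum of the weights with the Weyl denominator is an
  antisymmetric exponential sum which the second-order equation \<open>casimir\<close> makes an eigenfunction
  of the flat Laplacian, so all its exponents have the length of \<open>\<mu> + weyl_vector\<close>; among dominant
  exponents only \<open>\<mu> + weyl_vector\<close> itself has that length.\<close>

theorem weight_sum_times_denominator: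
  fixes \<nu> :: "'b \<Rightarrow> real^'n::{finite,linorder}"
  assumes fin: "finite B" and b0: "b0 \<in> B" "\<nu> b0 = \<mu>"
    and sum0: "\<And>b. b \<in> B \<Longrightarrow> (\<Sum>i\<in>UNIV. \<nu> b$i) = 0"
    and lower: "\<And>b. b \<in> B \<Longrightarrow> b \<noteq> b0 \<Longrightarrow> weyl_vector \<bullet> \<nu> b < weyl_vector \<bullet> \<mu>"
    and le: "\<And>b x. b \<in> B \<Longrightarrow> dominant x \<Longrightarrow> x \<bullet> \<nu> b \<le> x \<bullet> \<mu>"
    and symmetric: "\<And>h w. h \<in> cartan \<Longrightarrow> w permutes UNIV \<Longrightarrow>
      (\<Sum>b\<in>B. exp (pairing (\<nu> b) (\<chi> i. h$(w i)))) = (\<Sum>b\<in>B. exp (pairing (\<nu> b) h))"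
    and casimir: "\<And>h. h \<in> cartan \<Longrightarrow> (\<And>i k. i \<noteq> k \<Longrightarrow> exp (h$i) \<noteq> exp (h$k)) \<Longrightarrow>
      (\<Sum>b\<in>B. (of_real (\<nu> b \<bullet> \<nu> b) + (\<Sum>(i,k)\<in>{(i,k). i < k}.
          of_real (\<nu> b$i - \<nu> b$k) * (exp (h$i) + exp (h$k)) / (exp (h$i) - exp (h$k)))) *
        exp (pairing (\<nu> b) h))
      = of_real (\<mu> \<bullet> \<mu> + 2 * (\<mu> \<bullet> weyl_vector)) * (\<Sum>b\<in>B. exp (pairing (\<nu> b) h))"
    and h: "h \<in> cartan"
  shows "(\<Sum>b\<in>B. exp (pairing (\<nu> b) h)) * alternating_sum weyl_vector h
    = alternating_sum (\<mu> + weyl_vector) h"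
proof -
  let ?\<delta> = "weyl_vector :: real^'n::_"
  define \<rho> where "\<rho> = \<mu> + weyl_vector"
  define P where "P = {w. w permutes (UNIV::'n set)}"
  have finP: "finite P" by (simp add: P_def finite_permutations)
  define e where "e z = \<nu> (fst z) + weyl_act (snd z) weyl_vector" for z
  define E where "E = e ` (B \<times> P)"
  have finE: "finite E" using fin finP by (simp add: E_def)
  \<comment> \<open>Several pairs may share an exponent, so independence applies only to these
    collected coefficients.\<close>
  define a :: "real^'n::_ \<Rightarrow> complex" where
    "a x = (\<Sum>z\<in>{z \<in> B \<times> P. e z = x}. of_int (sign (snd z)))" for x
  have a0: "a x = 0" if "x \<notin> E" for x
    using that by (auto simp: a_def E_def intro!: sum.neutral)
  have sumE: "(\<Sum>i\<in>UNIV. x$i) = 0" if "x \<in> E" for x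
    using that by (auto simp: E_def e_def P_def sum.distrib sum_weyl_act sum0 sum_weyl_vector)
  define F where "F h = (\<Sum>b\<in>B. exp (pairing (\<nu> b) h)) * alternating_sum weyl_vector h" for h
  have group: "(\<Sum>z\<in>B \<times> P. of_int (sign (snd z)) * c (e z)) = (\<Sum>x\<in>E. a x * c x)"
    for c :: "real^'n::_ \<Rightarrow> complex"
  proof -
    have "(\<Sum>z\<in>B \<times> P. of_int (sign (snd z)) * c (e z)) =
        (\<Sum>x\<in>E. \<Sum>z\<in>{z \<in> B \<times> P. e z = x}. of_int (sign (snd z)) * c (e z))"
      unfolding E_def using fin finP by (intro sum.image_gen) auto
    also have "\<dots> = (\<Sum>x\<in>E. a x * c x)"
      unfolding a_def sum_distrib_right by (intro sum.cong) auto
    finally show ?thesis .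
  qed
  have F: "F h = (\<Sum>x\<in>E. a x * exp (pairing x h))" for h
  proof -
    have "F h = (\<Sum>z\<in>B \<times> P. of_int (sign (snd z)) * exp (pairing (e z) h))"
      unfolding F_def alternating_sum_def sum_product sum.cartesian_product P_def[symmetric]
      by (simp add: case_prod_unfold e_def pairing_add_left exp_add mult_ac)
    then show ?thesis using group[of "\<lambda>x. exp (pairing x h)"] by simp
  qed
  \<comment> \<open>The sum over weights is symmetric and the denominator antisymmetric, so
    permuting \<open>h\<close> gives two expansions of one function; their coefficients are
    compared.\<close>
  have antisym: "a (weyl_act v x) = of_int (sign v) * a x" if v: "v permutes UNIV" for v x
  proof -
    define vi where "vi = inv_into UNIV v"
    have vi: "vi permutes UNIV" unfolding vi_def using v by (rule permutes_inv)
    have inv1: "weyl_act vi (weyl_act v y) = y" "weyl_act v (weyl_act vi y) = y" for y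
      using v vi by (simp_all add: weyl_act_comp) (simp_all add: vi_def permutes_inv_o)
    have "of_int (sign v) * a (weyl_act v x) = a x"
    proof (rule exponentials_coefficients_eq[where S="weyl_act vi ` E" and T=E])
      fix h :: "complex^'n::_" assume h: "h \<in> cartan"
      have "(\<Sum>x\<in>weyl_act vi ` E. (of_int (sign v) * a (weyl_act v x)) * exp (pairing x h))
          = (\<Sum>x\<in>E. (of_int (sign v) * a x) * exp (pairing (weyl_act vi x) h))"
        by (subst sum.reindex) (auto intro!: inj_onI simp: inv1 dest: arg_cong[of _ _ "weyl_act v"])
      also have "\<dots> = of_int (sign v) * F (\<chi> i. h$(vi i))"
        using pairing_weyl_act[OF vi]
        by (simp add: F sum_distrib_left mult.assoc pairing_eq)
      also have "\<dots> = F h"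
      proof -
        have "sign vi = sign v"
          unfolding vi_def using permutes_imp_permutation[OF finite v] by (rule sign_inverse)
        then show ?thesis
          using symmetric[OF h vi] alternating_sum_permute[OF vi, of weyl_vector h]
          by (simp add: F_def sign_def)
      qed
      finally show "(\<Sum>x\<in>weyl_act vi ` E. (of_int (sign v) * a (weyl_act v x)) * exp (pairing x h))
          = (\<Sum>x\<in>E. a x * exp (pairing x h))" by (simp add: F)
    next
      fix x assume "x \<notin> weyl_act vi ` E"
      then have "weyl_act v x \<notin> E" using inv1 by (metis imageI)
      then show "of_int (sign v) * a (weyl_act v x) = 0" by (simp add: a0)
    qed (use finE a0 sumE vi in \<open>auto simp: sum_weyl_act\<close>)
    then have "of_int (sign v) * (of_int (sign v) * a (weyl_act v x)) = of_int (sign v) * a x"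
      by simp
    moreover have "of_int (sign v) * of_int (sign v) = (1::complex)" by (simp add: sign_def)
    ultimately show ?thesis by (metis mult.assoc mult_1_left)
  qed
  \<comment> \<open>The squared length of \<open>\<nu> b + weyl_act w weyl_vector\<close> splits
    into two squared lengths and a cross term; summed over \<open>w\<close>, the cross term is the
    derivative of the denominator, which supplies the first-order part of \<open>casimir\<close>.
    Its poles confine this to regular points, hence the density argument.\<close>
  have laplace: "(\<Sum>x\<in>E. (a x * of_real (x \<bullet> x - \<rho> \<bullet> \<rho>)) * exp (pairing x h)) = 0"
    if "h \<in> cartan" for h
  proof (rule regular_dense[OF that])
    show "continuous_on UNIV (\<lambda>h. \<Sum>x\<in>E. (a x * of_real (x \<bullet> x - \<rho> \<bullet> \<rho>)) * exp (pairing x h))"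
      unfolding pairing_eq by (intro continuous_intros)
  next
    fix h :: "complex^'n::_"
    assume h: "h \<in> cartan" and reg: "\<And>i k. i \<noteq> k \<Longrightarrow> exp (h$i) \<noteq> exp (h$k)"
    have hs: "(\<Sum>i\<in>UNIV. h$i) = 0" using h by (simp add: cartan_def)
    define A where "A = alternating_sum weyl_vector h"
    have A: "A \<noteq> 0" unfolding A_def using weyl_denominator_nonzero_iff[OF hs] reg by blast
    define R where "R b = (\<Sum>(i,k)\<in>{(i,k). i < k}.
          of_real (\<nu> b$i - \<nu> b$k) * (exp (h$i) + exp (h$k)) / (exp (h$i) - exp (h$k)))" for b
    let ?t = "\<lambda>b w. of_int (sign w) * (of_real (e (b,w) \<bullet> e (b,w)) * exp (pairing (e (b,w)) h))"
    have inner: "(\<Sum>w\<in>P. ?t b w)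
        = A * ((of_real (\<nu> b \<bullet> \<nu> b + weyl_vector \<bullet> ?\<delta>) + R b) * exp (pairing (\<nu> b) h))"
      if b: "b \<in> B" for b
    proof -
      define c where "c = exp (pairing (\<nu> b) h)"
      define f where "f w = weyl_act w ?\<delta>" for w
      have "(\<Sum>w\<in>P. ?t b w)
          = (\<Sum>w\<in>P. of_real (\<nu> b \<bullet> \<nu> b + weyl_vector \<bullet> ?\<delta>) * c * (of_int (sign w) * exp (pairing (f w) h))
            + c * (2 * (of_int (sign w) * of_real (f w \<bullet> \<nu> b) * exp (pairing (f w) h))))"
      proof (rule sum.cong[OF refl])
        fix w assume "w \<in> P"
        then have w: "w permutes UNIV" by (simp add: P_def)
        have "e (b,w) \<bullet> e (b,w) = \<nu> b \<bullet> \<nu> b + weyl_vector \<bullet> ?\<delta> + 2 * (f w \<bullet> \<nu> b)"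
          using norm_weyl_act[OF w, of weyl_vector]
          by (simp add: e_def f_def inner_add_left inner_add_right inner_commute)
        moreover have "exp (pairing (e (b,w)) h) = c * exp (pairing (f w) h)"
          by (simp add: e_def f_def c_def pairing_add_left exp_add)
        ultimately show "?t b w
           = of_real (\<nu> b \<bullet> \<nu> b + weyl_vector \<bullet> ?\<delta>) * c * (of_int (sign w) * exp (pairing (f w) h))
            + c * (2 * (of_int (sign w) * of_real (f w \<bullet> \<nu> b) * exp (pairing (f w) h)))"
          by (simp add: algebra_simps)
      qed
      also have "\<dots> = of_real (\<nu> b \<bullet> \<nu> b + weyl_vector \<bullet> ?\<delta>) * c * A
          + c * (2 * (\<Sum>w\<in>P. of_int (sign w) * of_real (f w \<bullet> \<nu> b) * exp (pairing (f w) h)))"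
        unfolding sum.distrib A_def alternating_sum_def P_def f_def by (simp only: sum_distrib_left)
      also have "2 * (\<Sum>w\<in>P. of_int (sign w) * of_real (f w \<bullet> \<nu> b) * exp (pairing (f w) h)) = A * R b"
        using weyl_denominator_derivative[OF hs sum0[OF b]] A by (simp add: P_def f_def A_def R_def)
      finally show ?thesis by (simp add: c_def algebra_simps)
    qed
    have "(\<Sum>x\<in>E. a x * (of_real (x \<bullet> x) * exp (pairing x h)))
        = (\<Sum>b\<in>B. \<Sum>w\<in>P. ?t b w)"
      unfolding group[symmetric] sum.cartesian_product by (simp add: case_prod_unfold)
    also have "\<dots> = A * (\<Sum>b\<in>B. (of_real (\<nu> b \<bullet> \<nu> b + weyl_vector \<bullet> ?\<delta>) + R b) * exp (pairing (\<nu> b) h))"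
      by (simp add: inner sum_distrib_left)
    also have "(\<Sum>b\<in>B. (of_real (\<nu> b \<bullet> \<nu> b + weyl_vector \<bullet> ?\<delta>) + R b) * exp (pairing (\<nu> b) h))
        = (\<Sum>b\<in>B. (of_real (\<nu> b \<bullet> \<nu> b) + R b) * exp (pairing (\<nu> b) h)) +
          of_real (weyl_vector \<bullet> ?\<delta>) * (\<Sum>b\<in>B. exp (pairing (\<nu> b) h))"
      by (simp add: sum_distrib_left algebra_simps flip: sum.distrib)
    also have "(\<Sum>b\<in>B. (of_real (\<nu> b \<bullet> \<nu> b) + R b) * exp (pairing (\<nu> b) h))
        = of_real (\<mu> \<bullet> \<mu> + 2 * (\<mu> \<bullet> weyl_vector)) * (\<Sum>b\<in>B. exp (pairing (\<nu> b) h))"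
      unfolding R_def using casimir[OF h reg] .
    also have "A * (\<dots> + of_real (weyl_vector \<bullet> ?\<delta>) * (\<Sum>b\<in>B. exp (pairing (\<nu> b) h)))
        = of_real (\<rho> \<bullet> \<rho>) * F h"
      by (simp add: F_def A_def \<rho>_def inner_add_left inner_add_right inner_commute algebra_simps)
    finally show "(\<Sum>x\<in>E. (a x * of_real (x \<bullet> x - \<rho> \<bullet> \<rho>)) * exp (pairing x h)) = 0"
      by (simp add: F sum_distrib_left sum_subtractf algebra_simps)
  qed
  have len: "x \<bullet> x = \<rho> \<bullet> \<rho>" if "a x \<noteq> 0" for x
  proof -
    have "x \<in> E" using that a0 by blast
    from exponentials_independent[OF finE _ laplace this] sumE have "a x * of_real (x \<bullet> x - \<rho> \<bullet> \<rho>) = 0"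
      by blast
    with that show ?thesis by simp
  qed
  \<comment> \<open>Against a dominant \<open>y\<close> both parts of its exponent pair at most as
    \<mu> and \<open>weyl_vector\<close> do, so
    \<open>y \<bullet> y \<le> y \<bullet> \<rho>\<close> with equal lengths, forcing
    \<open>y = \<rho>\<close>.\<close>
  have orbit: "\<exists>w\<in>P. x = weyl_act w \<rho>" if ax: "a x \<noteq> 0" for x
  proof -
    obtain v where v: "v permutes UNIV" and dom: "dominant (weyl_act v x)"
      using ex_dominant_weyl_act by blast
    define y where "y = weyl_act v x"
    have ay: "a y \<noteq> 0" using ax antisym[OF v, of x] by (simp add: y_def sign_def)
    then have "y \<in> E" using a0 by blast
    then obtain z where "z \<in> B \<times> P" "y = e z" unfolding E_def by blast
    then obtain b w where bw: "b \<in> B" "w \<in> P" "y = \<nu> b + weyl_act w weyl_vector"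
      by (auto simp: e_def)
    have "y \<bullet> y = y \<bullet> \<nu> b + y \<bullet> weyl_act w weyl_vector"
      by (subst (2) bw(3)) (simp add: inner_add_right)
    also have "\<dots> \<le> y \<bullet> \<rho>"
      using le[OF bw(1), of y] dominant_inner_weyl_act_le[of y w] dom bw(2)
      by (simp add: \<rho>_def inner_add_right y_def P_def)
    finally have "y = \<rho>" using len[OF ay] by (intro eq_if_inner_ge) auto
    moreover have "weyl_act (inv_into UNIV v) y = x"
      using v by (simp add: y_def weyl_act_comp permutes_inv permutes_inv_o)
    ultimately have "x = weyl_act (inv_into UNIV v) \<rho>" by simp
    then show ?thesis using permutes_inv[OF v] by (auto simp: P_def)
  qed
  \<comment> \<open>Both parts of an exponent equal to \<rho> must pair maximally with
    \<open>weyl_vector\<close>, which only \<open>b0\<close> and the identity do, so a single term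
    contributes.\<close>
  have a\<rho>: "a \<rho> = 1"
  proof -
    have "{z \<in> B \<times> P. e z = \<rho>} = {(b0, id)}"
    proof (intro equalityI subsetI)
      fix z assume "z \<in> {z \<in> B \<times> P. e z = \<rho>}"
      then obtain b w where z: "z = (b,w)" "b \<in> B" "w permutes UNIV"
        and eq: "\<nu> b + weyl_act w weyl_vector = \<rho>"
        by (auto simp: e_def P_def)
      have "weyl_vector \<bullet> \<nu> b + weyl_vector \<bullet> weyl_act w weyl_vector = weyl_vector \<bullet> \<mu> + weyl_vector \<bullet> ?\<delta>"
        using arg_cong[OF eq, of "\<lambda>x. weyl_vector \<bullet> x"] by (simp add: \<rho>_def inner_add_right)
      moreover have "weyl_vector \<bullet> weyl_act w weyl_vector \<le> weyl_vector \<bullet> ?\<delta>"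
        by (rule dominant_inner_weyl_act_le[OF dominant_weyl_vector z(3)])
      moreover have "weyl_vector \<bullet> \<nu> b \<le> weyl_vector \<bullet> \<mu>"
        by (rule le[OF z(2) dominant_weyl_vector])
      ultimately have 1: "weyl_vector \<bullet> \<nu> b = weyl_vector \<bullet> \<mu>"
        and 2: "weyl_vector \<bullet> weyl_act w weyl_vector = weyl_vector \<bullet> ?\<delta>"
        by linarith+
      have "b = b0" using lower[OF z(2)] 1 by fastforce
      moreover have "weyl_act w weyl_vector = ?\<delta>"
        using 2 norm_weyl_act[OF z(3), of weyl_vector] by (intro eq_if_inner_ge) (auto simp: inner_commute)
      then have "weyl_vector$inv_into UNIV w i = weyl_vector$i" for i :: 'n
        by (metis weyl_act_nth)
      then have "inv_into UNIV w i = i" for i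
        by (metis weyl_vector_decreasing less_irrefl linorder_neqE)
      then have "w = id" using z(3) by (metis eq_id_iff permutes_inverses(1))
      ultimately show "z \<in> {(b0, id)}" using z(1) by simp
    qed (use b0 permutes_id in \<open>auto simp: e_def P_def \<rho>_def\<close>)
    then show ?thesis by (simp add: a_def sign_id)
  qed
  have aw: "a (weyl_act w \<rho>) = of_int (sign w)" if "w \<in> P" for w
    using antisym[of w \<rho>] that by (simp add: P_def a\<rho>)
  have inj: "inj_on (\<lambda>w. weyl_act w \<rho>) P"
  proof (rule inj_onI)
    fix v w assume v: "v \<in> P" and w: "w \<in> P" and eq: "weyl_act v \<rho> = weyl_act w \<rho>"
    \<comment> \<open>Were two entries of \<rho> equal, their transposition would fix \<rho> and
      antisymmetry would give \<open>a \<rho> = 0\<close>; so \<rho> has trivial stabiliser.\<close>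
    have regular: "i = j" if "\<rho>$i = \<rho>$j" for i j
    proof (rule ccontr)
      assume ne: "i \<noteq> j"
      have "weyl_act (Transposition.transpose i j) \<rho> = \<rho>"
        using that by (simp add: vec_eq_iff weyl_act_nth Transposition.transpose_def)
      then have "a \<rho> = of_int (sign (Transposition.transpose i j)) * a \<rho>"
        using antisym[of "Transposition.transpose i j" \<rho>] by (simp add: permutes_swap_id)
      then show False using ne by (simp add: a\<rho> sign_swap_id)
    qed
    have "inv_into UNIV v i = inv_into UNIV w i" for i
      using eq regular by (metis weyl_act_nth)
    then have "inv_into UNIV v = inv_into UNIV w" by (simp add: fun_eq_iff)
    then show "v = w" using v w by (metis P_def mem_Collect_eq permutes_inv_inv)
  qed
  have "F h = (\<Sum>x\<in>(\<lambda>w. weyl_act w \<rho>) ` P. a x * exp (pairing x h))"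
    unfolding F
  proof (rule sum.mono_neutral_right[OF finE])
    show "(\<lambda>w. weyl_act w \<rho>) ` P \<subseteq> E"
    proof clarify
      fix w assume "w \<in> P"
      then have "a (weyl_act w \<rho>) \<noteq> 0" by (simp add: aw sign_def)
      then show "weyl_act w \<rho> \<in> E" using a0 by blast
    qed
    show "\<forall>x\<in>E - (\<lambda>w. weyl_act w \<rho>) ` P. a x * exp (pairing x h) = 0"
      using orbit by fastforce
  qed
  also have "\<dots> = alternating_sum \<rho> h"
    by (subst sum.reindex[OF inj]) (auto simp: aw alternating_sum_def P_def intro!: sum.cong)
  finally show ?thesis by (simp add: F_def \<rho>_def)
qed

section \<open>Differentiating a representation\<close>

lemma scaleR_matrix_mult:
  fixes A B :: "complex^'n^'n"
  shows "(r *\<^sub>R A) ** B = r *\<^sub>R (A ** B)" "A ** (r *\<^sub>R B) = r *\<^sub>R (A ** B)"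
  by (simp_all add: vec_eq_iff matrix_matrix_mult_def scaleR_right.sum)

lemma matrix_add_rdistrib: "((A::complex^'n^'n) + B) ** C = A ** C + B ** C"
  by (simp add: vec_eq_iff matrix_matrix_mult_def sum.distrib algebra_simps)

lemma bounded_bilinear_matrix_mult:
  "bounded_bilinear ((**) :: complex^'n^'n \<Rightarrow> complex^'n^'n \<Rightarrow> complex^'n^'n)"
  unfolding bilinear_conv_bounded_bilinear[symmetric] bilinear_def
  by (auto intro!: linearI simp: matrix_add_ldistrib matrix_add_rdistrib scaleR_matrix_mult)

lemmas matrix_mult_left_linear = bounded_bilinear.bounded_linear_left[OF bounded_bilinear_matrix_mult]
lemmas matrix_mult_right_linear = bounded_bilinear.bounded_linear_right[OF bounded_bilinear_matrix_mult]
lemmas has_vector_derivative_matrix_mult =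
  bounded_bilinear.has_vector_derivative[OF bounded_bilinear_matrix_mult]
lemmas tendsto_matrix_mult = bounded_bilinear.tendsto[OF bounded_bilinear_matrix_mult]
lemmas matrix_diff_ldistrib = bounded_bilinear.diff_right[OF bounded_bilinear_matrix_mult]
lemmas matrix_diff_rdistrib = bounded_bilinear.diff_left[OF bounded_bilinear_matrix_mult]

lemma has_vector_derivative_limit:
  fixes f :: "real \<Rightarrow> 'a::real_normed_vector"
  shows "(f has_vector_derivative D) (at x) \<longleftrightarrow> ((\<lambda>h. (1 / h) *\<^sub>R (f (x + h) - f x)) \<longlongrightarrow> D) (at 0)"
proof -
  have "(f has_vector_derivative D) (at x) \<longleftrightarrow>
      (\<lambda>h. norm (f (x + h) - f x - h *\<^sub>R D) / norm h) \<midarrow>0\<rightarrow> 0"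
    by (simp add: has_vector_derivative_def has_derivative_at bounded_linear_scaleR_left)
  also have "\<dots> \<longleftrightarrow> ((\<lambda>h. norm ((1 / h) *\<^sub>R (f (x + h) - f x) - D)) \<longlongrightarrow> 0) (at 0)"
  proof (rule filterlim_cong[OF refl refl])
    show "\<forall>\<^sub>F h in at 0. norm (f (x + h) - f x - h *\<^sub>R D) / norm h
        = norm ((1 / h) *\<^sub>R (f (x + h) - f x) - D)"
    proof (rule eventually_at[THEN iffD2], intro exI[of _ 1] conjI ballI impI)
      fix h :: real assume "h \<noteq> 0 \<and> dist h 0 < 1"
      then have "(1 / h) *\<^sub>R (f (x + h) - f x) - D = (1 / h) *\<^sub>R (f (x + h) - f x - h *\<^sub>R D)"
        by (simp add: scaleR_diff_right)
      then show "norm (f (x + h) - f x - h *\<^sub>R D) / norm h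
        = norm ((1 / h) *\<^sub>R (f (x + h) - f x) - D)" by simp
    qed simp
  qed
  also have "\<dots> \<longleftrightarrow> ((\<lambda>h. (1 / h) *\<^sub>R (f (x + h) - f x)) \<longlongrightarrow> D) (at 0)"
    by (simp add: tendsto_norm_zero_iff flip: LIM_zero_iff[of _ D])
  finally show ?thesis .
qed

lemma has_vector_derivative_entrywise:
  fixes u :: "real \<Rightarrow> complex^'n^'n"
  assumes "\<And>i j. ((\<lambda>s. u s$i$j) has_vector_derivative X$i$j) (at x)"
  shows "(u has_vector_derivative X) (at x)"
  unfolding has_vector_derivative_limit
  by (intro vec_tendstoI) (use assms in \<open>simp add: has_vector_derivative_limit\<close>)

lemma tendsto_det:
  fixes f :: "'b \<Rightarrow> complex^'n^'n"
  assumes "(f \<longlongrightarrow> A) F" shows "((\<lambda>x. det (f x)) \<longlongrightarrow> det A) F"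
  unfolding det_def by (intro tendsto_intros assms)

text \<open>Integrating over a short interval exhibits a continuous one-parameter group as a
  difference of differentiable functions times a fixed invertible matrix.\<close>

lemma one_parameter_group_differentiable:
  fixes \<phi> :: "real \<Rightarrow> complex^'m^'m"
  assumes cont: "continuous_on UNIV \<phi>" and add: "\<And>s t. \<phi> (s + t) = \<phi> s ** \<phi> t"
    and one: "\<phi> 0 = mat 1"
  shows "\<exists>Y. (\<phi> has_vector_derivative Y) (at 0)"
proof -
  \<comment> \<open>Starting at -1 makes \<open>F\<close> differentiable on both sides of 0.\<close>
  define F where "F t = integral {-1..t} \<phi>" for t
  have cont': "continuous_on S \<phi>" for S using cont continuous_on_subset by blast
  have F: "(F has_vector_derivative \<phi> t) (at t)" if "-1 < t" "t < 2" for t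
  proof -
    have "(F has_vector_derivative \<phi> t) (at t within {-1..2})"
      unfolding F_def using that by (intro integral_has_vector_derivative cont') auto
    then show ?thesis using that by (simp add: at_within_Icc_at)
  qed
  have "((\<lambda>h. (1 / h) *\<^sub>R (F h - F 0)) \<longlongrightarrow> \<phi> 0) (at 0)"
    using F[of 0] by (simp add: has_vector_derivative_limit)
  then have "((\<lambda>h. det ((1 / h) *\<^sub>R (F h - F 0))) \<longlongrightarrow> det (\<phi> 0)) (at 0)"
    by (rule tendsto_det)
  then have "\<forall>\<^sub>F h in at 0. det ((1 / h) *\<^sub>R (F h - F 0)) \<noteq> 0"
    by (rule tendsto_imp_eventually_ne) (simp add: one)
  then obtain d where d: "d > 0" "\<And>h. h \<noteq> 0 \<Longrightarrow> \<bar>h\<bar> < d \<Longrightarrow> det ((1 / h) *\<^sub>R (F h - F 0)) \<noteq> 0"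
    by (auto simp: eventually_at dist_real_def)
  \<comment> \<open>Small enough for invertibility and for \<open>a\<close> to lie where
    \<open>F\<close> is known to be differentiable.\<close>
  define a where "a = min (d / 2) (1 / 2)"
  have a: "a > 0" "a \<le> 1 / 2" "det ((1 / a) *\<^sub>R (F a - F 0)) \<noteq> 0"
    using d by (auto simp: a_def)
  then obtain R where R: "((1 / a) *\<^sub>R (F a - F 0)) ** R = mat 1"
    by (metis invertible_det_nz invertible_def)
  have A: "F a - F 0 = integral {0..a} \<phi>"
    using Henstock_Kurzweil_Integration.integral_combine[of "-1" 0 a \<phi>] a integrable_continuous_interval[OF cont', of "-1" a]
    by (simp add: F_def algebra_simps)
  \<comment> \<open>Left multiplication by \<open>\<phi> t\<close> translates the interval of
    integration.\<close>
  have shift: "\<phi> t ** (F a - F 0) = F (t + a) - F t" if t: "-1 < t" "t < 1" for t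
  proof -
    have "\<phi> t ** (F a - F 0) = integral {0..a} (\<lambda>s. \<phi> t ** \<phi> s)"
      unfolding A
      using integral_linear[OF integrable_continuous_interval[OF cont'] matrix_mult_right_linear, of 0 a "\<phi> t"]
      by (simp add: o_def)
    also have "\<dots> = integral {0..a} (\<phi> \<circ> (+) t)"
      by (simp add: o_def flip: add)
    also have "\<dots> = integral {0 + t..a + t} \<phi>"
      by (rule integral_shift_Icc_real)
    also have "\<dots> = F (t + a) - F t"
      using Henstock_Kurzweil_Integration.integral_combine[of "-1" t "t + a" \<phi>] a t integrable_continuous_interval[OF cont', of "-1" "t + a"]
      by (simp add: F_def algebra_simps)
    finally show ?thesis .
  qed
  have eq: "\<phi> t = ((1 / a) *\<^sub>R (F (t + a) - F t)) ** R" if t: "-1 < t" "t < 1" for t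
  proof -
    have "\<phi> t = \<phi> t ** (((1 / a) *\<^sub>R (F a - F 0)) ** R)" by (simp add: R)
    also have "\<dots> = ((1 / a) *\<^sub>R (\<phi> t ** (F a - F 0))) ** R"
      by (simp add: matrix_mul_assoc scaleR_matrix_mult)
    finally show ?thesis by (simp add: shift[OF t])
  qed
  have shift_deriv: "((\<lambda>t. F (t + a)) has_vector_derivative \<phi> a) (at 0)"
    using F[of a] a by (simp add: has_vector_derivative_limit add.commute)
  have "((\<lambda>t. ((1 / a) *\<^sub>R (F (t + a) - F t)) ** R) has_vector_derivative
      ((1 / a) *\<^sub>R (\<phi> a - \<phi> 0)) ** R) (at 0)"
    by (intro bounded_linear.has_vector_derivative[OF matrix_mult_left_linear]
        bounded_linear.has_vector_derivative[OF bounded_linear_scaleR_right]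
        has_vector_derivative_diff shift_deriv F) auto
  then have "(\<phi> has_vector_derivative ((1 / a) *\<^sub>R (\<phi> a - \<phi> 0)) ** R) (at 0)"
    by (rule has_vector_derivative_transform_within_open[where S="{-1<..<1}"]) (auto simp: eq)
  then show ?thesis by blast
qed

section \<open>Bounded powers and curves tangent to a constant\<close>

definition mpow :: "complex^'n^'n \<Rightarrow> nat \<Rightarrow> complex^'n^'n" where
  "mpow A j = ((\<lambda>X. A ** X) ^^ j) (mat 1)"

lemma mpow_0 [simp]: "mpow A 0 = mat 1" and mpow_Suc [simp]: "mpow A (Suc j) = A ** mpow A j"
  by (simp_all add: mpow_def)

lemma mpow_SU: "A \<in> carrier SU \<Longrightarrow> mpow A j \<in> carrier SU"
  by (induction j) (auto simp: SU_one SU_closed)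

lemma rep_mpow: "is_representation \<pi> \<Longrightarrow> A \<in> carrier SU \<Longrightarrow> \<pi> (mpow A j) = mpow (\<pi> A) j"
  by (induction j) (auto simp: rep_one rep_mult mpow_SU)

lemma mpow_telescope: "mpow B N - mat 1 = (B - mat 1) ** (\<Sum>j<N. mpow B j)"
proof (induction N)
  case (Suc N)
  have "mpow B (Suc N) - mat 1 = (B - mat 1) ** mpow B N + (mpow B N - mat 1)"
    by (simp add: matrix_diff_rdistrib)
  then show ?case by (simp add: Suc matrix_add_ldistrib)
qed simp

lemma norm_matrix_le: "norm (A :: complex^'n^'n) \<le> (\<Sum>i\<in>UNIV. \<Sum>j\<in>UNIV. cmod (A$i$j))"
proof -
  have "norm A \<le> (\<Sum>i\<in>UNIV. norm (A$i))"
    unfolding norm_vec_def[of A] by (rule L2_set_le_sum) simp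
  also have "\<dots> \<le> (\<Sum>i\<in>UNIV. \<Sum>j\<in>UNIV. cmod (A$i$j))"
    unfolding norm_vec_def by (intro sum_mono L2_set_le_sum) simp
  finally show ?thesis .
qed

text \<open>Rows of a unitary matrix are unit vectors. The bound is uniform over the group, hence
  holds for all powers of an element.\<close>

lemma norm_SU_le:
  fixes A :: "complex^'n^'n"
  assumes "A \<in> carrier SU" shows "norm A \<le> (real CARD('n))\<^sup>2"
proof -
  have "cmod (A$i$j) \<le> 1" for i j
  proof -
    have "(A ** ctranspose A)$i$i = 1" using assms by (simp add: carrier_SU mat_def)
    then have "(\<Sum>k\<in>UNIV. A$i$k * cnj (A$i$k)) = 1"
      by (simp add: matrix_matrix_mult_def ctranspose_nth)
    then have "complex_of_real (\<Sum>k\<in>UNIV. (cmod (A$i$k))\<^sup>2) = 1"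
      by (simp only: of_real_sum complex_norm_square)
    then have "(\<Sum>k\<in>UNIV. (cmod (A$i$k))\<^sup>2) = 1" using of_real_eq_1_iff by blast
    then have "(cmod (A$i$j))\<^sup>2 \<le> 1"
      using member_le_sum[of j UNIV "\<lambda>k. (cmod (A$i$k))\<^sup>2"] by simp
    then show ?thesis by (simp add: power_le_one_iff abs_square_le_1)
  qed
  then have "(\<Sum>i\<in>UNIV. \<Sum>j\<in>UNIV. cmod (A$i$j)) \<le> (\<Sum>i\<in>(UNIV::'n set). \<Sum>j\<in>(UNIV::'n set). 1)"
    by (intro sum_mono) auto
  then show ?thesis using norm_matrix_le[of A] by (simp add: power2_eq_square)
qed

text \<open>If \<open>u\<close> is tangent to the constant curve then \<open>u (1/N) ^ j\<close> is uniformly close to the identity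
  for \<open>j \<le> N\<close>, and so is its image; comparing with \<open>\<pi> (u (1/N)) ^ N - 1 = (\<pi> (u (1/N)) - 1) * (\<Sum>j<N. \<dots>)\<close>
  forces the derivative of \<open>\<pi> \<circ> u\<close> to vanish.\<close>

lemma rep_derivative_zero:
  fixes \<pi> :: "complex^'n^'n \<Rightarrow> complex^'m^'m"
  assumes rep: "is_representation \<pi>" and SU: "\<And>s. u s \<in> carrier SU" and u0: "u 0 = mat 1"
    and du: "(u has_vector_derivative 0) (at 0)"
    and dM: "((\<lambda>s. \<pi> (u s)) has_vector_derivative M) (at 0)"
  shows "M = 0"
proof -
  define r where "r N = 1 / real (Suc N)" for N
  have r: "filterlim r (at 0) sequentially"
    unfolding filterlim_at r_def using LIMSEQ_Suc[OF lim_1_over_n]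
    by (auto intro!: always_eventually)
  define U where "U N = u (r N)" for N
  have U: "U N \<in> carrier SU" for N by (simp add: U_def SU)
  define e where "e N = real (Suc N) *\<^sub>R (U N - mat 1)" for N
  define B where "B N = \<pi> (U N)" for N
  define m where "m N = real (Suc N) *\<^sub>R (B N - mat 1)" for N
  have e: "e \<longlonglongrightarrow> 0"
    using filterlim_compose[OF du[unfolded has_vector_derivative_limit] r]
    by (simp add: e_def[abs_def] U_def r_def u0)
  have m: "m \<longlonglongrightarrow> M"
    using filterlim_compose[OF dM[unfolded has_vector_derivative_limit] r]
    by (simp add: m_def[abs_def] B_def U_def r_def u0 rep_one[OF rep])
  have "\<exists>K>0. \<forall>(A :: complex^'n^'n) (B :: complex^'n^'n). norm (A ** B) \<le> norm A * norm B * K"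
    by (rule bounded_bilinear.pos_bounded[OF bounded_bilinear_matrix_mult])
  then obtain K where K': "0 < K \<and> (\<forall>(A :: complex^'n^'n) (B :: complex^'n^'n). norm (A ** B) \<le> norm A * norm B * K)"
    by (rule exE)
  have K: "K > 0" "norm (A ** B) \<le> norm A * norm B * K" for A B :: "complex^'n^'n"
    using K' by simp_all
  define C where "C = (real CARD('n))\<^sup>2"
  \<comment> \<open>The powers stay bounded, so the deviation from the identity grows only linearly
    in \<open>j\<close>.\<close>
  have close: "norm (mpow (U N) j - mat 1) \<le> real j * (K * C * norm (U N - mat 1))" for N j
  proof (induction j)
    case (Suc j)
    have "mpow (U N) (Suc j) - mat 1 = (U N - mat 1) ** mpow (U N) j + (mpow (U N) j - mat 1)"
      by (simp add: matrix_diff_rdistrib)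
    then have "norm (mpow (U N) (Suc j) - mat 1) \<le>
        norm ((U N - mat 1) ** mpow (U N) j) + norm (mpow (U N) j - mat 1)"
      by (metis norm_triangle_ineq)
    also have "norm ((U N - mat 1) ** mpow (U N) j) \<le> norm (U N - mat 1) * C * K"
    proof -
      have "norm ((U N - mat 1) ** mpow (U N) j) \<le> norm (U N - mat 1) * norm (mpow (U N) j) * K"
        by (rule K)
      also have "\<dots> \<le> norm (U N - mat 1) * C * K"
        using norm_SU_le[OF mpow_SU[OF U]] K(1) by (intro mult_mono) (auto simp: C_def)
      finally show ?thesis .
    qed
    finally show ?case using Suc by (simp add: algebra_simps)
  qed simp
  have unif: "\<forall>\<^sub>F N in sequentially. \<forall>j\<le>Suc N. norm (mpow (B N) j - mat 1) < \<epsilon>" if "\<epsilon> > 0" for \<epsilon>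
  proof -
    have "continuous_on (carrier SU) \<pi>" using rep by (simp add: is_representation_def)
    then obtain d where d: "d > 0"
      "\<And>g. g \<in> carrier SU \<Longrightarrow> dist g (mat 1) < d \<Longrightarrow> dist (\<pi> g) (\<pi> (mat 1)) < \<epsilon>"
      using SU_one \<open>\<epsilon> > 0\<close> unfolding continuous_on_iff by metis
    have "(\<lambda>N. K * C * norm (e N)) \<longlonglongrightarrow> K * C * norm (0 :: complex^'n^'n)"
      by (intro tendsto_intros e)
    then have "\<forall>\<^sub>F N in sequentially. K * C * norm (e N) < d"
      using d(1) by (intro order_tendstoD) auto
    then show ?thesis
    proof (rule eventually_mono, intro allI impI)
      fix N j assume N: "K * C * norm (e N) < d" and j: "j \<le> Suc N"
      have "norm (mpow (U N) j - mat 1) \<le> real (Suc N) * (K * C * norm (U N - mat 1))"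
        using close[of N j] j K(1)
        by (elim order_trans) (intro mult_right_mono, auto simp: C_def)
      also have "\<dots> = K * C * norm (e N)" by (simp add: e_def)
      finally have "dist (mpow (U N) j) (mat 1) < d" using N by (simp add: dist_norm)
      from d(2)[OF mpow_SU[OF U] this] show "norm (mpow (B N) j - mat 1) < \<epsilon>"
        by (simp add: B_def rep_mpow[OF rep U] rep_one[OF rep] dist_norm)
    qed
  qed
  define S where "S N = r N *\<^sub>R (\<Sum>j<Suc N. mpow (B N) j)" for N
  have S: "S \<longlonglongrightarrow> mat 1"
  proof (rule tendstoI)
    fix \<epsilon> :: real assume \<epsilon>: "\<epsilon> > 0"
    show "\<forall>\<^sub>F N in sequentially. dist (S N) (mat 1) < \<epsilon>"
      using unif[OF \<epsilon>]
    proof (rule eventually_mono)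
      fix N assume N: "\<forall>j\<le>Suc N. norm (mpow (B N) j - mat 1) < \<epsilon>"
      have "S N - mat 1 = r N *\<^sub>R (\<Sum>j<Suc N. mpow (B N) j - mat 1)"
        unfolding sum_subtractf sum_constant_scaleR S_def by (simp add: scaleR_diff_right r_def)
      then have "norm (S N - mat 1) = r N * norm (\<Sum>j<Suc N. mpow (B N) j - mat 1)"
        by (simp add: r_def)
      also have "\<dots> < r N * (\<Sum>j<Suc N. \<epsilon>)"
        using N
        by (intro mult_strict_left_mono le_less_trans[OF norm_sum] sum_strict_mono) (auto simp: r_def)
      also have "\<dots> = \<epsilon>" by (simp add: r_def)
      finally show "dist (S N) (mat 1) < \<epsilon>" by (simp add: dist_norm)
    qed
  qed
  have "(\<lambda>N. m N ** S N) \<longlonglongrightarrow> M ** mat 1"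
    by (intro tendsto_matrix_mult m S)
  moreover have "m N ** S N = mpow (B N) (Suc N) - mat 1" for N
    unfolding m_def S_def mpow_telescope by (simp add: scaleR_matrix_mult r_def)
  moreover have "(\<lambda>N. mpow (B N) (Suc N) - mat 1) \<longlonglongrightarrow> 0"
  proof (rule tendstoI)
    fix \<epsilon> :: real assume \<epsilon>: "\<epsilon> > 0"
    show "\<forall>\<^sub>F N in sequentially. dist (mpow (B N) (Suc N) - mat 1) 0 < \<epsilon>"
      using unif[OF \<epsilon>] by (rule eventually_mono) (simp del: mpow_Suc)
  qed
  ultimately show "M = 0" using LIMSEQ_unique by fastforce
qed

section \<open>Complex scalars and matrix units\<close>

definition cscale :: "complex \<Rightarrow> complex^'n^'n \<Rightarrow> complex^'n^'n" (infixr "*\<^sub>C" 75) where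
  "c *\<^sub>C A = (\<chi> i j. c * A$i$j)"

lemma cscale_nth [simp]: "(c *\<^sub>C A)$i$j = c * A$i$j"
  by (simp add: cscale_def)

lemma cscale_add_right: "c *\<^sub>C (A + B) = c *\<^sub>C A + c *\<^sub>C B"
  and cscale_add_left: "(c + d) *\<^sub>C A = c *\<^sub>C A + d *\<^sub>C A"
  and cscale_cscale [simp]: "c *\<^sub>C d *\<^sub>C A = (c * d) *\<^sub>C A"
  and cscale_one [simp]: "1 *\<^sub>C A = A"
  and cscale_zero [simp]: "0 *\<^sub>C A = 0"
  and cscale_zero_right [simp]: "c *\<^sub>C 0 = 0"
  and cscale_diff_right: "c *\<^sub>C (A - B) = c *\<^sub>C A - c *\<^sub>C B"
  and scaleR_cscale: "r *\<^sub>R A = of_real r *\<^sub>C A"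
  by (simp_all add: vec_eq_iff algebra_simps scaleR_conv_of_real[where 'a=complex])

lemma cscale_mult: "(c *\<^sub>C A) ** B = c *\<^sub>C (A ** B)" "A ** (c *\<^sub>C B) = c *\<^sub>C (A ** B)"
  by (simp_all add: vec_eq_iff matrix_matrix_mult_def sum_distrib_left mult_ac)

lemma cscale_vec: "(c *\<^sub>C A) *v x = c *s (A *v x)"
  by (simp add: vec_eq_iff matrix_vector_mult_def sum_distrib_left mult_ac)

lemma ctranspose_cscale: "ctranspose (c *\<^sub>C A) = cnj c *\<^sub>C ctranspose A"
  by (simp add: vec_eq_iff ctranspose_nth)

lemma ctranspose_add: "ctranspose (A + B) = ctranspose A + ctranspose B"
  and ctranspose_diff: "ctranspose (A - B) = ctranspose A - ctranspose B"
  by (simp_all add: vec_eq_iff ctranspose_nth)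

lemma trace_cscale: "trace (c *\<^sub>C A) = c * trace A"
  by (simp add: trace_def sum_distrib_left)

lemma trace_ctranspose: "trace (ctranspose A) = cnj (trace A)"
  by (simp add: trace_def ctranspose_nth)

lemma bounded_linear_ctranspose: "bounded_linear ctranspose"
  by (auto intro!: linearI simp: linear_conv_bounded_linear[symmetric] ctranspose_add scaleR_cscale ctranspose_cscale)

definition munit :: "'n \<Rightarrow> 'n \<Rightarrow> complex^'n^'n" where
  "munit i j = (\<chi> a b. if a = i \<and> b = j then 1 else 0)"

lemma munit_nth: "munit i j$a$b = (if a = i \<and> b = j then 1 else 0)"
  by (simp add: munit_def)

lemma munit_mult: "munit i j ** munit k l = (if j = k then munit i l else 0)"
proof -
  have "(\<Sum>c\<in>UNIV. (if a = i \<and> c = j then 1 else 0) * (if c = k \<and> b = l then 1 else (0::complex)))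
      = (if j = k \<and> a = i \<and> b = l then 1 else 0)" for a b
    by (subst sum.remove[of _ j]) (auto intro!: sum.neutral)
  then show ?thesis by (auto simp: vec_eq_iff matrix_matrix_mult_def munit_nth)
qed

lemma munit_sum: "(\<Sum>i\<in>UNIV. \<Sum>j\<in>UNIV. A$i$j *\<^sub>C munit i j) = A"
proof -
  have "(\<Sum>i\<in>UNIV. \<Sum>j\<in>UNIV. A$i$j * (if a = i \<and> b = j then 1 else 0)) = A$a$b" for a b
  proof -
    have "(\<Sum>j\<in>UNIV. A$i$j * (if a = i \<and> b = j then 1 else 0)) = (if a = i then A$a$b else 0)" for i
      by (cases "a = i") (simp_all add: if_distrib cong: if_cong)
    then show ?thesis by simp
  qed
  then show ?thesis by (simp add: vec_eq_iff munit_nth)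
qed

lemma diagonal_nth: "diagonal v$i$j = (if i = j then v$i else 0)"
  by (simp add: diagonal_def)

lemma diagonal_mult_nth: "(diagonal v ** A)$i$j = v$i * A$i$j"
  by (simp add: matrix_matrix_mult_def diagonal_nth if_distrib[of "\<lambda>x. x * _"] cong: if_cong)

lemma mult_diagonal_nth: "(A ** diagonal v)$i$j = A$i$j * v$j"
  by (simp add: matrix_matrix_mult_def diagonal_nth if_distrib cong: if_cong)

subsection \<open>One-parameter subgroups\<close>

text \<open>A Givens rotation with a phase. With the torus, \<zeta> = 1 suffices to generate the
  group; the phases let the generators \<open>rot_gen i j \<zeta>\<close> reach every off-diagonal
  skew-Hermitian direction.\<close>

definition rot :: "'n \<Rightarrow> 'n \<Rightarrow> complex \<Rightarrow> real \<Rightarrow> complex^'n^'n" where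
  "rot i j \<zeta> t = (\<chi> a b.
     if a = i then (if b = i then of_real (cos t) else if b = j then \<zeta> * of_real (sin t) else 0)
     else if a = j then (if b = i then - cnj \<zeta> * of_real (sin t) else if b = j then of_real (cos t) else 0)
     else if a = b then 1 else 0)"

definition rot_gen :: "'n \<Rightarrow> 'n \<Rightarrow> complex \<Rightarrow> complex^'n^'n" where
  "rot_gen i j \<zeta> = \<zeta> *\<^sub>C munit i j - cnj \<zeta> *\<^sub>C munit j i"

lemma rot_row_sum:
  assumes "i \<noteq> j"
  shows "(\<Sum>k\<in>UNIV. rot i j \<zeta> t$a$k * f k) =
    (if a = i then of_real (cos t) * f i + \<zeta> * of_real (sin t) * f j
     else if a = j then - cnj \<zeta> * of_real (sin t) * f i + of_real (cos t) * f j else f a)"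
proof -
  have "(\<Sum>k\<in>UNIV. rot i j \<zeta> t$a$k * f k) = (\<Sum>k\<in>(if a = i \<or> a = j then {i,j} else {a}). rot i j \<zeta> t$a$k * f k)"
    by (rule sum.mono_neutral_right) (auto simp: rot_def)
  then show ?thesis using assms by (auto simp: rot_def)
qed

lemma rot_vec:
  assumes "i \<noteq> j"
  shows "(rot i j \<zeta> t *v x)$a =
    (if a = i then of_real (cos t) * x$i + \<zeta> * of_real (sin t) * x$j
     else if a = j then - cnj \<zeta> * of_real (sin t) * x$i + of_real (cos t) * x$j else x$a)"
  using rot_row_sum[OF assms, of \<zeta> t a "\<lambda>k. x$k"] by (simp add: matrix_vector_mult_def)

lemma rot_zero: "i \<noteq> j \<Longrightarrow> rot i j \<zeta> 0 = mat 1"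
  by (auto simp: vec_eq_iff rot_def mat_def)

lemma rot_add:
  assumes ij: "i \<noteq> j" and \<zeta>: "cmod \<zeta> = 1"
  shows "rot i j \<zeta> (s + t) = rot i j \<zeta> s ** rot i j \<zeta> t"
proof -
  have z: "cnj \<zeta> * \<zeta> = 1" "\<zeta> * cnj \<zeta> = 1"
    using complex_norm_square[of \<zeta>] \<zeta> by (simp_all add: mult.commute)
  have z': "\<zeta> * (cnj \<zeta> * x) = x" "cnj \<zeta> * (\<zeta> * x) = x" for x
    using z by (simp_all flip: mult.assoc)
  have "(rot i j \<zeta> s ** rot i j \<zeta> t)$a$b = rot i j \<zeta> (s + t)$a$b" for a b
    unfolding matrix_matrix_mult_def vec_lambda_beta rot_row_sum[OF ij]
    using ij by (auto simp: rot_def cos_add sin_add algebra_simps z z')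
  then show ?thesis by (simp add: vec_eq_iff)
qed

lemma ctranspose_rot: "i \<noteq> j \<Longrightarrow> ctranspose (rot i j \<zeta> t) = rot i j \<zeta> (- t)"
  by (auto simp: vec_eq_iff ctranspose_nth rot_def)

text \<open>Reflecting the \<open>i\<close>-th axis inverts the rotation, so its determinant is \<open>\<plusminus>1\<close>, and it is a square.\<close>

lemma det_rot:
  fixes i j :: "'n::finite"
  assumes ij: "i \<noteq> j" and \<zeta>: "cmod \<zeta> = 1"
  shows "det (rot i j \<zeta> t) = 1"
proof -
  have sq: "det (rot i j \<zeta> t) * det (rot i j \<zeta> t) = 1" for t
  proof -
    define D :: "complex^'n^'n" where "D = diagonal (\<chi> a. if a = i then -1 else 1)"
    have "D ** D = mat 1"
      by (auto simp: D_def vec_eq_iff diagonal_mult_nth diagonal_nth mat_def)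
    then have D: "det D * det D = 1" by (metis det_I det_mul)
    have "D ** rot i j \<zeta> t ** D = rot i j \<zeta> (- t)"
      using ij by (auto simp: D_def vec_eq_iff diagonal_mult_nth mult_diagonal_nth rot_def)
    then have "det D * det (rot i j \<zeta> t) * det D = det (rot i j \<zeta> (- t))" by (metis det_mul)
    then have "det (rot i j \<zeta> (- t)) = det (rot i j \<zeta> t)" using D by (metis mult.assoc mult.commute mult_1_left)
    moreover have "rot i j \<zeta> t ** rot i j \<zeta> (- t) = mat 1"
      using rot_add[OF ij \<zeta>, of t "- t"] rot_zero[OF ij] by simp
    then have "det (rot i j \<zeta> t) * det (rot i j \<zeta> (- t)) = 1" by (metis det_I det_mul)
    ultimately show ?thesis by simp
  qed
  have "rot i j \<zeta> t = rot i j \<zeta> (t / 2) ** rot i j \<zeta> (t / 2)"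
    using rot_add[OF ij \<zeta>, of "t / 2" "t / 2"] by simp
  then show ?thesis using sq by (simp add: det_mul)
qed

lemma rot_SU:
  assumes ij: "i \<noteq> j" and \<zeta>: "cmod \<zeta> = 1"
  shows "rot i j \<zeta> t \<in> carrier SU"
  using rot_add[OF assms, of t "- t"] rot_zero[OF ij]
  by (simp add: carrier_SU det_rot[OF assms] ctranspose_rot[OF ij])

text \<open>Fixed matrices with scalar coefficients reduce continuity and derivative to those of cos
  and sin.\<close>

lemma rot_eq:
  assumes "i \<noteq> j"
  shows "rot i j \<zeta> t = mat 1 + (cos t - 1) *\<^sub>R (munit i i + munit j j) + sin t *\<^sub>R rot_gen i j \<zeta>"
  using assms
  by (auto simp: vec_eq_iff rot_def rot_gen_def munit_nth mat_def scaleR_conv_of_real[where 'a=complex])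

lemma continuous_rot:
  assumes "i \<noteq> j" shows "continuous_on S (rot i j \<zeta>)"
  unfolding ext[of "rot i j \<zeta>", OF rot_eq[OF assms]] by (intro continuous_intros)

lemma rot_derivative:
  assumes "i \<noteq> j" shows "(rot i j \<zeta> has_vector_derivative rot_gen i j \<zeta>) (at 0)"
  unfolding ext[of "rot i j \<zeta>", OF rot_eq[OF assms]]
  by (auto intro!: derivative_eq_intros has_real_derivative_iff_has_vector_derivative[THEN iffD1])

lemma exp_diagonal_nth: "exp_diagonal h$i$j = (if i = j then exp (h$i) else 0)"
  by (simp add: exp_diagonal_def diagonal_nth)

lemma exp_diagonal_add: "exp_diagonal (h + k) = exp_diagonal h ** exp_diagonal k"
  by (simp add: vec_eq_iff exp_diagonal_def diagonal_mult_nth) (simp add: diagonal_nth exp_add)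

lemma det_exp_diagonal: "det (exp_diagonal h) = exp (\<Sum>i\<in>UNIV. h$i)"
  unfolding exp_sum[OF finite] by (subst det_diagonal) (auto simp: exp_diagonal_nth)

lemma ctranspose_exp_diagonal: "h \<in> cartan \<Longrightarrow> ctranspose (exp_diagonal h) = exp_diagonal (- h)"
proof -
  assume h: "h \<in> cartan"
  have "cnj (h$i) = - h$i" for i
    using h by (auto simp: cartan_def complex_eq_iff)
  then show ?thesis by (auto simp: vec_eq_iff ctranspose_nth exp_diagonal_nth simp: exp_cnj)
qed

lemma exp_diagonal_zero [simp]: "exp_diagonal 0 = mat 1"
  by (simp add: vec_eq_iff exp_diagonal_nth mat_def)

lemma exp_diagonal_SU: "h \<in> cartan \<Longrightarrow> exp_diagonal h \<in> carrier SU"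
  using exp_diagonal_add[of h "- h"]
  by (simp add: carrier_SU ctranspose_exp_diagonal det_exp_diagonal) (simp add: cartan_def)

lemma cartan_scale: "h \<in> cartan \<Longrightarrow> of_real s *s h \<in> cartan"
  by (auto simp: cartan_def simp flip: sum_distrib_left)

lemma exp_diagonal_derivative:
  "((\<lambda>s. exp_diagonal (of_real s *s h)) has_vector_derivative diagonal h) (at 0)"
proof (rule has_vector_derivative_entrywise)
  fix i j
  have "((\<lambda>s. exp (of_real s * h$i)) has_vector_derivative h$i) (at (0::real))"
    by (rule has_vector_derivative_real_field)
      (auto intro!: derivative_eq_intros)
  then show "((\<lambda>s. exp_diagonal (of_real s *s h)$i$j) has_vector_derivative diagonal h$i$j) (at 0)"
    by (cases "i = j") (simp_all add: exp_diagonal_nth diagonal_nth)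
qed

lemma continuous_exp_diagonal: "continuous_on S exp_diagonal"
proof -
  have "continuous_on S (\<lambda>h. if i = j then exp (h$i) else (0::complex))" for i j
    by (cases "i = j") (auto intro!: continuous_intros)
  then show ?thesis
    unfolding exp_diagonal_def diagonal_def vec_lambda_beta by (intro continuous_on_vec_lambda)
qed

subsection \<open>The complexified derivative\<close>

definition su :: "(complex^'n^'n) set" where
  "su = {X. ctranspose X = - X \<and> trace X = 0}"

definition skew_part :: "complex^'n^'n \<Rightarrow> complex^'n^'n" where
  "skew_part Z = (1 / 2) *\<^sub>C (Z - ctranspose Z)"

definition traceless_part :: "complex^'n^'n \<Rightarrow> complex^'n^'n" where
  "traceless_part Z = Z - (trace Z / of_nat CARD('n)) *\<^sub>C mat 1"

lemma trace_traceless_part: "trace (traceless_part Z) = 0"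
  by (simp add: traceless_part_def trace_sub trace_cscale trace_I)

lemma skew_part_su: "trace Z = 0 \<Longrightarrow> skew_part Z \<in> su"
  by (simp add: su_def skew_part_def ctranspose_cscale ctranspose_diff trace_cscale trace_sub trace_ctranspose)
    (simp add: vec_eq_iff ctranspose_nth algebra_simps)

lemma skew_part_decomp: "Z = skew_part Z + \<i> *\<^sub>C skew_part ((-\<i>) *\<^sub>C Z)"
  by (simp add: skew_part_def vec_eq_iff ctranspose_nth field_simps)

text \<open>gl_n is the complexification of su plus the scalars, so identities linear over the
  complex numbers reduce to \<open>su\<close> and the identity matrix.\<close>

lemma su_decomp:
  obtains X1 X2 c where "X1 \<in> su" "X2 \<in> su" "Z = X1 + \<i> *\<^sub>C X2 + c *\<^sub>C mat 1"
proof
  let ?T = "traceless_part Z"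
  show "skew_part ?T \<in> su" "skew_part ((-\<i>) *\<^sub>C ?T) \<in> su"
    by (simp_all add: skew_part_su trace_cscale trace_traceless_part)
  show "Z = skew_part ?T + \<i> *\<^sub>C skew_part ((-\<i>) *\<^sub>C ?T) + (trace Z / of_nat CARD('a)) *\<^sub>C mat 1"
    unfolding skew_part_decomp[symmetric] by (simp add: traceless_part_def)
qed

locale su_rep =
  fixes \<pi> :: "complex^'n^'n \<Rightarrow> complex^'m^'m"
  assumes rep: "is_representation \<pi>"
begin

text \<open>A relation, because \<pi> is not known to be differentiable: it records any curve along
  which both derivatives exist. Products of curves add velocities, reparametrisation scales
  them.\<close>

definition tangent :: "complex^'n^'n \<Rightarrow> complex^'m^'m \<Rightarrow> bool" where
  "tangent X Y \<longleftrightarrow> (\<exists>u. (\<forall>s. u s \<in> carrier SU) \<and> u 0 = mat 1 \<and>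
     (u has_vector_derivative X) (at 0) \<and> ((\<lambda>s. \<pi> (u s)) has_vector_derivative Y) (at 0))"

lemma tangent_add: "tangent X Y \<Longrightarrow> tangent X' Y' \<Longrightarrow> tangent (X + X') (Y + Y')"
proof -
  assume "tangent X Y" "tangent X' Y'"
  then obtain u v where u: "\<forall>s. u s \<in> carrier SU" "u 0 = mat 1" "(u has_vector_derivative X) (at 0)"
      "((\<lambda>s. \<pi> (u s)) has_vector_derivative Y) (at 0)"
    and v: "\<forall>s. v s \<in> carrier SU" "v 0 = mat 1" "(v has_vector_derivative X') (at 0)"
      "((\<lambda>s. \<pi> (v s)) has_vector_derivative Y') (at 0)"
    by (auto simp: tangent_def)
  have "((\<lambda>s. u s ** v s) has_vector_derivative X + X') (at 0)"
    using has_vector_derivative_matrix_mult[OF u(3) v(3)] by (simp add: u(2) v(2) add.commute)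
  moreover have "((\<lambda>s. \<pi> (u s ** v s)) has_vector_derivative Y + Y') (at 0)"
    using has_vector_derivative_matrix_mult[OF u(4) v(4)] u v
    by (simp add: rep_one[OF rep] rep_mult[OF rep] add.commute)
  ultimately show ?thesis
    unfolding tangent_def using u v by (intro exI[of _ "\<lambda>s. u s ** v s"]) (auto simp: SU_closed)
qed

lemma tangent_scale: "tangent X Y \<Longrightarrow> tangent (r *\<^sub>R X) (r *\<^sub>R Y)"
proof -
  assume "tangent X Y"
  then obtain u where u: "\<forall>s. u s \<in> carrier SU" "u 0 = mat 1" "(u has_vector_derivative X) (at (r * 0))"
      "((\<lambda>s. \<pi> (u s)) has_vector_derivative Y) (at (r * 0))"
    by (auto simp: tangent_def)
  have d: "((\<lambda>s. r * s) has_vector_derivative r) (at 0)"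
    by (auto intro!: derivative_eq_intros)
  show ?thesis
    unfolding tangent_def using u vector_diff_chain_at[OF d u(3)] vector_diff_chain_at[OF d u(4)]
    by (intro exI[of _ "\<lambda>s. u (r * s)"]) (auto simp: o_def)
qed

lemma tangent_conj:
  assumes g: "g \<in> carrier SU" and t: "tangent X Y"
  shows "tangent (g ** X ** ctranspose g) (\<pi> g ** Y ** \<pi> (ctranspose g))"
proof -
  obtain u where u: "\<forall>s. u s \<in> carrier SU" "u 0 = mat 1" "(u has_vector_derivative X) (at 0)"
      "((\<lambda>s. \<pi> (u s)) has_vector_derivative Y) (at 0)"
    using t by (auto simp: tangent_def)
  have "((\<lambda>s. g ** u s ** ctranspose g) has_vector_derivative g ** X ** ctranspose g) (at 0)"
    by (intro bounded_linear.has_vector_derivative[OF matrix_mult_left_linear]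
        bounded_linear.has_vector_derivative[OF matrix_mult_right_linear] u)
  moreover have "((\<lambda>s. \<pi> g ** \<pi> (u s) ** \<pi> (ctranspose g)) has_vector_derivative
      \<pi> g ** Y ** \<pi> (ctranspose g)) (at 0)"
    by (intro bounded_linear.has_vector_derivative[OF matrix_mult_left_linear]
        bounded_linear.has_vector_derivative[OF matrix_mult_right_linear] u)
  ultimately show ?thesis
    unfolding tangent_def using u g
    by (intro exI[of _ "\<lambda>s. g ** u s ** ctranspose g"])
      (auto simp: SU_closed SU_ctranspose SU_mult_ctranspose rep_mult[OF rep])
qed

text \<open>By linearity the difference of two values is tangent to 0, the case settled by
  \<open>rep_derivative_zero\<close>.\<close>

lemma tangent_unique: "tangent X Y \<Longrightarrow> tangent X Y' \<Longrightarrow> Y = Y'"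
proof -
  assume "tangent X Y" "tangent X Y'"
  then have "tangent (X + (-1) *\<^sub>R X) (Y + (-1) *\<^sub>R Y')"
    by (intro tangent_add tangent_scale)
  then have "tangent 0 (Y - Y')" by simp
  then obtain u where u: "\<forall>s. u s \<in> carrier SU" "u 0 = mat 1" "(u has_vector_derivative 0) (at 0)"
      "((\<lambda>s. \<pi> (u s)) has_vector_derivative Y - Y') (at 0)"
    unfolding tangent_def by blast
  have "Y - Y' = 0" by (rule rep_derivative_zero[OF rep _ u(2-4)]) (use u(1) in simp)
  then show ?thesis by simp
qed

lemma tangent_zero: "tangent 0 0"
  unfolding tangent_def by (rule exI[of _ "\<lambda>_. mat 1"]) (simp add: SU_one)

lemma tangent_one_parameter:
  assumes SU: "\<And>s. u s \<in> carrier SU" and u0: "u 0 = mat 1" and add: "\<And>s t. u (s + t) = u s ** u t"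
    and cont: "continuous_on UNIV u" and du: "(u has_vector_derivative X) (at 0)"
  shows "\<exists>Y. tangent X Y \<and> ((\<lambda>s. \<pi> (u s)) has_vector_derivative Y) (at 0)"
proof -
  have "continuous_on (carrier SU) \<pi>" using rep unfolding is_representation_def by (rule conjunct2)
  moreover have "range u \<subseteq> carrier SU" using SU by (rule image_subsetI)
  ultimately have "continuous_on UNIV (\<lambda>s. \<pi> (u s))"
    by (rule continuous_on_compose2[OF _ cont])
  then obtain Y where "((\<lambda>s. \<pi> (u s)) has_vector_derivative Y) (at 0)"
    using one_parameter_group_differentiable[of "\<lambda>s. \<pi> (u s)"]
    by (auto simp: add u0 rep_mult[OF rep SU SU] rep_one[OF rep])
  then show ?thesis
    unfolding tangent_def by (intro exI[of _ Y] conjI exI[of _ u]) (simp_all add: SU u0 du)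
qed

lemma tangent_rot:
  assumes "i \<noteq> j" "cmod \<zeta> = 1"
  shows "\<exists>Y. tangent (rot_gen i j \<zeta>) Y \<and> ((\<lambda>s. \<pi> (rot i j \<zeta> s)) has_vector_derivative Y) (at 0)"
  by (rule tangent_one_parameter[of "rot i j \<zeta>"])
    (use assms in \<open>auto simp: rot_SU rot_zero rot_add continuous_rot rot_derivative\<close>)

lemma tangent_diagonal:
  assumes "h \<in> cartan"
  shows "\<exists>Y. tangent (diagonal h) Y \<and>
    ((\<lambda>s. \<pi> (exp_diagonal (of_real s *s h))) has_vector_derivative Y) (at 0)"
proof (rule tangent_one_parameter[of "\<lambda>s. exp_diagonal (of_real s *s h)"])
  show "continuous_on UNIV (\<lambda>s. exp_diagonal (of_real s *s h))"
  proof (rule continuous_on_compose2[OF continuous_exp_diagonal[of UNIV]])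
    show "continuous_on UNIV (\<lambda>s. of_real s *s h)"
      unfolding scaleR_eq_vec_scale[symmetric] by (intro continuous_intros)
  qed simp
  show "exp_diagonal (of_real (s + t) *s h) = exp_diagonal (of_real s *s h) ** exp_diagonal (of_real t *s h)" for s t
    by (simp add: vec.scale_left_distrib flip: exp_diagonal_add)
qed (use assms in \<open>auto simp: exp_diagonal_SU cartan_scale exp_diagonal_derivative\<close>)

lemma tangent_sum:
  assumes "\<And>i. i \<in> I \<Longrightarrow> \<exists>Y. tangent (X i) Y"
  shows "\<exists>Y. tangent (\<Sum>i\<in>I. X i) Y"
  using assms
proof (induction I rule: infinite_finite_induct)
  case (insert i I)
  then show ?case using tangent_add by (metis insertCI sum.insert)
qed (auto intro: tangent_zero)

text \<open>The diagonal part comes from the torus, each off-diagonal pair from a rotation with the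
  phase of its entry.\<close>

lemma tangent_su:
  assumes X: "X \<in> su" shows "\<exists>Y. tangent X Y"
proof -
  have skew: "cnj (X$j$i) = - X$i$j" for i j
  proof -
    have "ctranspose X$i$j = (- X)$i$j" using X by (simp add: su_def)
    then show ?thesis by (simp add: ctranspose_nth)
  qed
  define h where "h = (\<chi> i. X$i$i)"
  define R where "R i j = X$i$j *\<^sub>C munit i j - cnj (X$i$j) *\<^sub>C munit j i" for i j
  \<comment> \<open>Each off-diagonal pair occurs twice in the double sum, hence the factor
    \<open>1 / 2\<close>.\<close>
  let ?S = "\<Sum>i\<in>UNIV. \<Sum>j\<in>UNIV. (if i = j then 0 else 1 / 2 :: real) *\<^sub>R R i j"
  have h: "h \<in> cartan"
    using X skew[of i i for i] unfolding h_def cartan_def su_def trace_def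
    by (auto simp: complex_eq_iff)
  have "\<exists>Y. tangent ((if i = j then 0 else 1 / 2 :: real) *\<^sub>R R i j) Y" for i j
  proof (cases "i = j \<or> X$i$j = 0")
    case True
    then have "(if i = j then 0 else 1 / 2 :: real) *\<^sub>R R i j = 0" by (auto simp: R_def)
    then show ?thesis using tangent_zero by auto
  next
    case False
    then have ij: "i \<noteq> j" "cmod (sgn (X$i$j)) = 1" by (simp_all add: norm_sgn)
    have "X$i$j = of_real (cmod (X$i$j)) * sgn (X$i$j)"
      using False by (simp add: sgn_div_norm scaleR_conv_of_real[where 'a=complex])
    then have "R i j = cmod (X$i$j) *\<^sub>R rot_gen i j (sgn (X$i$j))"
      unfolding R_def rot_gen_def scaleR_cscale cscale_diff_right cscale_cscale
      by (metis complex_cnj_complex_of_real complex_cnj_mult)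
    then show ?thesis using tangent_rot[OF ij] tangent_scale by metis
  qed
  then have "\<exists>Y. tangent ?S Y"
    by (intro tangent_sum)
  then obtain Y1 where Y1: "tangent ?S Y1" ..
  obtain Y2 where Y2: "tangent (diagonal h) Y2" using tangent_diagonal[OF h] by blast
  have "X = ?S + diagonal h"
  proof -
    have "(\<Sum>i\<in>UNIV. \<Sum>j\<in>UNIV. ((if i = j then 0 else 1 / 2 :: real) *\<^sub>R R i j)$a$b) + diagonal h$a$b = X$a$b" for a b
    proof -
      have e: "((if i = j then 0 else 1 / 2 :: real) *\<^sub>R R i j)$a$b =
          (if i = a then (if j = b then (if i = j then 0 else X$a$b / 2) else 0) else 0)
          + (if i = b then (if j = a then (if i = j then 0 else X$a$b / 2) else 0) else 0)" for i j
        using skew by (auto simp: R_def munit_nth scaleR_conv_of_real[where 'a=complex])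
      have dd: "(\<Sum>i\<in>UNIV. \<Sum>j\<in>UNIV. if i = a then (if j = b then F i j else 0) else (0::complex)) = F a b"
        for F and a b :: 'n
      proof -
        have "(\<Sum>j\<in>UNIV. if i = a then (if j = b then F i j else 0) else 0) = (if i = a then F a b else 0)" for i
          by (cases "i = a") simp_all
        then show ?thesis by simp
      qed
      show ?thesis
        unfolding e sum.distrib dd by (simp add: diagonal_nth h_def)
    qed
    then show ?thesis by (simp add: vec_eq_iff)
  qed
  then have "tangent X (Y1 + Y2)" using tangent_add[OF Y1 Y2] by (simp only:)
  then show ?thesis ..
qed

definition dsu :: "complex^'n^'n \<Rightarrow> complex^'m^'m" where
  "dsu X = (THE Y. tangent X Y)"

lemma dsu_eq: "tangent X Y \<Longrightarrow> dsu X = Y"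
  unfolding dsu_def using tangent_unique by blast

lemma tangent_dsu: "X \<in> su \<Longrightarrow> tangent X (dsu X)"
  using tangent_su dsu_eq by metis

lemma dsu_add: "X \<in> su \<Longrightarrow> Y \<in> su \<Longrightarrow> dsu (X + Y) = dsu X + dsu Y"
  by (intro dsu_eq tangent_add tangent_dsu)

lemma dsu_scale: "X \<in> su \<Longrightarrow> dsu (r *\<^sub>R X) = r *\<^sub>R dsu X"
  by (intro dsu_eq tangent_scale tangent_dsu)

lemma dsu_conj: "g \<in> carrier SU \<Longrightarrow> X \<in> su \<Longrightarrow>
    dsu (g ** X ** ctranspose g) = \<pi> g ** dsu X ** \<pi> (ctranspose g)"
  by (intro dsu_eq tangent_conj tangent_dsu)

text \<open>The complex-linear extension of the derivative to all matrices, with scalars sent to 0;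
  this makes single matrix units available.\<close>

definition d\<pi> :: "complex^'n^'n \<Rightarrow> complex^'m^'m" where
  "d\<pi> Z = dsu (skew_part (traceless_part Z)) + \<i> *\<^sub>C dsu (skew_part ((-\<i>) *\<^sub>C traceless_part Z))"

lemma traceless_part_add: "traceless_part (Y + Z) = traceless_part Y + traceless_part Z"
  by (simp add: traceless_part_def trace_add add_divide_distrib cscale_add_left)

lemma traceless_part_scale: "traceless_part (c *\<^sub>C Z) = c *\<^sub>C traceless_part Z"
  by (simp add: traceless_part_def trace_cscale cscale_diff_right)

lemma skew_part_add: "skew_part (Y + Z) = skew_part Y + skew_part Z"
  by (simp add: skew_part_def ctranspose_add cscale_diff_right cscale_add_right)

lemma skew_part_scaleR: "skew_part (r *\<^sub>R Z) = r *\<^sub>R skew_part Z"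
  by (simp add: skew_part_def scaleR_cscale ctranspose_cscale cscale_diff_right mult.commute)

lemma skew_parts_su:
  "skew_part (traceless_part Z) \<in> su" "skew_part (c *\<^sub>C traceless_part Z) \<in> su"
  by (simp_all add: skew_part_su trace_cscale trace_traceless_part)

lemma d\<pi>_add: "d\<pi> (Y + Z) = d\<pi> Y + d\<pi> Z"
  by (simp add: d\<pi>_def traceless_part_add skew_part_add cscale_add_right dsu_add skew_parts_su)

lemma d\<pi>_scaleR: "d\<pi> (r *\<^sub>R Z) = r *\<^sub>R d\<pi> Z"
proof -
  have 1: "traceless_part (r *\<^sub>R Z) = r *\<^sub>R traceless_part Z"
    by (simp add: scaleR_cscale traceless_part_scale)
  have 2: "(-\<i>) *\<^sub>C r *\<^sub>R A = r *\<^sub>R ((-\<i>) *\<^sub>C A)" for A :: "complex^'n^'n"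
    by (simp add: vec_eq_iff)
  have 3: "\<i> *\<^sub>C r *\<^sub>R A = r *\<^sub>R (\<i> *\<^sub>C A)" for A :: "complex^'m^'m"
    by (simp add: vec_eq_iff)
  show ?thesis
    unfolding d\<pi>_def 1 2 skew_part_scaleR dsu_scale[OF skew_parts_su(1)] dsu_scale[OF skew_parts_su(2)] 3
    by (simp add: scaleR_add_right)
qed

lemma d\<pi>_imaginary: "d\<pi> (\<i> *\<^sub>C Z) = \<i> *\<^sub>C d\<pi> Z"
proof -
  have "\<i> *\<^sub>C traceless_part Z = (-1) *\<^sub>R ((-\<i>) *\<^sub>C traceless_part Z)"
    by (simp add: vec_eq_iff)
  then have "dsu (skew_part (\<i> *\<^sub>C traceless_part Z)) = (-1) *\<^sub>R dsu (skew_part ((-\<i>) *\<^sub>C traceless_part Z))"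
    by (simp only: skew_part_scaleR dsu_scale skew_parts_su)
  then show ?thesis
    by (simp add: d\<pi>_def traceless_part_scale cscale_add_right vec_eq_iff)
qed

lemma d\<pi>_cscale: "d\<pi> (c *\<^sub>C Z) = c *\<^sub>C d\<pi> Z"
proof -
  have c: "c *\<^sub>C A = Re c *\<^sub>R A + Im c *\<^sub>R (\<i> *\<^sub>C A)" for A :: "complex^'k^'k"
  proof -
    have "c *\<^sub>C A = (of_real (Re c) + \<i> * of_real (Im c)) *\<^sub>C A" by (rule arg_cong[OF complex_eq])
    then show ?thesis by (simp add: scaleR_cscale mult.commute cscale_add_left)
  qed
  show ?thesis unfolding c d\<pi>_add d\<pi>_scaleR d\<pi>_imaginary ..
qed

lemma bounded_linear_d\<pi>: "bounded_linear d\<pi>"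
  by (auto intro!: linearI simp: linear_conv_bounded_linear[symmetric] d\<pi>_add d\<pi>_scaleR)

lemma d\<pi>_zero [simp]: "d\<pi> 0 = 0" and d\<pi>_diff: "d\<pi> (Y - Z) = d\<pi> Y - d\<pi> Z"
  and d\<pi>_sum: "d\<pi> (\<Sum>i\<in>I. X i) = (\<Sum>i\<in>I. d\<pi> (X i))"
  using bounded_linear.linear[OF bounded_linear_d\<pi>]
  by (auto simp: linear_0 linear_diff linear_sum)

lemma d\<pi>_su: "X \<in> su \<Longrightarrow> d\<pi> X = dsu X"
proof -
  assume X: "X \<in> su"
  have "traceless_part X = X" using X by (simp add: su_def traceless_part_def)
  moreover have "skew_part X = X" using X by (simp add: su_def skew_part_def vec_eq_iff)
  moreover have "skew_part ((-\<i>) *\<^sub>C X) = 0"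
    using X by (simp add: su_def skew_part_def ctranspose_cscale) (simp add: vec_eq_iff)
  moreover have "dsu 0 = 0" by (rule dsu_eq[OF tangent_zero])
  ultimately show ?thesis by (simp add: d\<pi>_def)
qed

lemma d\<pi>_one: "d\<pi> (mat 1) = 0"
proof -
  have "traceless_part (mat 1 :: complex^'n^'n) = 0" by (simp add: traceless_part_def trace_I)
  moreover have "skew_part (0 :: complex^'n^'n) = 0" by (simp add: skew_part_def vec_eq_iff ctranspose_nth)
  moreover have "dsu 0 = 0" by (rule dsu_eq[OF tangent_zero])
  ultimately show ?thesis by (simp add: d\<pi>_def)
qed

lemma su_conj:
  assumes g: "g \<in> carrier SU" and X: "X \<in> su" shows "g ** X ** ctranspose g \<in> su"
proof -
  have "ctranspose (g ** X ** ctranspose g) = - (g ** X ** ctranspose g)"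
    using X by (simp add: su_def ctranspose_mult matrix_mul_assoc)
      (simp add: vec_eq_iff matrix_matrix_mult_def sum_negf)
  moreover have "trace (g ** X ** ctranspose g) = trace (ctranspose g ** (g ** X))"
    by (rule trace_mul_sym)
  then have "trace (g ** X ** ctranspose g) = 0"
    using X by (simp add: matrix_mul_assoc SU_ctranspose_mult[OF g] su_def)
  ultimately show ?thesis by (simp add: su_def)
qed

lemma d\<pi>_conj:
  assumes g: "g \<in> carrier SU"
  shows "d\<pi> (g ** Z ** ctranspose g) = \<pi> g ** d\<pi> Z ** \<pi> (ctranspose g)"
proof -
  obtain X1 X2 c where X: "X1 \<in> su" "X2 \<in> su" and Z: "Z = X1 + \<i> *\<^sub>C X2 + c *\<^sub>C mat 1"
    by (rule su_decomp)
  have "g ** Z ** ctranspose g = g ** X1 ** ctranspose g + \<i> *\<^sub>C (g ** X2 ** ctranspose g) + c *\<^sub>C mat 1"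
    by (simp add: Z matrix_add_ldistrib matrix_add_rdistrib cscale_mult SU_mult_ctranspose[OF g])
  then show ?thesis
    using X g by (simp add: d\<pi>_add d\<pi>_cscale d\<pi>_one Z d\<pi>_su su_conj dsu_conj
        matrix_add_ldistrib matrix_add_rdistrib cscale_mult)
qed

text \<open>Obtained by differentiating \<open>\<pi> (u s) ** d\<pi> Z = d\<pi> (u s ** Z **
  ctranspose (u s)) ** \<pi> (u s)\<close> along a curve \<open>u\<close> with velocity
  \<open>X\<close>. This form serves for moving one operator past another.\<close>

lemma d\<pi>_bracket_su:
  assumes X: "X \<in> su"
  shows "d\<pi> X ** d\<pi> Z = d\<pi> Z ** d\<pi> X + d\<pi> (X ** Z - Z ** X)"
proof -
  obtain u where u: "\<forall>s. u s \<in> carrier SU" "u 0 = mat 1" "(u has_vector_derivative X) (at 0)"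
      "((\<lambda>s. \<pi> (u s)) has_vector_derivative d\<pi> X) (at 0)"
    using tangent_dsu[OF X] by (auto simp: tangent_def d\<pi>_su[OF X])
  have uc: "((\<lambda>s. ctranspose (u s)) has_vector_derivative - X) (at 0)"
    using bounded_linear.has_vector_derivative[OF bounded_linear_ctranspose u(3)] X by (simp add: su_def)
  have "((\<lambda>s. \<pi> (u s) ** d\<pi> Z) has_vector_derivative d\<pi> X ** d\<pi> Z) (at 0)"
    by (intro bounded_linear.has_vector_derivative[OF matrix_mult_left_linear] u)
  moreover have "\<pi> (u s) ** d\<pi> Z = d\<pi> (u s ** Z ** ctranspose (u s)) ** \<pi> (u s)" for s
  proof -
    have "d\<pi> (u s ** Z ** ctranspose (u s)) ** \<pi> (u s)
        = \<pi> (u s) ** d\<pi> Z ** (\<pi> (ctranspose (u s)) ** \<pi> (u s))"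
      using u(1) by (simp add: d\<pi>_conj matrix_mul_assoc)
    then show ?thesis using u(1) by (simp add: rep_ctranspose[OF rep])
  qed
  moreover have "((\<lambda>s. d\<pi> (u s ** Z ** ctranspose (u s)) ** \<pi> (u s)) has_vector_derivative
      d\<pi> (u 0 ** Z ** ctranspose (u 0)) ** d\<pi> X
      + d\<pi> ((u 0 ** Z) ** (- X) + (X ** Z) ** ctranspose (u 0)) ** \<pi> (u 0)) (at 0)"
    by (intro has_vector_derivative_matrix_mult bounded_linear.has_vector_derivative[OF bounded_linear_d\<pi>]
        bounded_linear.has_vector_derivative[OF matrix_mult_left_linear] u uc)
  ultimately have "d\<pi> X ** d\<pi> Z = d\<pi> (u 0 ** Z ** ctranspose (u 0)) ** d\<pi> X
      + d\<pi> ((u 0 ** Z) ** (- X) + (X ** Z) ** ctranspose (u 0)) ** \<pi> (u 0)"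
    using vector_derivative_unique_at by fastforce
  then show ?thesis
    by (simp add: u(2) rep_one[OF rep] bounded_bilinear.minus_right[OF bounded_bilinear_matrix_mult])
qed

theorem d\<pi>_bracket: "d\<pi> Y ** d\<pi> Z = d\<pi> Z ** d\<pi> Y + d\<pi> (Y ** Z - Z ** Y)"
proof -
  obtain X1 X2 c where X: "X1 \<in> su" "X2 \<in> su" and Y: "Y = X1 + \<i> *\<^sub>C X2 + c *\<^sub>C mat 1"
    by (rule su_decomp)
  have "Y ** Z - Z ** Y = (X1 ** Z - Z ** X1) + \<i> *\<^sub>C (X2 ** Z - Z ** X2)"
    by (simp add: Y matrix_add_ldistrib matrix_add_rdistrib cscale_mult cscale_diff_right)
  then show ?thesis
    by (simp add: Y d\<pi>_add d\<pi>_cscale d\<pi>_one matrix_add_ldistrib matrix_add_rdistrib cscale_mult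
        d\<pi>_bracket_su[OF X(1)] d\<pi>_bracket_su[OF X(2)] cscale_add_right d\<pi>_diff cscale_diff_right)
qed

end

section \<open>Generators of the special unitary group\<close>

lemma exp_diagonal_vec: "(exp_diagonal h *v x)$i = exp (h$i) * x$i"
  by (simp add: matrix_vector_mult_def exp_diagonal_nth if_distrib[of "\<lambda>x. x * _"] cong: if_cong)

lemma matrix_mult_axis_nth: "((g :: complex^'n^'n) *v axis i 1)$k = g$k$i"
  by (simp add: matrix_vector_mult_def axis_def if_distrib cong: if_cong)

lemma matrix_mult_minus_left: "(- A) *v x = - (A *v (x :: complex^'n))"
  by (simp add: vec_eq_iff matrix_vector_mult_def sum_negf)

text \<open>Column \<open>i\<close> is a unit axis and the columns are orthogonal, so row
  \<open>i\<close> has no other entries.\<close>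

lemma SU_entry_zero:
  fixes g :: "complex^'n^'n"
  assumes g: "g \<in> carrier SU" and fixed: "g *v axis i 1 = axis i 1" and "j \<noteq> i"
  shows "g$i$j = 0"
proof -
  have col: "g$k$i = (if k = i then 1 else 0)" for k
  proof -
    have "(g *v axis i 1)$k = axis i 1$k" using fixed by simp
    then show ?thesis unfolding matrix_mult_axis_nth by (simp add: axis_def)
  qed
  have "(ctranspose g ** g)$i$j = 0"
    using assms(3) by (simp add: SU_ctranspose_mult[OF g] mat_def)
  then show ?thesis
    by (simp add: matrix_matrix_mult_def ctranspose_nth col if_distrib[of "\<lambda>x. cnj x * _"] cong: if_cong)
qed

text \<open>Any unitary matrix of determinant one is reduced to the identity column by column, by
  Givens rotations.\<close>

locale SU_generators =
  fixes N :: "(complex^'n^'n) set"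
  assumes mult: "\<And>a b. a \<in> N \<Longrightarrow> b \<in> N \<Longrightarrow> a ** b \<in> N"
    and torus: "\<And>h. h \<in> cartan \<Longrightarrow> exp_diagonal h \<in> N"
    and rots: "\<And>i j t. i \<noteq> j \<Longrightarrow> rot i j 1 t \<in> N"
begin

text \<open>\<open>N\<close> is only closed under products; a reduction can be undone when the
  inverse of the element used lies in \<open>N\<close> too.\<close>

definition M :: "(complex^'n^'n) set" where
  "M = {k \<in> carrier SU. k \<in> N \<and> ctranspose k \<in> N}"

lemma M_mult: "a \<in> M \<Longrightarrow> b \<in> M \<Longrightarrow> a ** b \<in> M"
  by (simp add: M_def SU_closed mult ctranspose_mult)

lemma M_torus: "h \<in> cartan \<Longrightarrow> exp_diagonal h \<in> M"
proof -
  assume h: "h \<in> cartan"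
  then have "- h \<in> cartan" by (auto simp: cartan_def sum_negf)
  then show ?thesis using h by (simp add: M_def exp_diagonal_SU torus ctranspose_exp_diagonal)
qed

lemma M_rot: "i \<noteq> j \<Longrightarrow> rot i j 1 t \<in> M"
  by (simp add: M_def rot_SU rots ctranspose_rot)

lemma M_one: "mat 1 \<in> M"
  using M_torus[of 0] by (simp add: cartan_def)

definition phase :: "'n \<Rightarrow> 'n \<Rightarrow> real \<Rightarrow> complex^'n" where
  "phase a j \<theta> = (\<chi> i. if i = a then \<i> * of_real \<theta> else if i = j then - \<i> * of_real \<theta> else 0)"

lemma phase_cartan: "a \<noteq> j \<Longrightarrow> phase a j \<theta> \<in> cartan"
proof -
  assume aj: "a \<noteq> j"
  have "(\<Sum>i\<in>UNIV. phase a j \<theta>$i) = (\<Sum>i\<in>{a,j}. phase a j \<theta>$i)"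
    by (rule sum.mono_neutral_right) (auto simp: phase_def)
  then show ?thesis using aj by (auto simp: cartan_def phase_def)
qed

text \<open>Opposite phases bring the two entries to a common argument, a real rotation moves their
  length into entry \<open>a\<close>, and a second pair of phases makes it real.\<close>

lemma pair_rotation:
  assumes aj: "a \<noteq> j"
  obtains k r where "k \<in> M" "r \<ge> 0" "(k *v c)$a = of_real r" "(k *v c)$j = 0"
    "\<And>i. i \<noteq> a \<Longrightarrow> i \<noteq> j \<Longrightarrow> (k *v c)$i = c$i"
    "\<And>x. x$a = 0 \<Longrightarrow> x$j = 0 \<Longrightarrow> k *v x = x"
proof -
  define p q where "p = cmod (c$a)" and "q = cmod (c$j)"
  define \<alpha> \<beta> where "\<alpha> = Arg (c$a)" and "\<beta> = Arg (c$j)"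
  have ca: "c$a = of_real p * exp (\<i> * of_real \<alpha>)" and cj: "c$j = of_real q * exp (\<i> * of_real \<beta>)"
    unfolding p_def q_def \<alpha>_def \<beta>_def
    by (metis cis_conv_exp rcis_def rcis_cmod_Arg)+
  \<comment> \<open>Opposite phases cannot change the sum of the arguments, so the common argument
    is taken to be their mean.\<close>
  define \<psi> where "\<psi> = (\<alpha> + \<beta>) / 2"
  define \<theta> where "\<theta> = (\<beta> - \<alpha>) / 2"
  define r where "r = sqrt (p\<^sup>2 + q\<^sup>2)"
  obtain t where t: "p * cos t + q * sin t = r" "q * cos t - p * sin t = 0"
  proof (cases "r = 0")
    case True
    then have "p = 0" "q = 0" by (simp_all add: r_def sum_power2_eq_zero_iff)
    then show ?thesis using that[of 0] True by simp
  next
    case False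
    have "(p / r)\<^sup>2 + (q / r)\<^sup>2 = 1"
      using False by (simp add: r_def power_divide add_divide_distrib[symmetric])
    then obtain t where t: "p / r = cos t" "q / r = sin t"
      using sincos_total_2pi by metis
    have "p = r * cos t" "q = r * sin t" using t False by (simp_all add: field_simps)
    moreover from this have "r * cos t * cos t + r * sin t * sin t = r"
      by (metis distrib_left mult.assoc mult_1_right power2_eq_square sin_cos_squared_add2)
    ultimately show ?thesis using that[of t] by simp
  qed
  define x1 where "x1 x = exp_diagonal (phase a j \<theta>) *v x" for x
  define x2 where "x2 x = rot a j 1 t *v x1 x" for x
  define k where "k = exp_diagonal (phase a j (- \<psi>)) ** (rot a j 1 t ** exp_diagonal (phase a j \<theta>))"
  have k: "k *v x = exp_diagonal (phase a j (- \<psi>)) *v x2 x" for x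
    by (simp add: k_def x1_def x2_def matrix_vector_mul_assoc)
  have e1: "exp (\<i> * of_real \<theta>) * exp (\<i> * of_real \<alpha>) = exp (\<i> * of_real \<psi>)"
    and e2: "exp (- \<i> * of_real \<theta>) * exp (\<i> * of_real \<beta>) = exp (\<i> * of_real \<psi>)"
    by (simp_all add: \<theta>_def \<psi>_def field_simps flip: exp_add)
  have c1: "x1 c$a = of_real p * exp (\<i> * of_real \<psi>)"
    unfolding e1[symmetric] by (simp add: x1_def exp_diagonal_vec phase_def ca)
  have c1': "x1 c$j = of_real q * exp (\<i> * of_real \<psi>)"
    unfolding e2[symmetric] using aj by (simp add: x1_def exp_diagonal_vec phase_def cj)
  have c2: "x2 c$a = of_real r * exp (\<i> * of_real \<psi>)" "x2 c$j = 0"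
  proof -
    have "x2 c$a = of_real (p * cos t + q * sin t) * exp (\<i> * of_real \<psi>)"
      by (simp add: x2_def rot_vec[OF aj] c1 c1' algebra_simps)
    then show "x2 c$a = of_real r * exp (\<i> * of_real \<psi>)" by (simp only: t(1))
    have "x2 c$j = of_real (q * cos t - p * sin t) * exp (\<i> * of_real \<psi>)"
      using aj by (simp add: x2_def rot_vec[OF aj] c1 c1' algebra_simps)
    then show "x2 c$j = 0" unfolding t(2) by simp
  qed
  show ?thesis
  proof
    show "k \<in> M" unfolding k_def by (intro M_mult M_torus M_rot phase_cartan aj)
    show "r \<ge> 0" by (simp add: r_def)
    show "(k *v c)$a = of_real r"
      by (simp add: k exp_diagonal_vec c2 phase_def exp_minus)
    show "(k *v c)$j = 0" by (simp add: k exp_diagonal_vec c2)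
    show "(k *v c)$i = c$i" if "i \<noteq> a" "i \<noteq> j" for i
      using that by (simp add: k exp_diagonal_vec x2_def x1_def rot_vec[OF aj] phase_def)
    show "k *v x = x" if "x$a = 0" "x$j = 0" for x
      using that by (auto simp: vec_eq_iff k exp_diagonal_vec x2_def x1_def rot_vec[OF aj] phase_def)
  qed
qed

text \<open>One coordinate of \<open>J\<close> is cleared at a time. Correcting a phase takes a
  second coordinate, so for empty \<open>J\<close> the entry must already be real and
  nonnegative.\<close>

lemma rotate_to_axis:
  assumes "finite J" "a \<notin> J" "\<And>i. i \<noteq> a \<Longrightarrow> i \<notin> J \<Longrightarrow> c$i = 0" "J \<noteq> {} \<or> (\<exists>r\<ge>0. c$a = of_real r)"
  shows "\<exists>k\<in>M. \<exists>r\<ge>0. k *v c = of_real r *s axis a 1 \<and>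
    (\<forall>x. (\<forall>i\<in>insert a J. x$i = 0) \<longrightarrow> k *v x = x)"
  using assms
proof (induction J arbitrary: c rule: finite_induct)
  case empty
  then obtain r where "r \<ge> 0" "c$a = of_real r" by auto
  then have "c = of_real r *s axis a 1" using empty by (auto simp: vec_eq_iff axis_def)
  then show ?case using M_one \<open>r \<ge> 0\<close> by (intro bexI[of _ "mat 1"] exI[of _ r]) auto
next
  case (insert j J)
  have aj: "a \<noteq> j" using insert.prems by auto
  obtain k r where k: "k \<in> M" "r \<ge> 0" "(k *v c)$a = of_real r" "(k *v c)$j = 0"
    "\<And>i. i \<noteq> a \<Longrightarrow> i \<noteq> j \<Longrightarrow> (k *v c)$i = c$i"
    "\<And>x. x$a = 0 \<Longrightarrow> x$j = 0 \<Longrightarrow> k *v x = x"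
    using pair_rotation[OF aj, of c] by metis
  have "\<exists>l\<in>M. \<exists>r\<ge>0. l *v (k *v c) = of_real r *s axis a 1 \<and>
      (\<forall>x. (\<forall>i\<in>insert a J. x$i = 0) \<longrightarrow> l *v x = x)"
  proof (rule insert.IH)
    show "(k *v c)$i = 0" if "i \<noteq> a" "i \<notin> J" for i
      using that k(4,5) insert.prems(2) by (cases "i = j") auto
  qed (use k insert.prems in auto)
  then obtain l s where l: "l \<in> M" "s \<ge> 0" "l *v (k *v c) = of_real s *s axis a 1"
      "\<And>x. \<forall>i\<in>insert a J. x$i = 0 \<Longrightarrow> l *v x = x" by blast
  show ?case
    by (rule bexI[of _ "l ** k"], rule exI[of _ s])
      (use k l in \<open>auto simp: M_mult simp flip: matrix_vector_mul_assoc\<close>)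
qed

text \<open>\<open>I\<close> holds the axes not yet known to be fixed. The column of such an axis is
  supported on \<open>I\<close>, so rotations within \<open>I\<close> send it to its axis without
  disturbing the axes already fixed.\<close>

lemma generates_aux:
  assumes "finite I" "I \<noteq> {}" "g \<in> carrier SU" "\<And>i. i \<notin> I \<Longrightarrow> g *v axis i 1 = axis i 1"
  shows "g \<in> N"
  using assms
proof (induction I arbitrary: g rule: finite_ne_induct)
  case (singleton x)
  have g: "g$i$j = 0" if "i \<noteq> j" for i j
  proof (cases "i = x")
    case False
    then show ?thesis using SU_entry_zero[OF singleton(1), of i j] singleton(2)[of i] that by simp
  next
    case True
    then have "(g *v axis j 1)$i = axis j 1$i" using singleton that by auto
    then show ?thesis using that unfolding matrix_mult_axis_nth by (simp add: axis_def)
  qed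
  have gii: "g$i$i = 1" if "i \<noteq> x" for i
  proof -
    have "(g *v axis i 1)$i = axis i 1$i" using singleton that by auto
    then show ?thesis unfolding matrix_mult_axis_nth by (simp add: axis_def)
  qed
  \<comment> \<open>With one axis left \<open>g\<close> is diagonal, and the determinant fixes its
    last entry.\<close>
  have "det g = (\<Prod>i\<in>UNIV. g$i$i)" using g by (rule det_diagonal)
  also have "\<dots> = g$x$x * (\<Prod>i\<in>UNIV - {x}. g$i$i)" by (rule prod.remove) auto
  also have "(\<Prod>i\<in>UNIV - {x}. g$i$i) = 1" by (rule prod.neutral) (use gii in auto)
  finally have "g$x$x = 1" using singleton by (simp add: carrier_SU)
  with g gii have "g = mat 1" by (auto simp: vec_eq_iff mat_def) metis
  then show ?case using M_one by (simp add: M_def)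
next
  case (insert x F)
  define c where "c = g *v axis x 1"
  have c: "c$i = g$i$x" for i
    by (simp add: c_def matrix_mult_axis_nth)
  have "\<exists>k\<in>M. \<exists>r\<ge>0. k *v c = of_real r *s axis x 1 \<and>
      (\<forall>y. (\<forall>i\<in>insert x F. y$i = 0) \<longrightarrow> k *v y = y)"
  proof (rule rotate_to_axis)
    show "c$i = 0" if "i \<noteq> x" "i \<notin> F" for i
      unfolding c using that insert.prems by (intro SU_entry_zero) auto
  qed (use insert.hyps in auto)
  then obtain k r where k: "k \<in> M" "r \<ge> 0" "k *v c = of_real r *s axis x 1"
      "\<And>y. \<forall>i\<in>insert x F. y$i = 0 \<Longrightarrow> k *v y = y" by blast
  have kSU: "k \<in> carrier SU" using k(1) by (simp add: M_def)
  have kg: "k ** g \<in> carrier SU" using kSU insert.prems(1) by (rule SU_closed)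
  have colx: "(k ** g)$i$x = of_real r * axis x 1$i" for i
  proof -
    have "(k ** g)$i$x = ((k ** g) *v axis x 1)$i"
      by (simp add: matrix_mult_axis_nth)
    also have "\<dots> = of_real r * axis x 1$i"
      using k(3) by (simp add: c_def flip: matrix_vector_mul_assoc)
    finally show ?thesis .
  qed
  \<comment> \<open>The column has unit length and \<open>r\<close> is nonnegative, so
    \<open>r = 1\<close>.\<close>
  have "(ctranspose (k ** g) ** (k ** g))$x$x = 1"
    by (simp only: SU_ctranspose_mult[OF kg]) (simp add: mat_def)
  then have "complex_of_real (r * r) = 1"
    by (simp add: matrix_matrix_mult_def[of "ctranspose _"] ctranspose_nth colx axis_def
        if_distrib[of "\<lambda>x. cnj x * _"] if_distrib[of "\<lambda>x. _ * x"] cong: if_cong)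
  then have "r * r = 1" using of_real_eq_1_iff by blast
  then have r: "r = 1" using k(2) by (metis abs_of_nonneg abs_1 abs_mult_self_eq power2_eq_1_iff power2_eq_square abs_minus_cancel)
  have "k ** g \<in> N"
  proof (rule insert.IH[OF kg])
    fix i assume i: "i \<notin> F"
    show "(k ** g) *v axis i 1 = axis i 1"
    proof (cases "i = x")
      case True
      then show ?thesis using k(3) r by (simp add: c_def flip: matrix_vector_mul_assoc)
    next
      case False
      then have "g *v axis i 1 = axis i 1" using insert.prems(2) i by auto
      moreover have "k *v axis i 1 = axis i 1" using False i by (intro k(4)) (auto simp: axis_def)
      ultimately show ?thesis by (simp flip: matrix_vector_mul_assoc)
    qed
  qed
  then have "ctranspose k ** (k ** g) \<in> N" using k(1) by (simp add: M_def mult)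
  then show ?case by (simp add: matrix_mul_assoc SU_ctranspose_mult[OF kSU])
qed

theorem generates: "g \<in> carrier SU \<Longrightarrow> g \<in> N"
  by (rule generates_aux[of UNIV]) auto

end

section \<open>Subspaces invariant under a one-parameter group\<close>

lemma bounded_linear_matrix_vector:
  "bounded_linear (\<lambda>A::complex^'m^'m. A *v x)" "bounded_linear (\<lambda>x. (A::complex^'m^'m) *v x)"
  by (auto intro!: linearI simp: linear_conv_bounded_linear[symmetric] matrix_vector_mult_add_rdistrib
      matrix_vector_right_distrib scaleR_matrix_vector scaleR_eq_vec_scale vec.scale)

text \<open>A Gronwall argument: with \<open>K\<close> bounding \<open>A\<close>, the function
  \<open>exp (- (2 * K * s)) * (y s \<bullet> y s)\<close> does not increase.\<close>

lemma linear_ode_zero: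
  fixes y :: "real \<Rightarrow> complex^'m"
  assumes dy: "\<And>s. (y has_vector_derivative A *v y s) (at s)" and y0: "y 0 = 0" and "t \<ge> 0"
  shows "y t = 0"
proof -
  obtain K where K: "\<And>x::complex^'m. norm (A *v x) \<le> norm x * K"
    using bounded_linear.bounded[OF bounded_linear_matrix_vector(2)] by metis
  define f where "f s = exp (- (2 * K * s)) * (y s \<bullet> y s)" for s
  have df: "(f has_real_derivative exp (- (2 * K * s)) * (2 * (y s \<bullet> (A *v y s)) - 2 * K * (y s \<bullet> y s))) (at s)" for s
  proof -
    have "((\<lambda>s. y s \<bullet> y s) has_vector_derivative y s \<bullet> (A *v y s) + (A *v y s) \<bullet> y s) (at s)"
      by (rule bounded_bilinear.has_vector_derivative[OF bounded_bilinear_inner dy dy])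
    then have "((\<lambda>s. y s \<bullet> y s) has_real_derivative 2 * (y s \<bullet> (A *v y s))) (at s)"
      by (simp add: has_real_derivative_iff_has_vector_derivative inner_commute)
    then show ?thesis
      unfolding f_def by (auto intro!: derivative_eq_intros simp: algebra_simps)
  qed
  have "f t \<le> f 0"
  proof (rule DERIV_nonpos_imp_nonincreasing[OF \<open>t \<ge> 0\<close>])
    fix s
    have "y s \<bullet> (A *v y s) \<le> norm (y s) * norm (A *v y s)" by (rule norm_cauchy_schwarz)
    also have "\<dots> \<le> norm (y s) * (norm (y s) * K)" by (intro mult_left_mono K) auto
    also have "\<dots> = K * (y s \<bullet> y s)" by (simp add: dot_square_norm power2_eq_square)
    finally have "exp (- (2 * K * s)) * (2 * (y s \<bullet> (A *v y s)) - 2 * K * (y s \<bullet> y s)) \<le> 0"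
      by (intro mult_nonneg_nonpos) auto
    then show "\<exists>z. (f has_real_derivative z) (at s) \<and> z \<le> 0" using df by blast
  qed
  then have "exp (- (2 * K * t)) * (y t \<bullet> y t) \<le> 0" by (simp add: f_def y0)
  then have "y t \<bullet> y t \<le> 0" by (simp add: mult_le_0_iff)
  then show ?thesis by (metis inner_gt_zero_iff not_le)
qed

text \<open>The component of the orbit outside \<open>W\<close> satisfies a linear equation of its
  own because \<open>D\<close> maps \<open>W\<close> to itself, and it starts at 0.\<close>

lemma one_parameter_group_invariant:
  fixes \<phi> :: "real \<Rightarrow> complex^'m^'m"
  assumes add: "\<And>s t. \<phi> (s + t) = \<phi> s ** \<phi> t" and one: "\<phi> 0 = mat 1"
    and d: "(\<phi> has_vector_derivative D) (at 0)"
    and W: "vec.subspace W" "\<And>w. w \<in> W \<Longrightarrow> D *v w \<in> W" and w: "w \<in> W"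
  shows "\<phi> t *v w \<in> W"
proof -
  obtain Q where Q: "\<And>v. Q *v v \<in> W" "\<And>w. w \<in> W \<Longrightarrow> Q *v w = w"
    using vec_projection[OF W(1)] by blast
  define R where "R = mat 1 - Q"
  have R: "R *v x = x - Q *v x" for x
    by (simp add: R_def matrix_vector_mult_diff_rdistrib)
  define y where "y s = R *v (\<phi> s *v w)" for s
  have d\<phi>: "(\<phi> has_vector_derivative D ** \<phi> s) (at s)" for s
  proof -
    have "((\<lambda>h. ((1 / h) *\<^sub>R (\<phi> h - \<phi> 0)) ** \<phi> s) \<longlongrightarrow> D ** \<phi> s) (at 0)"
      using d by (intro tendsto_matrix_mult tendsto_const) (simp add: has_vector_derivative_limit)
    moreover have "((1 / h) *\<^sub>R (\<phi> h - \<phi> 0)) ** \<phi> s = (1 / h) *\<^sub>R (\<phi> (s + h) - \<phi> s)" for h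
      by (simp add: scaleR_matrix_mult matrix_diff_rdistrib one add.commute flip: add)
    ultimately show ?thesis by (simp add: has_vector_derivative_limit)
  qed
  have dy: "(y has_vector_derivative (R ** D) *v y s) (at s)" for s
  proof -
    have "(y has_vector_derivative R *v ((D ** \<phi> s) *v w)) (at s)"
      unfolding y_def
      by (intro bounded_linear.has_vector_derivative[OF bounded_linear_matrix_vector(2)]
        bounded_linear.has_vector_derivative[OF bounded_linear_matrix_vector(1)] d\<phi>)
    moreover have "R *v ((D ** \<phi> s) *v w) = (R ** D) *v y s"
    proof -
      have "\<phi> s *v w = y s + Q *v (\<phi> s *v w)" by (simp add: y_def R)
      then have "D *v (\<phi> s *v w) = D *v y s + D *v (Q *v (\<phi> s *v w))"
        by (metis matrix_vector_right_distrib)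
      moreover have "R *v (D *v (Q *v (\<phi> s *v w))) = 0"
        using Q W(2) by (simp add: R)
      ultimately show ?thesis
        by (simp add: matrix_vector_right_distrib flip: matrix_vector_mul_assoc)
    qed
    ultimately show ?thesis by simp
  qed
  have y0: "y 0 = 0" using Q w by (simp add: y_def one R)
  have "y t = 0"
  proof (cases "t \<ge> 0")
    case True
    then show ?thesis using linear_ode_zero[OF dy y0] by simp
  next
    case False
    \<comment> \<open>Negative times follow by reversing the direction.\<close>
    have m: "((\<lambda>s. - s) has_vector_derivative - 1) (at s)" for s :: real
      by (auto intro!: derivative_eq_intros)
    have "((\<lambda>s. y (- s)) has_vector_derivative (- (R ** D)) *v y (- s)) (at s)" for s
      using vector_diff_chain_at[OF m dy[of "- s"]]
      by (simp add: o_def matrix_mult_minus_left)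
    then show ?thesis using linear_ode_zero[of "\<lambda>s. y (- s)" "- (R ** D)" "- t"] y0 False by simp
  qed
  then have "\<phi> t *v w = Q *v (\<phi> t *v w)" by (simp add: y_def R)
  then show ?thesis using Q(1) by metis
qed

section \<open>Weights of an irreducible representation\<close>

lemma sum_diagonal_pairs:
  fixes f :: "'n::{finite,linorder} \<Rightarrow> 'n \<Rightarrow> 'b::comm_monoid_add"
  shows "(\<Sum>i\<in>UNIV. \<Sum>j\<in>UNIV. f i j) = (\<Sum>i\<in>UNIV. f i i) + (\<Sum>(i,j)\<in>{(i,j). i < j}. f i j + f j i)"
proof -
  let ?L = "{(i::'n,j). i < j}" and ?G = "{(i::'n,j). j < i}" and ?D = "{(i::'n,j). i = j}"
  have "(\<Sum>i\<in>UNIV. \<Sum>j\<in>UNIV. f i j) = (\<Sum>(i,j)\<in>UNIV \<times> UNIV. f i j)"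
    by (rule sum.cartesian_product)
  also have "UNIV \<times> UNIV = ?D \<union> (?L \<union> ?G)" by auto
  also have "(\<Sum>(i,j)\<in>\<dots>. f i j) = (\<Sum>(i,j)\<in>?D. f i j) + ((\<Sum>(i,j)\<in>?L. f i j) + (\<Sum>(i,j)\<in>?G. f i j))"
    by (subst sum.union_disjoint; (subst sum.union_disjoint)?) auto
  also have "(\<Sum>(i,j)\<in>?D. f i j) = (\<Sum>i\<in>UNIV. f i i)"
    by (rule sum.reindex_bij_witness[of _ "\<lambda>i. (i,i)" fst]) auto
  also have "(\<Sum>(i,j)\<in>?G. f i j) = (\<Sum>(i,j)\<in>?L. f j i)"
    by (rule sum.reindex_bij_witness[of _ prod.swap prod.swap]) auto
  finally show ?thesis by (simp add: case_prod_unfold sum.distrib)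
qed

lemma exp_diagonal_munit_conj:
  assumes "h \<in> cartan"
  shows "exp_diagonal h ** munit i j ** ctranspose (exp_diagonal h) = exp (h$i - h$j) *\<^sub>C munit i j"
  unfolding ctranspose_exp_diagonal[OF assms]
  by (auto simp: vec_eq_iff exp_diagonal_def diagonal_mult_nth mult_diagonal_nth munit_nth exp_diff exp_minus
      field_simps)

lemma (in su_rep) character_conj:
  assumes "u \<in> carrier SU" "g \<in> carrier SU"
  shows "character \<pi> (u ** g ** ctranspose u) = character \<pi> g"
proof -
  have "character \<pi> (u ** g ** ctranspose u) = trace ((\<pi> u ** \<pi> g) ** \<pi> (ctranspose u))"
    using assms by (simp add: character_def rep_mult[OF rep] SU_closed SU_ctranspose)
  also have "\<dots> = trace (\<pi> (ctranspose u) ** (\<pi> u ** \<pi> g))" by (rule trace_mul_sym)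
  also have "\<pi> (ctranspose u) ** (\<pi> u ** \<pi> g) = \<pi> g"
    by (simp add: matrix_mul_assoc rep_ctranspose[OF rep assms(1)])
  finally show ?thesis by (simp add: character_def)
qed

locale highest_weight_rep = su_rep \<pi>
  for \<pi> :: "complex^'n::{finite,linorder}^'n::{finite,linorder} \<Rightarrow> complex^'m^'m" +
  fixes \<mu> :: "real^'n::{finite,linorder}"
  assumes irr: "irreducible_on \<pi> (carrier SU) UNIV" and hw: "highest_weight \<pi> \<mu>"
begin

abbreviation E :: "'n \<Rightarrow> 'n \<Rightarrow> complex^'m^'m" where
  "E i j \<equiv> d\<pi> (munit i j)"

text \<open>Unlike \<open>is_weight\<close> it allows \<open>x = 0\<close>, so raising and lowering
  need no case distinction on vanishing.\<close>

definition weight_vector :: "real^'n::_ \<Rightarrow> complex^'m \<Rightarrow> bool" where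
  "weight_vector \<nu> x \<longleftrightarrow> (\<Sum>i\<in>UNIV. \<nu>$i) = 0 \<and>
     (\<forall>h\<in>cartan. \<pi> (exp_diagonal h) *v x = exp (pairing \<nu> h) *s x)"

lemma E_bracket: "E i j ** E k l = E k l ** E i j + (if j = k then E i l else 0) - (if l = i then E k j else 0)"
  using d\<pi>_bracket[of "munit i j" "munit k l"] by (simp add: munit_mult d\<pi>_diff)

lemma torus_E:
  assumes h: "h \<in> cartan"
  shows "\<pi> (exp_diagonal h) ** E i j = exp (h$i - h$j) *\<^sub>C (E i j ** \<pi> (exp_diagonal h))"
proof -
  note g = exp_diagonal_SU[OF h]
  have "\<pi> (exp_diagonal h) ** E i j ** \<pi> (ctranspose (exp_diagonal h)) = exp (h$i - h$j) *\<^sub>C E i j"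
    by (simp only: d\<pi>_conj[OF g, symmetric] exp_diagonal_munit_conj[OF h] d\<pi>_cscale)
  then have "\<pi> (exp_diagonal h) ** E i j ** (\<pi> (ctranspose (exp_diagonal h)) ** \<pi> (exp_diagonal h))
      = (exp (h$i - h$j) *\<^sub>C E i j) ** \<pi> (exp_diagonal h)"
    by (simp add: matrix_mul_assoc)
  then show ?thesis by (simp add: rep_ctranspose[OF rep g] cscale_mult)
qed

lemma pairing_root: "pairing (\<nu> + axis i 1 - axis j 1) h = pairing \<nu> h + (h$i - h$j)"
proof -
  have "pairing (axis i 1) h = h$i" for i
    by (simp add: pairing_eq axis_def if_distrib[of of_real] if_distrib[of "\<lambda>x. x * _"] cong: if_cong)
  moreover have "pairing (x - y) h = pairing x h - pairing y h" for x y
    by (simp add: pairing_eq sum_subtractf left_diff_distrib)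
  ultimately show ?thesis by (simp add: pairing_add_left)
qed

lemma weight_vector_E:
  assumes "weight_vector \<nu> x"
  shows "weight_vector (\<nu> + axis i 1 - axis j 1) (E i j *v x)"
proof -
  have "(\<Sum>k\<in>UNIV. (axis i 1 :: real^'n::_)$k) = 1" for i by (simp add: axis_def)
  then have "(\<Sum>k\<in>UNIV. (\<nu> + axis i 1 - axis j 1)$k) = 0"
    using assms by (simp add: weight_vector_def sum.distrib sum_subtractf)
  moreover have "\<pi> (exp_diagonal h) *v (E i j *v x) = exp (pairing (\<nu> + axis i 1 - axis j 1) h) *s (E i j *v x)"
    if h: "h \<in> cartan" for h
  proof -
    have "\<pi> (exp_diagonal h) *v (E i j *v x) = exp (h$i - h$j) *s (E i j *v (\<pi> (exp_diagonal h) *v x))"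
      by (simp only: matrix_vector_mul_assoc torus_E[OF h] cscale_vec)
    also have "\<pi> (exp_diagonal h) *v x = exp (pairing \<nu> h) *s x"
      using assms h by (simp add: weight_vector_def)
    finally show ?thesis
      by (simp add: vec.scale pairing_root exp_add mult.commute)
  qed
  ultimately show ?thesis by (simp add: weight_vector_def)
qed

lemma diagonal_su: "h \<in> cartan \<Longrightarrow> diagonal h \<in> su"
  by (auto simp: cartan_def su_def trace_def diagonal_nth vec_eq_iff ctranspose_nth complex_eq_iff)

lemma rot_gen_su: "i \<noteq> j \<Longrightarrow> rot_gen i j \<zeta> \<in> su"
  by (auto simp: su_def rot_gen_def ctranspose_diff ctranspose_cscale trace_def munit_nth vec_eq_iff
      ctranspose_nth intro!: sum.neutral)

lemma weight_vector_diagonal: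
  assumes x: "weight_vector \<nu> x" and h: "h \<in> cartan"
  shows "d\<pi> (diagonal h) *v x = pairing \<nu> h *s x"
proof -
  obtain Y where Y: "tangent (diagonal h) Y"
      "((\<lambda>s. \<pi> (exp_diagonal (of_real s *s h))) has_vector_derivative Y) (at 0)"
    using tangent_diagonal[OF h] by blast
  from bounded_linear.has_vector_derivative[OF bounded_linear_matrix_vector(1)[of x] Y(2)]
  have "((\<lambda>s. exp (of_real s * pairing \<nu> h) *s x) has_vector_derivative Y *v x) (at 0)"
    using x h by (simp add: weight_vector_def cartan_scale pairing_scale_right)
  moreover have "((\<lambda>s. exp (of_real s * pairing \<nu> h) *s x) has_vector_derivative pairing \<nu> h *s x) (at 0)"
    unfolding has_vector_derivative_limit
  proof (intro vec_tendstoI)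
    fix a
    have "((\<lambda>s. exp (of_real s * pairing \<nu> h) * x$a) has_vector_derivative pairing \<nu> h * x$a) (at (0::real))"
      by (rule has_vector_derivative_real_field) (auto intro!: derivative_eq_intros)
    then show "((\<lambda>s. ((1 / s) *\<^sub>R (exp (of_real (0 + s) * pairing \<nu> h) *s x - exp (of_real 0 * pairing \<nu> h) *s x))$a)
        \<longlongrightarrow> (pairing \<nu> h *s x)$a) (at 0)"
      by (simp add: has_vector_derivative_limit)
  qed
  ultimately have "Y *v x = pairing \<nu> h *s x" by (rule vector_derivative_unique_at)
  then show ?thesis using dsu_eq[OF Y(1)] d\<pi>_su[OF diagonal_su[OF h]] by simp
qed

lemma weight_vector_E_diag:
  assumes x: "weight_vector \<nu> x"
  shows "E i i *v x = of_real (\<nu>$i) *s x"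
proof -
  \<comment> \<open>\<open>munit i i\<close> less its trace part is \<open>- \<i>\<close> times
    \<open>diagonal h\<close>; since the entries of \<nu> sum to 0, subtracting
    \<open>1 / CARD('n)\<close> does not affect the pairing.\<close>
  define h :: "complex^'n::_" where "h = (\<chi> a. \<i> * of_real ((if a = i then 1 else 0) - 1 / real CARD('n)))"
  have h: "h \<in> cartan"
  proof -
    have "(\<Sum>a\<in>UNIV. h$a) = \<i> * of_real (\<Sum>a\<in>(UNIV::'n set). (if a = i then 1 else 0) - 1 / real CARD('n))"
      by (simp only: h_def vec_lambda_beta sum_distrib_left of_real_sum)
    also have "(\<Sum>a\<in>(UNIV::'n set). (if a = i then 1 else 0) - 1 / real CARD('n)) = 0"
      by (simp add: sum_subtractf)
    finally show ?thesis by (simp add: cartan_def h_def)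
  qed
  have "munit i i = (- \<i>) *\<^sub>C diagonal h + (1 / of_nat CARD('n)) *\<^sub>C mat 1"
    by (auto simp: vec_eq_iff munit_nth diagonal_nth h_def mat_def algebra_simps)
  then have "E i i = (- \<i>) *\<^sub>C d\<pi> (diagonal h)"
    by (simp only: d\<pi>_add d\<pi>_cscale d\<pi>_one) simp
  then have "E i i *v x = (- \<i> * pairing \<nu> h) *s x"
    by (simp add: cscale_vec weight_vector_diagonal[OF x h])
  also have "pairing \<nu> h = \<i> * of_real (\<nu>$i)"
  proof -
    have "pairing \<nu> h = (\<Sum>a\<in>UNIV. \<i> * of_real (\<nu>$a * (if a = i then 1 else 0) - \<nu>$a / real CARD('n)))"
      unfolding pairing_eq by (rule sum.cong) (auto simp: h_def algebra_simps)
    also have "\<dots> = \<i> * of_real (\<Sum>a\<in>UNIV. \<nu>$a * (if a = i then 1 else 0) - \<nu>$a / real CARD('n))"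
      by (simp only: sum_distrib_left of_real_sum)
    also have "(\<Sum>a\<in>UNIV. \<nu>$a * (if a = i then 1 else 0) - \<nu>$a / real CARD('n)) = \<nu>$i"
      using x unfolding sum_subtractf sum_divide_distrib[symmetric]
      by (simp add: weight_vector_def if_distrib[of "\<lambda>z. _ * z"] cong: if_cong)
    finally show ?thesis .
  qed
  finally show ?thesis by simp
qed

section \<open>The highest weight vector and its descendants\<close>

definition vac :: "complex^'m" where
  "vac = (SOME v. v \<noteq> 0 \<and> weight_vector \<mu> v)"

lemma vac: "vac \<noteq> 0" "weight_vector \<mu> vac"
proof -
  have "\<exists>v. v \<noteq> 0 \<and> weight_vector \<mu> v"
    using hw by (auto simp: highest_weight_def is_weight_def weight_vector_def)
  from someI_ex[OF this] show "vac \<noteq> 0" "weight_vector \<mu> vac" by (auto simp: vac_def)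
qed

text \<open>Otherwise \<mu> plus a positive root would be a weight. Every weight pairs with
  \<open>weyl_vector\<close> at most as \<mu> does, while positive roots pair with it strictly
  positively.\<close>

lemma raise_vac: assumes "i < j" shows "E i j *v vac = 0"
proof (rule ccontr)
  assume "E i j *v vac \<noteq> 0"
  then have "is_weight \<pi> (\<mu> + axis i 1 - axis j 1)"
    using weight_vector_E[OF vac(2), of i j] by (auto simp: is_weight_def weight_vector_def)
  then obtain a where a: "\<And>\<alpha>. \<alpha> \<in> positive_roots \<Longrightarrow> a \<alpha> \<ge> 0"
      "\<mu> - (\<mu> + axis i 1 - axis j 1) = (\<Sum>\<alpha>\<in>positive_roots. a \<alpha> *\<^sub>R \<alpha>)"
    using hw unfolding highest_weight_def by blast
  have pos: "weyl_vector \<bullet> \<alpha> > 0" if "\<alpha> \<in> positive_roots" for \<alpha> :: "real^'n::_"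
    using that weyl_vector_decreasing by (auto simp: positive_roots_def inner_diff_right inner_axis)
  have "weyl_vector \<bullet> (\<mu> - (\<mu> + axis i 1 - axis j 1)) \<ge> 0"
    unfolding a(2) inner_sum_right inner_scaleR_right
    by (intro sum_nonneg mult_nonneg_nonneg a(1) less_imp_le[OF pos])
  moreover have "weyl_vector \<bullet> (\<mu> - (\<mu> + axis i 1 - axis j 1)) = weyl_vector$j - weyl_vector$i"
    by (simp add: inner_diff_right inner_add_right inner_axis)
  ultimately show False using weyl_vector_decreasing[OF assms] by simp
qed

text \<open>The weight travels with the vector, since a vector that has become 0 does not determine
  one. \<open>E i j\<close> with \<open>j < i\<close> lowers.\<close>

inductive descendant :: "complex^'m \<Rightarrow> real^'n::_ \<Rightarrow> bool" where
  base: "descendant vac \<mu>"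
| step: "descendant x \<nu> \<Longrightarrow> j < i \<Longrightarrow> descendant (E i j *v x) (\<nu> + axis i 1 - axis j 1)"

lemma descendant_weight_vector: "descendant x \<nu> \<Longrightarrow> weight_vector \<nu> x"
  by (induction rule: descendant.induct) (auto intro: vac weight_vector_E)

lemma descendant_dominant: "descendant x \<nu> \<Longrightarrow> dominant y \<Longrightarrow> y \<bullet> \<nu> \<le> y \<bullet> \<mu>"
  by (induction rule: descendant.induct)
    (force simp: dominant_def inner_add_right inner_diff_right inner_axis)+

text \<open>Each lowering strictly decreases the pairing with \<open>weyl_vector\<close>; this is
  what gives \<mu> multiplicity one.\<close>

lemma descendant_lower: "descendant x \<nu> \<Longrightarrow> (x = vac \<and> \<nu> = \<mu>) \<or> weyl_vector \<bullet> \<nu> < weyl_vector \<bullet> \<mu>"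
proof (induction rule: descendant.induct)
  case (step x \<nu> j i)
  then show ?case
    using weyl_vector_decreasing[OF step.hyps(2)]
    by (auto simp: inner_add_right inner_diff_right inner_axis)
qed simp

definition descendants :: "(complex^'m) set" where
  "descendants = vec.span {x. \<exists>\<nu>. descendant x \<nu>}"

lemma subspace_descendants: "vec.subspace descendants"
  by (simp add: descendants_def)

lemma descendants_invariant:
  assumes "\<And>x \<nu>. descendant x \<nu> \<Longrightarrow> A *v x \<in> descendants" and "w \<in> descendants"
  shows "A *v w \<in> descendants"
proof -
  have "descendants \<subseteq> {w. A *v w \<in> descendants}"
    unfolding descendants_def
  proof (rule vec.span_minimal)
    show "{x. \<exists>\<nu>. descendant x \<nu>} \<subseteq> {w. A *v w \<in> vec.span {x. \<exists>\<nu>. descendant x \<nu>}}"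
      using assms(1) by (auto simp: descendants_def)
    show "vec.subspace {w. A *v w \<in> vec.span {x. \<exists>\<nu>. descendant x \<nu>}}"
      by (auto simp: vec.subspace_def matrix_vector_right_distrib vec.scale vec.span_zero
          intro: vec.span_add vec.span_scale)
  qed
  then show ?thesis using assms(2) by blast
qed

lemma descendant_in: "descendant x \<nu> \<Longrightarrow> x \<in> descendants"
  unfolding descendants_def by (rule vec.span_base) blast

text \<open>Moving \<open>d\<pi> Z\<close> past a lowering operator leaves the commutator, again a
  value of \<open>d\<pi>\<close>, so the induction runs over all \<open>Z\<close> at once. On
  \<open>vac\<close>, raising gives 0 and diagonal units give multiples.\<close>

lemma d\<pi>_descendant: "descendant x \<nu> \<Longrightarrow> d\<pi> Z *v x \<in> descendants"
proof (induction arbitrary: Z rule: descendant.induct)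
  case base
  have "E i j *v vac \<in> descendants" for i j
  proof (cases i j rule: linorder_cases)
    case less
    then show ?thesis by (simp add: raise_vac vec.subspace_0[OF subspace_descendants])
  next
    case equal
    then show ?thesis
      by (simp add: weight_vector_E_diag[OF vac(2)] vec.subspace_scale[OF subspace_descendants]
          descendant_in[OF descendant.base])
  next
    case greater
    then show ?thesis by (intro descendant_in[OF descendant.step[OF descendant.base]])
  qed
  moreover have "d\<pi> Z *v vac = (\<Sum>i\<in>UNIV. \<Sum>j\<in>UNIV. Z$i$j *s (E i j *v vac))"
    by (subst munit_sum[of Z, symmetric])
      (simp add: d\<pi>_sum d\<pi>_cscale matrix_vector_mult_sum_left cscale_vec)
  ultimately show ?case
    by (simp add: vec.subspace_sum[OF subspace_descendants] vec.subspace_scale[OF subspace_descendants])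
next
  case (step x \<nu> j i)
  have lower: "E i j *v w \<in> descendants" if "w \<in> descendants" for w
    using that by (rule descendants_invariant[rotated]) (intro descendant_in[OF descendant.step] step.hyps)
  have "d\<pi> Z *v (E i j *v x) = E i j *v (d\<pi> Z *v x) + d\<pi> (Z ** munit i j - munit i j ** Z) *v x"
    by (simp add: matrix_vector_mul_assoc d\<pi>_bracket[of Z] matrix_vector_mult_add_rdistrib)
  then show ?case
    using lower step.IH by (simp add: vec.subspace_add[OF subspace_descendants])
qed

text \<open>The elements preserving \<open>descendants\<close> are closed under products; the torus
  scales each descendant, and rotations qualify because their derivative at 0 does.\<close>

lemma rep_descendants:
  assumes "g \<in> carrier SU" "w \<in> descendants"
  shows "\<pi> g *v w \<in> descendants"
proof -
  define N where "N = {g \<in> carrier SU. \<forall>w\<in>descendants. \<pi> g *v w \<in> descendants}"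
  interpret SU_generators N
  proof
    show "a ** b \<in> N" if "a \<in> N" "b \<in> N" for a b
      using that by (auto simp: N_def SU_closed rep_mult[OF rep] simp flip: matrix_vector_mul_assoc)
    show "exp_diagonal h \<in> N" if h: "h \<in> cartan" for h
    proof -
      have "\<pi> (exp_diagonal h) *v x \<in> descendants" if "descendant x \<nu>" for x \<nu>
        using descendant_weight_vector[OF that] h
        by (simp add: weight_vector_def vec.subspace_scale[OF subspace_descendants] descendant_in[OF that])
      then show ?thesis
        using h by (auto simp: N_def exp_diagonal_SU intro: descendants_invariant)
    qed
    show "rot i j 1 t \<in> N" if ij: "i \<noteq> j" for i j t
    proof -
      obtain Y where Y: "tangent (rot_gen i j 1) Y"
          "((\<lambda>s. \<pi> (rot i j 1 s)) has_vector_derivative Y) (at 0)"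
        using tangent_rot[OF ij, of 1] by auto
      have YZ: "Y = d\<pi> (rot_gen i j 1)"
        using dsu_eq[OF Y(1)] d\<pi>_su[OF rot_gen_su[OF ij]] by simp
      have "\<pi> (rot i j 1 t) *v w \<in> descendants" if "w \<in> descendants" for w
      proof (rule one_parameter_group_invariant[OF _ _ Y(2) subspace_descendants _ that])
        show "\<pi> (rot i j 1 (s + t)) = \<pi> (rot i j 1 s) ** \<pi> (rot i j 1 t)" for s t
          by (simp add: rot_add[OF ij] rep_mult[OF rep] rot_SU[OF ij])
        show "\<pi> (rot i j 1 0) = mat 1" by (simp add: rot_zero[OF ij] rep_one[OF rep])
        show "Y *v w \<in> descendants" if "w \<in> descendants" for w
          unfolding YZ by (rule descendants_invariant[OF d\<pi>_descendant that])
      qed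
      then show ?thesis by (simp add: N_def rot_SU[OF ij])
    qed
  qed
  show ?thesis using generates[OF assms(1)] assms(2) by (simp add: N_def)
qed

lemma descendants_UNIV: "descendants = UNIV"
proof -
  have "subrepresentation \<pi> (carrier SU) descendants"
    by (simp add: subrepresentation_def subspace_descendants rep_descendants)
  moreover have "descendants \<noteq> {0}" using descendant_in[OF descendant.base] vac(1) by blast
  ultimately show ?thesis using irr by (auto simp: irreducible_on_def)
qed

subsection \<open>The Casimir operator\<close>

definition casimir :: "complex^'m^'m" where
  "casimir = (\<Sum>i\<in>UNIV. \<Sum>j\<in>UNIV. E i j ** E j i)"

lemma matrix_mult_sum: "A ** (\<Sum>i\<in>I. B i) = (\<Sum>i\<in>I. A ** B i)" "(\<Sum>i\<in>I. B i) ** A = (\<Sum>i\<in>I. B i ** A)"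
  for A :: "complex^'m^'m"
  by (induction I rule: infinite_finite_induct) (auto simp: matrix_add_ldistrib matrix_add_rdistrib)

lemma casimir_commutes: "casimir ** E k l = E k l ** casimir"
proof -
  \<comment> \<open>The four sums of commutator terms cancel in pairs, \<open>?a\<close> with
    \<open>?d\<close> and \<open>?b\<close> with \<open>?c\<close>.\<close>
  let ?a = "\<Sum>i\<in>UNIV. \<Sum>j\<in>UNIV. if j = k then E i l ** E k i else 0"
  let ?b = "\<Sum>i\<in>UNIV. \<Sum>j\<in>UNIV. if l = i then E k j ** E j l else 0"
  let ?c = "\<Sum>i\<in>UNIV. \<Sum>j\<in>UNIV. if i = k then E k j ** E j l else 0"
  let ?d = "\<Sum>i\<in>UNIV. \<Sum>j\<in>UNIV. if l = j then E i l ** E k i else 0"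
  have comm: "(E i j ** E j i) ** E k l = E k l ** (E i j ** E j i)
      + ((if j = k then E i l ** E k i else 0) - (if l = i then E k j ** E j l else 0))
      + ((if i = k then E k j ** E j l else 0) - (if l = j then E i l ** E k i else 0))" for i j
  proof -
    have "(E i j ** E j i) ** E k l = E i j ** (E j i ** E k l)" by (rule matrix_mul_assoc[symmetric])
    also have "\<dots> = (E i j ** E k l) ** E j i + E i j ** (if i = k then E j l else 0)
        - E i j ** (if l = j then E k i else 0)"
      unfolding E_bracket[of j i k l] by (simp add: matrix_add_ldistrib matrix_diff_ldistrib matrix_mul_assoc)
    also have "(E i j ** E k l) ** E j i = E k l ** (E i j ** E j i) + (if j = k then E i l else 0) ** E j i
        - (if l = i then E k j else 0) ** E j i"
      unfolding E_bracket[of i j k l] by (simp add: matrix_add_rdistrib matrix_diff_rdistrib matrix_mul_assoc)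
    finally show ?thesis by auto
  qed
  have "casimir ** E k l = (\<Sum>i\<in>UNIV. \<Sum>j\<in>UNIV. (E i j ** E j i) ** E k l)"
    by (simp add: casimir_def matrix_mult_sum)
  also have "\<dots> = E k l ** casimir
      + (?a - ?b)
      + (?c - ?d)"
    unfolding comm by (simp only: sum.distrib sum_subtractf casimir_def matrix_mult_sum)
  also have "?b = (\<Sum>j\<in>UNIV. E k j ** E j l)"
    by (subst sum.swap) simp
  also have "?c = (\<Sum>j\<in>UNIV. E k j ** E j l)"
    by (subst sum.swap) simp
  finally show ?thesis by simp
qed

definition casimir_value :: real where
  "casimir_value = \<mu> \<bullet> \<mu> + 2 * (\<mu> \<bullet> weyl_vector)"

lemma casimir_vac: "casimir *v vac = of_real casimir_value *s vac"
proof -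
  have diag: "(E i i ** E i i) *v vac = of_real (\<mu>$i * \<mu>$i) *s vac" for i
    by (simp add: weight_vector_E_diag[OF vac(2)] vec.scale flip: matrix_vector_mul_assoc)
  have pair: "(E i j ** E j i + E j i ** E i j) *v vac = of_real (\<mu>$i - \<mu>$j) *s vac" if ij: "i < j" for i j
  proof -
    \<comment> \<open>\<open>E i j\<close> raises for \<open>i < j\<close>, so it is moved to the
      right where it kills \<open>vac\<close>; the commutator contributes the root term.\<close>
    have eq: "E i j ** E j i + E j i ** E i j = E j i ** E i j + E j i ** E i j + (E i i - E j j)"
      by (simp add: E_bracket[of i j j i])
    have "(E j i ** E i j) *v vac = 0" by (simp add: raise_vac[OF ij] flip: matrix_vector_mul_assoc)
    then show ?thesis
      unfolding eq matrix_vector_mult_add_rdistrib matrix_vector_mult_diff_rdistrib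
      by (simp add: weight_vector_E_diag[OF vac(2)] vec.scale_left_diff_distrib)
  qed
  have "casimir *v vac = (\<Sum>i\<in>UNIV. (E i i ** E i i) *v vac) +
      (\<Sum>(i,j)\<in>{(i,j). i < j}. (E i j ** E j i + E j i ** E i j) *v vac)"
    unfolding casimir_def sum_diagonal_pairs
    by (simp add: matrix_vector_mult_add_rdistrib matrix_vector_mult_sum_left case_prod_unfold)
  also have "(\<Sum>(i,j)\<in>{(i,j). i < j}. (E i j ** E j i + E j i ** E i j) *v vac)
      = (\<Sum>(i,j)\<in>{(i,j). i < j}. of_real (\<mu>$i - \<mu>$j) *s vac)"
    by (rule sum.cong) (auto simp: pair)
  finally show ?thesis
    unfolding diag casimir_value_def inner_weyl_vector
    by (simp add: inner_vec_def vec.scale_left_distrib vec.scale_sum_left case_prod_unfold)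
qed

text \<open>The operator commutes with lowering, so its value on \<open>vac\<close> propagates to
  all descendants, and these span the space.\<close>

lemma casimir_scalar: "casimir = of_real casimir_value *\<^sub>C mat 1"
proof -
  define C where "C = casimir - of_real casimir_value *\<^sub>C mat 1"
  have C: "C *v x = casimir *v x - of_real casimir_value *s x" for x
    by (simp add: C_def matrix_vector_mult_diff_rdistrib cscale_vec)
  have "C *v x = 0" if "descendant x \<nu>" for x \<nu>
    using that
  proof (induction rule: descendant.induct)
    case (step x \<nu> j i)
    have "casimir *v (E i j *v x) = E i j *v (casimir *v x)"
      by (simp add: matrix_vector_mul_assoc casimir_commutes)
    then show ?case using step.IH by (simp add: C vec.scale)
  qed (simp add: C casimir_vac)
  then have "{x. \<exists>\<nu>. descendant x \<nu>} \<subseteq> {x. C *v x = 0}" by auto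
  moreover have "vec.subspace {x. C *v x = 0}"
    by (auto simp: vec.subspace_def matrix_vector_right_distrib vec.scale)
  ultimately have "descendants \<subseteq> {x. C *v x = 0}"
    unfolding descendants_def by (rule vec.span_minimal)
  then have "C *v x = 0 *v x" for x using descendants_UNIV by auto
  then have "C = 0" unfolding matrix_eq by simp
  then show ?thesis by (simp add: C_def)
qed

subsection \<open>The character\<close>

lemma weight_basis:
  obtains B \<nu> where "vec.independent B" "vec.span B = UNIV" "finite B" "vac \<in> B" "\<nu> vac = \<mu>"
    "\<And>b. b \<in> B \<Longrightarrow> weight_vector (\<nu> b) b"
    "\<And>b. b \<in> B \<Longrightarrow> b \<noteq> vac \<Longrightarrow> weyl_vector \<bullet> \<nu> b < weyl_vector \<bullet> \<mu>"
    "\<And>b y. b \<in> B \<Longrightarrow> dominant y \<Longrightarrow> y \<bullet> \<nu> b \<le> y \<bullet> \<mu>"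
proof -
  let ?S = "{x. \<exists>\<nu>. descendant x \<nu>}"
  have "{vac} \<subseteq> ?S" using descendant.base by auto
  moreover have "vec.independent {vac}" using vac(1) by simp
  ultimately obtain B where B: "{vac} \<subseteq> B" "B \<subseteq> ?S" "vec.independent B" "?S \<subseteq> vec.span B"
    by (rule vec.maximal_independent_subset_extend)
  have "descendants \<subseteq> vec.span B"
    unfolding descendants_def by (rule vec.span_minimal) (use B in auto)
  then have span: "vec.span B = UNIV" using descendants_UNIV by auto
  \<comment> \<open>A vector could be a descendant with several weights, so one is chosen;
    \<open>vac\<close> is pinned to \<mu>.\<close>
  define \<nu> where "\<nu> b = (if b = vac then \<mu> else SOME \<nu>. descendant b \<nu>)" for b
  have \<nu>: "descendant b (\<nu> b)" if "b \<in> B" for b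
    using B(2) that descendant.base by (auto simp: \<nu>_def intro: someI_ex)
  show ?thesis
  proof (rule that[of B \<nu>])
    show "weyl_vector \<bullet> \<nu> b < weyl_vector \<bullet> \<mu>" if "b \<in> B" "b \<noteq> vac" for b
      using descendant_lower[OF \<nu>[OF that(1)]] that(2) by simp
    show "y \<bullet> \<nu> b \<le> y \<bullet> \<mu>" if "b \<in> B" "dominant y" for b y
      using \<nu>[OF that(1)] that(2) by (rule descendant_dominant)
    show "weight_vector (\<nu> b) b" if "b \<in> B" for b
      using \<nu>[OF that] by (rule descendant_weight_vector)
    show "\<nu> vac = \<mu>" by (simp add: \<nu>_def)
  qed (use B span vec.finiteI_independent[OF B(3)] in auto)
qed

text \<open>Kept undivided, so it holds on all of \<open>cartan\<close>; division waits for a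
  regular \<open>h\<close>.\<close>

lemma trace_E_E:
  assumes h: "h \<in> cartan"
  shows "(1 - exp (h$i - h$j)) * trace (E i j ** E j i ** \<pi> (exp_diagonal h))
    = - exp (h$i - h$j) * trace ((E i i - E j j) ** \<pi> (exp_diagonal h))"
proof -
  define T where "T = \<pi> (exp_diagonal h)"
  define z where "z = exp (h$i - h$j)"
  have 1: "(E j i ** T) ** E i j = z *\<^sub>C (E j i ** E i j ** T)"
    using torus_E[OF h, of i j] by (simp add: T_def z_def cscale_mult flip: matrix_mul_assoc)
  have 2: "E j i ** E i j = E i j ** E j i - (E i i - E j j)"
    using E_bracket[of i j j i] by simp
  have "trace (E i j ** E j i ** T) = trace ((E j i ** T) ** E i j)"
    unfolding matrix_mul_assoc[symmetric, of "E i j"] by (rule trace_mul_sym)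
  then have "trace (E i j ** E j i ** T) = z * (trace (E i j ** E j i ** T) - trace ((E i i - E j j) ** T))"
    unfolding 1 2 by (simp only: trace_cscale matrix_diff_rdistrib trace_sub)
  then show ?thesis by (simp add: T_def z_def algebra_simps)
qed

text \<open>Transposing two torus entries is conjugation by a quarter turn in their plane, which has
  determinant 1 where the permutation matrix has -1.\<close>

lemma character_permute:
  assumes "w permutes UNIV" and "h \<in> cartan"
  shows "character \<pi> (exp_diagonal (\<chi> i. h$w i)) = character \<pi> (exp_diagonal h)"
  using assms(1) finite[of "UNIV :: 'n set"] assms(2)
proof (induction w arbitrary: h rule: permutes_induct)
  case (swap a b p)
  have ab: "a \<noteq> b" by (rule swap.hyps(3))
  let ?t = "Transposition.transpose a b"
  have "(\<chi> i. h$?t i) \<in> cartan"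
    using swap.prems by (intro cartan_permute) (simp_all add: permutes_swap_id)
  from swap.IH[OF this]
  have "character \<pi> (exp_diagonal (\<chi> i. h$(?t \<circ> p) i)) = character \<pi> (exp_diagonal (\<chi> i. h$?t i))"
    by simp
  also have "exp_diagonal (\<chi> i. h$?t i) = rot a b 1 (pi / 2) ** exp_diagonal h ** ctranspose (rot a b 1 (pi / 2))"
  proof -
    have "((rot a b 1 (pi / 2) ** exp_diagonal h) ** rot a b 1 (- (pi / 2)))$i$j
        = exp_diagonal (\<chi> i. h$?t i)$i$j" for i j
    proof -
      have "((rot a b 1 (pi / 2) ** exp_diagonal h) ** rot a b 1 (- (pi / 2)))$i$j
          = (\<Sum>k\<in>UNIV. rot a b 1 (pi / 2)$i$k * (exp (h$k) * rot a b 1 (- (pi / 2))$k$j))"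
        by (simp add: matrix_matrix_mult_def[of _ "rot a b 1 (- (pi / 2))"] exp_diagonal_def
            mult_diagonal_nth mult.assoc)
      then show ?thesis
        unfolding rot_row_sum[OF ab] using ab
        by (auto simp: rot_def exp_diagonal_nth Transposition.transpose_def)
    qed
    then show ?thesis by (simp add: vec_eq_iff ctranspose_rot[OF ab])
  qed
  also have "character \<pi> \<dots> = character \<pi> (exp_diagonal h)"
    by (rule character_conj) (simp_all add: rot_SU ab exp_diagonal_SU swap.prems)
  finally show ?case .
qed (simp_all add: id_def vec_lambda_eta)

theorem weyl_character_formula:
  assumes h: "h \<in> cartan"
  shows "character \<pi> (exp_diagonal h) * alternating_sum weyl_vector h = alternating_sum (\<mu> + weyl_vector) h"
proof -
  obtain B \<nu> where ind: "vec.independent B" and span: "vec.span B = UNIV" and fin: "finite B"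
    and B: "vac \<in> B" "\<nu> vac = \<mu>"
    and wv: "\<And>b. b \<in> B \<Longrightarrow> weight_vector (\<nu> b) b"
    and lower: "\<And>b. b \<in> B \<Longrightarrow> b \<noteq> vac \<Longrightarrow> weyl_vector \<bullet> \<nu> b < weyl_vector \<bullet> \<mu>"
    and dom: "\<And>b y. b \<in> B \<Longrightarrow> dominant y \<Longrightarrow> y \<bullet> \<nu> b \<le> y \<bullet> \<mu>"
    by (rule weight_basis) (rule that; assumption)
  have char: "character \<pi> (exp_diagonal h) = (\<Sum>b\<in>B. exp (pairing (\<nu> b) h))" if "h \<in> cartan" for h
    unfolding character_def
    by (rule trace_eigenbasis[OF ind span]) (use wv that in \<open>simp add: weight_vector_def\<close>)
  have "(\<Sum>b\<in>B. exp (pairing (\<nu> b) h)) * alternating_sum weyl_vector h = alternating_sum (\<mu> + weyl_vector) h"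
  proof (rule weight_sum_times_denominator[where ?b0.0=vac])
    show "(\<Sum>i\<in>UNIV. \<nu> b$i) = 0" if "b \<in> B" for b
      using wv[OF that] by (simp add: weight_vector_def)
    show "(\<Sum>b\<in>B. exp (pairing (\<nu> b) (\<chi> i. h$w i))) = (\<Sum>b\<in>B. exp (pairing (\<nu> b) h))"
      if "h \<in> cartan" "w permutes UNIV" for h w
      using character_permute[OF that(2,1)] char cartan_permute[OF that(2,1)] that(1) by simp
  next
    fix h :: "complex^'n::_"
    assume h: "h \<in> cartan" and reg: "\<And>i k. i \<noteq> k \<Longrightarrow> exp (h$i) \<noteq> exp (h$k)"
    define T where "T = \<pi> (exp_diagonal h)"
    define e where "e b = exp (pairing (\<nu> b) h)" for b
    define x where "x i = exp (h$i)" for i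
    let ?c = "\<lambda>b z. of_real (\<nu> b$fst z - \<nu> b$snd z) * (x (fst z) + x (snd z)) / (x (fst z) - x (snd z))"
    let ?C = "\<lambda>i j. trace (E i j ** E j i ** T)"
    have T: "T *v b = e b *s b" if "b \<in> B" for b
      using wv[OF that] h by (simp add: weight_vector_def T_def e_def)
    have diag: "trace (E i i ** E i i ** T) = (\<Sum>b\<in>B. of_real (\<nu> b$i * \<nu> b$i) * e b)" for i
      by (rule trace_eigenbasis[OF ind span])
        (simp add: T weight_vector_E_diag[OF wv] vec.scale mult_ac flip: matrix_vector_mul_assoc)
    have root: "trace ((E i i - E j j) ** T) = (\<Sum>b\<in>B. of_real (\<nu> b$i - \<nu> b$j) * e b)" for i j
      by (rule trace_eigenbasis[OF ind span])
        (simp add: T weight_vector_E_diag[OF wv] vec.scale matrix_vector_mult_diff_rdistrib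
          vec.scale_left_diff_distrib algebra_simps flip: matrix_vector_mul_assoc)
    have off: "?C i j = x i / (x i - x j) * trace ((E i i - E j j) ** T)"
      if ij: "i \<noteq> j" for i j
    proof -
      define a r where "a = ?C i j" and "r = trace ((E i i - E j j) ** T)"
      have nz: "x j \<noteq> 0" "x i - x j \<noteq> 0" using reg[OF ij] by (simp_all add: x_def)
      have "(1 - x i / x j) * a = - (x i / x j) * r"
        using trace_E_E[OF h, of i j] by (simp add: x_def T_def exp_diff a_def r_def)
      then have "x j * ((1 - x i / x j) * a) = x j * (- (x i / x j) * r)" by (rule arg_cong)
      then have "(x i - x j) * a = x i * r"
        using nz(1) by (simp add: algebra_simps add_eq_0_iff)
      then have "a = x i / (x i - x j) * r" using nz by (simp add: nonzero_eq_divide_eq mult.commute)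
      then show ?thesis by (simp only: a_def r_def)
    qed
    \<comment> \<open>Exchanging \<open>i\<close> and \<open>j\<close> changes the sign of the root
      trace, so the two fractions combine to \<open>(x i + x j) / (x i - x j)\<close>, the factor in
      the logarithmic derivative of the denominator.\<close>
    have pair: "?C i j + ?C j i
        = (\<Sum>b\<in>B. of_real (\<nu> b$i - \<nu> b$j) * (x i + x j) / (x i - x j) * e b)" if ij: "i < j" for i j
    proof -
      define s where "s = (\<Sum>b\<in>B. of_real (\<nu> b$i - \<nu> b$j) * e b)"
      have s': "(\<Sum>b\<in>B. of_real (\<nu> b$j - \<nu> b$i) * e b) = - s"
        unfolding s_def sum_negf[symmetric] by (rule sum.cong) (simp_all add: algebra_simps)
      have "?C i j + ?C j i = x i / (x i - x j) * s - x j / (x j - x i) * s"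
      proof -
        have "i \<noteq> j" "j \<noteq> i" using ij by auto
        then show ?thesis
          unfolding off[OF \<open>i \<noteq> j\<close>] off[OF \<open>j \<noteq> i\<close>] root s' s_def[symmetric] by simp
      qed
      also have "\<dots> = (x i + x j) / (x i - x j) * s"
      proof -
        have "x j / (x j - x i) = - (x j / (x i - x j))"
          by (simp only: minus_divide_right minus_diff_eq)
        then show ?thesis by (simp add: add_divide_distrib distrib_right)
      qed
      also have "\<dots> = (\<Sum>b\<in>B. of_real (\<nu> b$i - \<nu> b$j) * (x i + x j) / (x i - x j) * e b)"
        unfolding s_def sum_distrib_left by (rule sum.cong) simp_all
      finally show ?thesis .
    qed
    \<comment> \<open>The trace of the Casimir operator times \<open>T\<close> is computed twice: as
      a scalar and summand by summand.\<close>
    have "of_real casimir_value * (\<Sum>b\<in>B. e b) = trace (casimir ** T)"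
      using char[OF h] by (simp add: casimir_scalar cscale_mult trace_cscale T_def e_def character_def)
    also have "\<dots> = (\<Sum>i\<in>UNIV. \<Sum>j\<in>UNIV. ?C i j)"
    proof -
      have ts: "trace (\<Sum>i\<in>I. A i) = (\<Sum>i\<in>I. trace (A i))" for I and A :: "'n \<Rightarrow> complex^'m^'m"
        unfolding trace_def sum_component by (rule sum.swap)
      show ?thesis by (simp add: casimir_def matrix_mult_sum ts)
    qed
    also have "\<dots> = (\<Sum>i\<in>UNIV. \<Sum>b\<in>B. of_real (\<nu> b$i * \<nu> b$i) * e b) +
        (\<Sum>z\<in>{(i,j). i < j}. \<Sum>b\<in>B. ?c b z * e b)"
      unfolding sum_diagonal_pairs diag
      by (rule arg_cong2[where f="(+)", OF refl], rule sum.cong) (auto simp: pair)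
    also have "\<dots> = (\<Sum>b\<in>B. (of_real (\<nu> b \<bullet> \<nu> b) +
        (\<Sum>z\<in>{(i,j). i < j}. ?c b z)) * e b)"
      by (subst sum.swap, subst (2) sum.swap)
        (simp add: inner_vec_def distrib_right sum.distrib sum_distrib_right)
    finally show "(\<Sum>b\<in>B. (of_real (\<nu> b \<bullet> \<nu> b) + (\<Sum>(i,k)\<in>{(i,k). i < k}.
          of_real (\<nu> b$i - \<nu> b$k) * (exp (h$i) + exp (h$k)) / (exp (h$i) - exp (h$k)))) *
        exp (pairing (\<nu> b) h))
      = of_real (\<mu> \<bullet> \<mu> + 2 * (\<mu> \<bullet> weyl_vector)) * (\<Sum>b\<in>B. exp (pairing (\<nu> b) h))"
      by (simp add: casimir_value_def e_def x_def case_prod_unfold)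
  qed (use fin B lower dom h in auto)
  then show ?thesis by (simp add: char[OF h])
qed

end

section \<open>Inaccessibility, multiplicity and the character together\<close>

theorem proposition1:
  fixes \<pi> :: "complex^'n::{finite,linorder}^'n::{finite,linorder} \<Rightarrow> complex^'m^'m"
    and \<Phi> :: "complex^'m \<Rightarrow> complex^'h^'h"
    and \<mu> :: "real^'n::{finite,linorder}"
    and G :: "(complex^'n::{finite,linorder}^'n::{finite,linorder}) set"
  assumes "is_representation \<pi>"
    and "irreducible_on \<pi> (carrier SU) UNIV"
    and "nontrivial \<pi>"
    and "highest_weight \<pi> \<mu>"
    and "subgroup G SU"
    and "finite G"
  shows "(\<exists>D. irreducible_decomposition \<pi> G D) \<and>
    (\<forall>D. irreducible_decomposition \<pi> G D \<longrightarrow>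
       (inaccessible_symmetry \<pi> \<Phi> G \<longleftrightarrow> \<not> (\<exists>W\<in>D. trivial_irrep_on \<pi> G W)) \<and>
       of_nat (card {W\<in>D. trivial_irrep_on \<pi> G W}) =
         1 / of_nat (card G) * (\<Sum>g\<in>G. character \<pi> g)) \<and>
    (inaccessible_symmetry \<pi> \<Phi> G \<longleftrightarrow>
       1 / of_nat (card G) * (\<Sum>g\<in>G. character \<pi> g) = 0) \<and>
    given_by_weyl_formula \<mu> (character \<pi>)"
proof -
  interpret finite_rep \<pi> G using assms(1,5,6) by (rule finite_rep.intro)
  interpret W: highest_weight_rep \<pi> \<mu>
    using assms(1,2,4) by (intro highest_weight_rep.intro su_rep.intro highest_weight_rep_axioms.intro)
  let ?I = "invariants \<pi> G"
  have acc: "inaccessible_symmetry \<pi> \<Phi> G \<longleftrightarrow> vec.dim ?I = 0"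
  proof -
    have "vec.dim ?I = 0 \<longleftrightarrow> ?I = {0}"
      using vec.dim_eq_0[of ?I] vec.subspace_0[OF subspace_invariants] by blast
    then show ?thesis using inaccessible_symmetry_iff[OF assms(1-3)] by blast
  qed
  have mult: "of_nat (card {W\<in>D. trivial_irrep_on \<pi> G W}) =
      1 / of_nat (card G) * (\<Sum>g\<in>G. character \<pi> g)"
    and none: "inaccessible_symmetry \<pi> \<Phi> G \<longleftrightarrow> \<not> (\<exists>W\<in>D. trivial_irrep_on \<pi> G W)"
    if D: "irreducible_decomposition \<pi> G D" for D
  proof -
    have "finite D" using D by (simp add: irreducible_decomposition_def)
    then show "inaccessible_symmetry \<pi> \<Phi> G \<longleftrightarrow> \<not> (\<exists>W\<in>D. trivial_irrep_on \<pi> G W)"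
      unfolding acc card_trivial_irreps[OF D, symmetric] by auto
    show "of_nat (card {W\<in>D. trivial_irrep_on \<pi> G W}) =
      1 / of_nat (card G) * (\<Sum>g\<in>G. character \<pi> g)"
      unfolding card_trivial_irreps[OF D] by (rule dim_invariants)
  qed
  \<comment> \<open>The average is the image of a natural number in the complex field, so it
    vanishes exactly when the dimension does.\<close>
  have avg_zero: "inaccessible_symmetry \<pi> \<Phi> G \<longleftrightarrow> 1 / of_nat (card G) * (\<Sum>g\<in>G. character \<pi> g) = 0"
    unfolding acc dim_invariants[symmetric] by simp
  have "given_by_weyl_formula \<mu> (character \<pi>)"
    unfolding given_by_weyl_formula_def
  proof (intro conjI ballI)
    have regular: "character \<pi> (exp_diagonal h) = weyl_quotient \<mu> h" if "h \<in> weyl_regular" for h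
      using W.weyl_character_formula[of h] that
      by (simp add: weyl_regular_def weyl_quotient_def nonzero_eq_divide_eq)
    show "character \<pi> (exp_diagonal h) = weyl_quotient \<mu> h" if "h \<in> weyl_regular" for h
      using that by (rule regular)
    \<comment> \<open>The character is continuous on the torus and agrees with the quotient at
      regular points, which gives the limit also at singular ones.\<close>
    show "(weyl_quotient \<mu> \<longlongrightarrow> character \<pi> (exp_diagonal h)) (at h within weyl_regular)"
      if h: "h \<in> cartan" for h
    proof -
      have "continuous_on cartan (\<lambda>h. \<pi> (exp_diagonal h))"
      proof (rule continuous_on_compose2[of "carrier SU" \<pi> _ exp_diagonal])
        show "continuous_on (carrier SU) \<pi>" using assms(1) by (simp add: is_representation_def)
        show "continuous_on cartan exp_diagonal" by (rule continuous_exp_diagonal)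
      qed (auto simp: exp_diagonal_SU)
      then have "continuous_on cartan (\<lambda>h. character \<pi> (exp_diagonal h))"
        unfolding character_def trace_def by (intro continuous_intros)
      then have "((\<lambda>h. character \<pi> (exp_diagonal h)) \<longlongrightarrow> character \<pi> (exp_diagonal h)) (at h within cartan)"
        using h by (simp add: continuous_on_def)
      then have "((\<lambda>h. character \<pi> (exp_diagonal h)) \<longlongrightarrow> character \<pi> (exp_diagonal h)) (at h within weyl_regular)"
        by (rule tendsto_within_subset) (auto simp: weyl_regular_def)
      then show ?thesis
        by (rule Lim_transform_within[OF _ zero_less_one]) (simp add: regular)
    qed
    show "character \<pi> (u ** g ** matrix_inv u) = character \<pi> g"
      if "g \<in> carrier SU" "u \<in> carrier SU" for g u
      using that by (simp add: matrix_inv_SU W.character_conj)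
  qed
  then show ?thesis using ex_irreducible_decomposition mult none avg_zero by blast
qed

end
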